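(* Let $\mathcal{A}$ be an abelian category and let $(\mathcal{X},\mathcal{Y})$ be a balanced pair of additive subcategories in $\mathcal{A}$ which is admissible and of finite dimension. Then there is a triangle-equivalence $\mathbf{K}(\mathcal{X})\simeq \mathbf{K}(\mathcal{Y})$.
   Context: All subcategories of $\mathcal{A}$ are full additive subcategories closed under taking direct summands. For an additive category $\mathfrak{a}$, $\mathbf{K}(\mathfrak{a})$ denotes the homotopy category of (unbounded) complexes in $\mathfrak{a}$, with its canonical triangulated structure. A right $\mathcal{X}$-approximation of $M\in\mathcal{A}$ is a morphism $\theta\colon X\to M$ with $X\in\mathcal{X}$ such that every morphism from an object of $\mathcal{X}$ to $M$ factors through $\theta$. $\mathcal{X}$ is contravariantly finite if every object of $\mathcal{A}$ has a right $\mathcal{X}$-approximation. Dually: left $\mathcal{Y}$-approximation, covariantly finite subcategory. For $\mathcal{X}$ contravariantly finite, an $\mathcal{X}$-resolution $X^\bullet\to M$ of $M$ is a complex $\cdots\to X^{-2}\to X^{-1}\to X^0\to M\to 0$ with all $X^i\in\mathcal{X}$ which becomes acyclic after applying $\mathrm{Hom}_{\mathcal{A}}(X,-)$ for each $X\in\mathcal{X}$. The $\mathcal{X}$-resolution dimension of $M$ is the minimal $n\ge 0$ such that there is an $\mathcal{X}$-resolution $0\to X^{-n}\to\cdots\to X^0\to M\to 0$ ($\infty$ if there is none), and $\mathcal{X}\text{-res.dim}\,\mathcal{A}$ is the supremum of these over all $M\in\mathcal{A}$. Dually, for $\mathcal{Y}$ covariantly finite, a $\mathcal{Y}$-coresolution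 $N\to Y^\bullet$ is a complex $0\to N\to Y^0\to Y^1\to\cdots$ with all $Y^i\in\mathcal{Y}$ which becomes acyclic after applying $\mathrm{Hom}_{\mathcal{A}}(-,Y)$ for each $Y\in\mathcal{Y}$; $\mathcal{Y}\text{-cores.dim}\,\mathcal{A}$ is defined dually. A pair $(\mathcal{X},\mathcal{Y})$ is a balanced pair if: (BP0) $\mathcal{X}$ is contravariantly finite and $\mathcal{Y}$ is covariantly finite; (BP1) each object $M$ has an $\mathcal{X}$-resolution $X^\bullet\to M$ (regarded as the augmented complex) which is acyclic after applying $\mathrm{Hom}_{\mathcal{A}}(-,Y)$ for all $Y\in\mathcal{Y}$; (BP2) each object $N$ has a $\mathcal{Y}$-coresolution $N\to Y^\bullet$ (regarded as the augmented complex) which is acyclic after applying $\mathrm{Hom}_{\mathcal{A}}(X,-)$ for all $X\in\mathcal{X}$. A contravariantly finite $\mathcal{X}$ is admissible if each right $\mathcal{X}$-approximation is epic; a covariantly finite $\mathcal{Y}$ is coadmissible if each left $\mathcal{Y}$-approximation is monic. For a balanced pair, $\mathcal{X}$ is admissible if and only if $\mathcal{Y}$ is coadmissible, and the balanced pair is then called admissible. For an admissible balanced pair one has $\mathcal{X}\text{-res.dim}\,\mathcal{A}=\mathcal{Y}\text{-cores.dim}\,\mathcal{A}$; the pair is of finite dimension if both are finite. *)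

theory Defs
  imports "HOL-Algebra.Group" "HOL-Library.Extended_Nat"
begin

section \<open>Abelian categories\<close>

text \<open>
  Categories are records over explicit carriers, in the style of HOL-Algebra. All operations are
  total functions, but they are only meaningful (and only constrained by the locales) on objects
  and composable or parallel arrows of the category.
\<close>

record ('o, 'm) cat =
  Ob :: "'o set"
  Arr :: "'m set"
  Dom :: "'m \<Rightarrow> 'o"
  Cod :: "'m \<Rightarrow> 'o"
  Id :: "'o \<Rightarrow> 'm"
  Comp :: "'m \<Rightarrow> 'm \<Rightarrow> 'm" (infixl "\<cdot>\<index>" 70)

definition Hom :: "('o, 'm, 'z) cat_scheme \<Rightarrow> 'o \<Rightarrow> 'o \<Rightarrow> 'm set" where
  "Hom C a b = {f \<in> Arr C. Dom C f = a \<and> Cod C f = b}"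

locale category =
  fixes C :: "('o, 'm, 'z) cat_scheme" (structure)
  assumes Dom_in: "f \<in> Arr C \<Longrightarrow> Dom C f \<in> Ob C"
    and Cod_in: "f \<in> Arr C \<Longrightarrow> Cod C f \<in> Ob C"
    and Id_in: "a \<in> Ob C \<Longrightarrow> Id C a \<in> Hom C a a"
    and Comp_in: "f \<in> Hom C a b \<Longrightarrow> g \<in> Hom C b c \<Longrightarrow> g \<cdot> f \<in> Hom C a c"
    and Id_left: "f \<in> Hom C a b \<Longrightarrow> Id C b \<cdot> f = f"
    and Id_right: "f \<in> Hom C a b \<Longrightarrow> f \<cdot> Id C a = f"
    and Comp_assoc: "f \<in> Hom C a b \<Longrightarrow> g \<in> Hom C b c \<Longrightarrow> h \<in> Hom C c d
                       \<Longrightarrow> (h \<cdot> g) \<cdot> f = h \<cdot> (g \<cdot> f)"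

definition iso_arr :: "('o, 'm, 'z) cat_scheme \<Rightarrow> 'm \<Rightarrow> bool" where
  "iso_arr C f \<longleftrightarrow> f \<in> Arr C \<and>
     (\<exists>g \<in> Hom C (Cod C f) (Dom C f).
        g \<cdot>\<^bsub>C\<^esub> f = Id C (Dom C f) \<and> f \<cdot>\<^bsub>C\<^esub> g = Id C (Cod C f))"

definition monic :: "('o, 'm, 'z) cat_scheme \<Rightarrow> 'm \<Rightarrow> bool" where
  "monic C f \<longleftrightarrow> f \<in> Arr C \<and>
     (\<forall>a \<in> Ob C. \<forall>u \<in> Hom C a (Dom C f). \<forall>v \<in> Hom C a (Dom C f).
        f \<cdot>\<^bsub>C\<^esub> u = f \<cdot>\<^bsub>C\<^esub> v \<longrightarrow> u = v)"

definition epic :: "('o, 'm, 'z) cat_scheme \<Rightarrow> 'm \<Rightarrow> bool" where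
  "epic C f \<longleftrightarrow> f \<in> Arr C \<and>
     (\<forall>a \<in> Ob C. \<forall>u \<in> Hom C (Cod C f) a. \<forall>v \<in> Hom C (Cod C f) a.
        u \<cdot>\<^bsub>C\<^esub> f = v \<cdot>\<^bsub>C\<^esub> f \<longrightarrow> u = v)"

definition zero_object :: "('o, 'm, 'z) cat_scheme \<Rightarrow> 'o \<Rightarrow> bool" where
  "zero_object C z \<longleftrightarrow> z \<in> Ob C \<and>
     (\<forall>a \<in> Ob C. (\<exists>!f. f \<in> Hom C a z) \<and> (\<exists>!f. f \<in> Hom C z a))"

record ('o, 'm) precat = "('o, 'm) cat" +
  Zero :: "'o \<Rightarrow> 'o \<Rightarrow> 'm"
  Add :: "'m \<Rightarrow> 'm \<Rightarrow> 'm" (infixl "\<boxplus>\<index>" 65)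

definition hom_group :: "('o, 'm, 'z) precat_scheme \<Rightarrow> 'o \<Rightarrow> 'o \<Rightarrow> 'm monoid" where
  "hom_group C a b = \<lparr>carrier = Hom C a b, mult = Add C, one = Zero C a b\<rparr>"

definition neg :: "('o, 'm, 'z) precat_scheme \<Rightarrow> 'm \<Rightarrow> 'm" where
  "neg C f = inv\<^bsub>hom_group C (Dom C f) (Cod C f)\<^esub> f"

locale preadditive_category = category C
  for C :: "('o, 'm, 'z) precat_scheme" (structure) +
  assumes hom_comm_group: "a \<in> Ob C \<Longrightarrow> b \<in> Ob C \<Longrightarrow> comm_group (hom_group C a b)"
    and Comp_Add_right: "f \<in> Hom C a b \<Longrightarrow> f' \<in> Hom C a b \<Longrightarrow> g \<in> Hom C b c
                           \<Longrightarrow> g \<cdot> (f \<boxplus> f') = g \<cdot> f \<boxplus> g \<cdot> f'"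
    and Comp_Add_left: "f \<in> Hom C a b \<Longrightarrow> g \<in> Hom C b c \<Longrightarrow> g' \<in> Hom C b c
                          \<Longrightarrow> (g \<boxplus> g') \<cdot> f = g \<cdot> f \<boxplus> g' \<cdot> f"

definition biproduct ::
  "('o, 'm, 'z) precat_scheme \<Rightarrow> 'o \<Rightarrow> 'o \<Rightarrow> 'o \<Rightarrow> 'm \<Rightarrow> 'm \<Rightarrow> 'm \<Rightarrow> 'm \<Rightarrow> bool" where
  "biproduct C a b s i1 i2 p1 p2 \<longleftrightarrow>
     a \<in> Ob C \<and> b \<in> Ob C \<and> s \<in> Ob C \<and>
     i1 \<in> Hom C a s \<and> i2 \<in> Hom C b s \<and> p1 \<in> Hom C s a \<and> p2 \<in> Hom C s b \<and>
     p1 \<cdot>\<^bsub>C\<^esub> i1 = Id C a \<and> p2 \<cdot>\<^bsub>C\<^esub> i2 = Id C b \<and>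
     p1 \<cdot>\<^bsub>C\<^esub> i2 = Zero C b a \<and> p2 \<cdot>\<^bsub>C\<^esub> i1 = Zero C a b \<and>
     i1 \<cdot>\<^bsub>C\<^esub> p1 \<boxplus>\<^bsub>C\<^esub> i2 \<cdot>\<^bsub>C\<^esub> p2 = Id C s"

locale additive_category = preadditive_category +
  assumes ex_zero_object: "\<exists>z. zero_object C z"
    and ex_biproduct: "a \<in> Ob C \<Longrightarrow> b \<in> Ob C \<Longrightarrow> \<exists>s i1 i2 p1 p2. biproduct C a b s i1 i2 p1 p2"

definition is_kernel :: "('o, 'm, 'z) precat_scheme \<Rightarrow> 'm \<Rightarrow> 'm \<Rightarrow> bool" where
  "is_kernel C f k \<longleftrightarrow>
     f \<in> Arr C \<and> k \<in> Arr C \<and> Cod C k = Dom C f \<and>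
     f \<cdot>\<^bsub>C\<^esub> k = Zero C (Dom C k) (Cod C f) \<and>
     (\<forall>a \<in> Ob C. \<forall>u \<in> Hom C a (Dom C f). f \<cdot>\<^bsub>C\<^esub> u = Zero C a (Cod C f) \<longrightarrow>
        (\<exists>!v. v \<in> Hom C a (Dom C k) \<and> k \<cdot>\<^bsub>C\<^esub> v = u))"

definition is_cokernel :: "('o, 'm, 'z) precat_scheme \<Rightarrow> 'm \<Rightarrow> 'm \<Rightarrow> bool" where
  "is_cokernel C f q \<longleftrightarrow>
     f \<in> Arr C \<and> q \<in> Arr C \<and> Dom C q = Cod C f \<and>
     q \<cdot>\<^bsub>C\<^esub> f = Zero C (Dom C f) (Cod C q) \<and>
     (\<forall>a \<in> Ob C. \<forall>u \<in> Hom C (Cod C f) a. u \<cdot>\<^bsub>C\<^esub> f = Zero C (Dom C f) a \<longrightarrow>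
        (\<exists>!v. v \<in> Hom C (Cod C q) a \<and> v \<cdot>\<^bsub>C\<^esub> q = u))"

locale abelian_category = additive_category +
  assumes ex_kernel: "f \<in> Arr C \<Longrightarrow> \<exists>k. is_kernel C f k"
    and ex_cokernel: "f \<in> Arr C \<Longrightarrow> \<exists>q. is_cokernel C f q"
    and monic_is_kernel: "monic C k \<Longrightarrow> \<exists>f. is_kernel C f k"
    and epic_is_cokernel: "epic C q \<Longrightarrow> \<exists>f. is_cokernel C f q"

text \<open>
  A full subcategory is given by its set of objects. The last condition (closure under direct
  summands) entails closure under isomorphism, since an isomorphic object is a summand with zero
  complement.
\<close>

definition additive_subcategory :: "('o, 'm, 'z) precat_scheme \<Rightarrow> 'o set \<Rightarrow> bool" where
  "additive_subcategory A \<X> \<longleftrightarrow>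
     \<X> \<subseteq> Ob A \<and>
     (\<exists>z \<in> \<X>. zero_object A z) \<and>
     (\<forall>a b s i1 i2 p1 p2. biproduct A a b s i1 i2 p1 p2 \<longrightarrow> a \<in> \<X> \<longrightarrow> b \<in> \<X> \<longrightarrow> s \<in> \<X>) \<and>
     (\<forall>a b s i1 i2 p1 p2. biproduct A a b s i1 i2 p1 p2 \<longrightarrow> s \<in> \<X> \<longrightarrow> a \<in> \<X> \<and> b \<in> \<X>)"

definition full_subcategory :: "('o, 'm, 'z) precat_scheme \<Rightarrow> 'o set \<Rightarrow> ('o, 'm, 'z) precat_scheme" where
  "full_subcategory A \<X> = A\<lparr>Ob := \<X>, Arr := {f \<in> Arr A. Dom A f \<in> \<X> \<and> Cod A f \<in> \<X>}\<rparr>"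


section \<open>Complexes\<close>

record ('o, 'm) cplx =
  obj :: "int \<Rightarrow> 'o"
  diff :: "int \<Rightarrow> 'm"

definition complexes :: "('o, 'm, 'z) precat_scheme \<Rightarrow> ('o, 'm) cplx set" where
  "complexes C = {X. \<forall>n. obj X n \<in> Ob C \<and> diff X n \<in> Hom C (obj X n) (obj X (n + 1)) \<and>
       diff X (n + 1) \<cdot>\<^bsub>C\<^esub> diff X n = Zero C (obj X n) (obj X (n + 1 + 1))}"

definition chain_maps ::
  "('o, 'm, 'z) precat_scheme \<Rightarrow> ('o, 'm) cplx \<Rightarrow> ('o, 'm) cplx \<Rightarrow> (int \<Rightarrow> 'm) set" where
  "chain_maps C X Y = {f. \<forall>n. f n \<in> Hom C (obj X n) (obj Y n) \<and>
       diff Y n \<cdot>\<^bsub>C\<^esub> f n = f (n + 1) \<cdot>\<^bsub>C\<^esub> diff X n}"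

definition homotopy_rel ::
  "('o, 'm, 'z) precat_scheme \<Rightarrow> ('o, 'm) cplx \<Rightarrow> ('o, 'm) cplx
     \<Rightarrow> ((int \<Rightarrow> 'm) \<times> (int \<Rightarrow> 'm)) set" where
  "homotopy_rel C X Y = {(f, g). f \<in> chain_maps C X Y \<and> g \<in> chain_maps C X Y \<and>
       (\<exists>s. \<forall>n. s n \<in> Hom C (obj X n) (obj Y (n - 1)) \<and>
          f n = g n \<boxplus>\<^bsub>C\<^esub> (diff Y (n - 1) \<cdot>\<^bsub>C\<^esub> s n \<boxplus>\<^bsub>C\<^esub> s (n + 1) \<cdot>\<^bsub>C\<^esub> diff X n))}"

text \<open>Acyclicity of the complexes of abelian groups Hom(M, X) and Hom(X, N).\<close>

definition Hom_from_acyclic :: "('o, 'm, 'z) precat_scheme \<Rightarrow> 'o \<Rightarrow> ('o, 'm) cplx \<Rightarrow> bool" where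
  "Hom_from_acyclic A M X \<longleftrightarrow>
     (\<forall>n. {u \<in> Hom A M (obj X n). diff X n \<cdot>\<^bsub>A\<^esub> u = Zero A M (obj X (n + 1))}
          = (\<lambda>v. diff X (n - 1) \<cdot>\<^bsub>A\<^esub> v) ` Hom A M (obj X (n - 1)))"

definition Hom_to_acyclic :: "('o, 'm, 'z) precat_scheme \<Rightarrow> 'o \<Rightarrow> ('o, 'm) cplx \<Rightarrow> bool" where
  "Hom_to_acyclic A N X \<longleftrightarrow>
     (\<forall>n. {u \<in> Hom A (obj X n) N. u \<cdot>\<^bsub>A\<^esub> diff X (n - 1) = Zero A (obj X (n - 1)) N}
          = (\<lambda>v. v \<cdot>\<^bsub>A\<^esub> diff X n) ` Hom A (obj X (n + 1)) N)"


section \<open>Balanced pairs\<close>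

definition right_approximation ::
  "('o, 'm, 'z) precat_scheme \<Rightarrow> 'o set \<Rightarrow> 'o \<Rightarrow> 'm \<Rightarrow> bool" where
  "right_approximation A \<X> M \<theta> \<longleftrightarrow> \<theta> \<in> Arr A \<and> Dom A \<theta> \<in> \<X> \<and> Cod A \<theta> = M \<and>
     (\<forall>X \<in> \<X>. \<forall>g \<in> Hom A X M. \<exists>h \<in> Hom A X (Dom A \<theta>). \<theta> \<cdot>\<^bsub>A\<^esub> h = g)"

definition left_approximation ::
  "('o, 'm, 'z) precat_scheme \<Rightarrow> 'o set \<Rightarrow> 'o \<Rightarrow> 'm \<Rightarrow> bool" where
  "left_approximation A \<Y> N \<phi> \<longleftrightarrow> \<phi> \<in> Arr A \<and> Cod A \<phi> \<in> \<Y> \<and> Dom A \<phi> = N \<and>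
     (\<forall>Y \<in> \<Y>. \<forall>g \<in> Hom A N Y. \<exists>h \<in> Hom A (Cod A \<phi>) Y. h \<cdot>\<^bsub>A\<^esub> \<phi> = g)"

definition contravariantly_finite :: "('o, 'm, 'z) precat_scheme \<Rightarrow> 'o set \<Rightarrow> bool" where
  "contravariantly_finite A \<X> \<longleftrightarrow> (\<forall>M \<in> Ob A. \<exists>\<theta>. right_approximation A \<X> M \<theta>)"

definition covariantly_finite :: "('o, 'm, 'z) precat_scheme \<Rightarrow> 'o set \<Rightarrow> bool" where
  "covariantly_finite A \<Y> \<longleftrightarrow> (\<forall>N \<in> Ob A. \<exists>\<phi>. left_approximation A \<Y> N \<phi>)"

text \<open>
  A resolution is encoded by its augmented complex, with M in degree 1 and zero objects in degrees
  above 1; a coresolution by its augmented complex, with N in degree -1 and zero objects in degrees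
  below -1.
\<close>

definition resolution ::
  "('o, 'm, 'z) precat_scheme \<Rightarrow> 'o set \<Rightarrow> 'o \<Rightarrow> ('o, 'm) cplx \<Rightarrow> bool" where
  "resolution A \<X> M R \<longleftrightarrow> R \<in> complexes A \<and>
     (\<forall>n \<le> 0. obj R n \<in> \<X>) \<and> obj R 1 = M \<and> (\<forall>n > 1. zero_object A (obj R n)) \<and>
     (\<forall>X \<in> \<X>. Hom_from_acyclic A X R)"

definition coresolution ::
  "('o, 'm, 'z) precat_scheme \<Rightarrow> 'o set \<Rightarrow> 'o \<Rightarrow> ('o, 'm) cplx \<Rightarrow> bool" where
  "coresolution A \<Y> N R \<longleftrightarrow> R \<in> complexes A \<and>
     (\<forall>n \<ge> 0. obj R n \<in> \<Y>) \<and> obj R (-1) = N \<and> (\<forall>n < -1. zero_object A (obj R n)) \<and>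
     (\<forall>Y \<in> \<Y>. Hom_to_acyclic A Y R)"

text \<open>In \<^typ>\<open>enat\<close> the infimum of a nonempty set is its minimum, and that of the empty set is infinity.\<close>

definition res_dim_ob :: "('o, 'm, 'z) precat_scheme \<Rightarrow> 'o set \<Rightarrow> 'o \<Rightarrow> enat" where
  "res_dim_ob A \<X> M =
     Inf {enat n | n. \<exists>R. resolution A \<X> M R \<and> (\<forall>i < - int n. zero_object A (obj R i))}"

definition res_dim :: "('o, 'm, 'z) precat_scheme \<Rightarrow> 'o set \<Rightarrow> enat" where
  "res_dim A \<X> = (SUP M \<in> Ob A. res_dim_ob A \<X> M)"

definition cores_dim_ob :: "('o, 'm, 'z) precat_scheme \<Rightarrow> 'o set \<Rightarrow> 'o \<Rightarrow> enat" where
  "cores_dim_ob A \<Y> N =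
     Inf {enat n | n. \<exists>R. coresolution A \<Y> N R \<and> (\<forall>i > int n. zero_object A (obj R i))}"

definition cores_dim :: "('o, 'm, 'z) precat_scheme \<Rightarrow> 'o set \<Rightarrow> enat" where
  "cores_dim A \<Y> = (SUP N \<in> Ob A. cores_dim_ob A \<Y> N)"

definition balanced_pair :: "('o, 'm, 'z) precat_scheme \<Rightarrow> 'o set \<Rightarrow> 'o set \<Rightarrow> bool" where
  "balanced_pair A \<X> \<Y> \<longleftrightarrow>
     contravariantly_finite A \<X> \<and> covariantly_finite A \<Y> \<and>
     (\<forall>M \<in> Ob A. \<exists>R. resolution A \<X> M R \<and> (\<forall>Y \<in> \<Y>. Hom_to_acyclic A Y R)) \<and>
     (\<forall>N \<in> Ob A. \<exists>R. coresolution A \<Y> N R \<and> (\<forall>X \<in> \<X>. Hom_from_acyclic A X R))"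

definition admissible :: "('o, 'm, 'z) precat_scheme \<Rightarrow> 'o set \<Rightarrow> bool" where
  "admissible A \<X> \<longleftrightarrow> contravariantly_finite A \<X> \<and>
     (\<forall>M \<in> Ob A. \<forall>\<theta>. right_approximation A \<X> M \<theta> \<longrightarrow> epic A \<theta>)"

definition coadmissible :: "('o, 'm, 'z) precat_scheme \<Rightarrow> 'o set \<Rightarrow> bool" where
  "coadmissible A \<Y> \<longleftrightarrow> covariantly_finite A \<Y> \<and>
     (\<forall>N \<in> Ob A. \<forall>\<phi>. left_approximation A \<Y> N \<phi> \<longrightarrow> monic A \<phi>)"

text \<open>
  For a balanced pair the first member is admissible iff the second is coadmissible (lemma
  \<open>admissible_iff_coadmissible\<close> below), so only the former is demanded.
\<close>

definition admissible_balanced_pair ::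
  "('o, 'm, 'z) precat_scheme \<Rightarrow> 'o set \<Rightarrow> 'o set \<Rightarrow> bool" where
  "admissible_balanced_pair A \<X> \<Y> \<longleftrightarrow> balanced_pair A \<X> \<Y> \<and> admissible A \<X>"

definition finite_dimension :: "('o, 'm, 'z) precat_scheme \<Rightarrow> 'o set \<Rightarrow> 'o set \<Rightarrow> bool" where
  "finite_dimension A \<X> \<Y> \<longleftrightarrow> res_dim A \<X> < \<infinity> \<and> cores_dim A \<Y> < \<infinity>"

context preadditive_category
begin

lemma Hom_objects: "f \<in> Hom C a b \<Longrightarrow> a \<in> Ob C \<and> b \<in> Ob C"
  using Dom_in Cod_in by (auto simp: Hom_def)

lemma Zero_in: "a \<in> Ob C \<Longrightarrow> b \<in> Ob C \<Longrightarrow> Zero C a b \<in> Hom C a b"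
  using group.is_monoid[OF comm_group.axioms(2)[OF hom_comm_group[of a b]]]
  by (auto dest: monoid.one_closed simp: hom_group_def)

lemma idempotent_eq_Zero:
  assumes "f \<in> Hom C a b" "f \<boxplus> f = f"
  shows "f = Zero C a b"
proof -
  have ab: "a \<in> Ob C" "b \<in> Ob C" using Hom_objects[OF assms(1)] by auto
  interpret G: comm_group "hom_group C a b" using hom_comm_group[OF ab] .
  show ?thesis using G.l_cancel_one[of f f] assms by (simp add: hom_group_def)
qed

lemma Zero_Add_Zero: "a \<in> Ob C \<Longrightarrow> b \<in> Ob C \<Longrightarrow> Zero C a b \<boxplus> Zero C a b = Zero C a b"
proof -
  assume ab: "a \<in> Ob C" "b \<in> Ob C"
  interpret G: comm_group "hom_group C a b" using hom_comm_group[OF ab] .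
  show ?thesis using G.l_one[OF G.one_closed] by (simp add: hom_group_def)
qed

lemma Comp_Zero_right:
  assumes "g \<in> Hom C b c" "a \<in> Ob C"
  shows "g \<cdot> Zero C a b = Zero C a c"
proof -
  have b: "b \<in> Ob C" using Hom_objects[OF assms(1)] by auto
  have z: "Zero C a b \<in> Hom C a b" using Zero_in[OF assms(2) b] .
  show ?thesis
    using idempotent_eq_Zero[OF Comp_in[OF z assms(1)]] Comp_Add_right[OF z z assms(1)]
      Zero_Add_Zero[OF assms(2) b] by simp
qed

lemma Comp_Zero_left:
  assumes "f \<in> Hom C a b" "c \<in> Ob C"
  shows "Zero C b c \<cdot> f = Zero C a c"
proof -
  have b: "b \<in> Ob C" using Hom_objects[OF assms(1)] by auto
  have z: "Zero C b c \<in> Hom C b c" using Zero_in[OF b assms(2)] .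
  show ?thesis
    using idempotent_eq_Zero[OF Comp_in[OF assms(1) z]] Comp_Add_left[OF assms(1) z z]
      Zero_Add_Zero[OF b assms(2)] by simp
qed

lemma difference:
  assumes "u \<in> Hom C a b" "v \<in> Hom C a b"
  obtains w where "w \<in> Hom C a b" "u = w \<boxplus> v"
proof -
  have ab: "a \<in> Ob C" "b \<in> Ob C" using Hom_objects[OF assms(1)] by auto
  interpret G: comm_group "hom_group C a b" using hom_comm_group[OF ab] .
  have uv: "u \<in> carrier (hom_group C a b)" "v \<in> carrier (hom_group C a b)"
    using assms by (auto simp: hom_group_def)
  let ?w = "u \<otimes>\<^bsub>hom_group C a b\<^esub> inv\<^bsub>hom_group C a b\<^esub> v"
  have w: "?w \<in> carrier (hom_group C a b)" using uv by simp
  have "?w \<otimes>\<^bsub>hom_group C a b\<^esub> v = u" using uv by (simp add: G.m_assoc)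
  then show ?thesis using that[of ?w] w by (simp add: hom_group_def)
qed

lemma Add_eq_self_iff:
  assumes "w \<in> Hom C a b" "v \<in> Hom C a b"
  shows "w \<boxplus> v = v \<longleftrightarrow> w = Zero C a b"
proof -
  have ab: "a \<in> Ob C" "b \<in> Ob C" using Hom_objects[OF assms(1)] by auto
  interpret G: comm_group "hom_group C a b" using hom_comm_group[OF ab] .
  show ?thesis using G.r_cancel_one[of v w] assms by (simp add: hom_group_def)
qed

lemma monicI:
  assumes "f \<in> Hom C b c"
    and "\<And>a w. w \<in> Hom C a b \<Longrightarrow> f \<cdot> w = Zero C a c \<Longrightarrow> w = Zero C a b"
  shows "monic C f"
proof -
  have "u = v" if uv: "u \<in> Hom C a b" "v \<in> Hom C a b" and eq: "f \<cdot> u = f \<cdot> v" for a u v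
  proof -
    obtain w where w: "w \<in> Hom C a b" "u = w \<boxplus> v" using difference[OF uv] .
    have "f \<cdot> w \<boxplus> f \<cdot> v = f \<cdot> v" using eq Comp_Add_right[OF w(1) uv(2) assms(1)] w(2) by simp
    then have "w = Zero C a b"
      using Add_eq_self_iff[OF Comp_in[OF w(1) assms(1)] Comp_in[OF uv(2) assms(1)]]
        assms(2)[OF w(1)] by simp
    then show ?thesis using Add_eq_self_iff[OF w(1) uv(2)] w(2) by simp
  qed
  then show ?thesis using assms(1) by (auto simp: monic_def Hom_def)
qed

lemma epicI:
  assumes "f \<in> Hom C b c"
    and "\<And>a w. w \<in> Hom C c a \<Longrightarrow> w \<cdot> f = Zero C b a \<Longrightarrow> w = Zero C c a"
  shows "epic C f"
proof -
  have "u = v" if uv: "u \<in> Hom C c a" "v \<in> Hom C c a" and eq: "u \<cdot> f = v \<cdot> f" for a u v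
  proof -
    obtain w where w: "w \<in> Hom C c a" "u = w \<boxplus> v" using difference[OF uv] .
    have "w \<cdot> f \<boxplus> v \<cdot> f = v \<cdot> f" using eq Comp_Add_left[OF assms(1) w(1) uv(2)] w(2) by simp
    then have "w = Zero C c a"
      using Add_eq_self_iff[OF Comp_in[OF assms(1) w(1)] Comp_in[OF assms(1) uv(2)]]
        assms(2)[OF w(1)] by simp
    then show ?thesis using Add_eq_self_iff[OF w(1) uv(2)] w(2) by simp
  qed
  then show ?thesis using assms(1) by (auto simp: epic_def Hom_def)
qed

lemma from_zero_object: "zero_object C z \<Longrightarrow> f \<in> Hom C z a \<Longrightarrow> f = Zero C z a"
  using Zero_in[of z a] Hom_objects[of f z a] unfolding zero_object_def by blast

lemma to_zero_object: "zero_object C z \<Longrightarrow> f \<in> Hom C a z \<Longrightarrow> f = Zero C a z"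
  using Zero_in[of a z] Hom_objects[of f a z] unfolding zero_object_def by blast

lemma coadmissible_if_admissible:
  assumes bp: "balanced_pair C \<X> \<Y>" and adm: "admissible C \<X>"
  shows "coadmissible C \<Y>"
  unfolding coadmissible_def
proof (intro conjI ballI allI impI)
  show "covariantly_finite C \<Y>" using bp by (simp add: balanced_pair_def)
next
  fix N \<phi> assume N: "N \<in> Ob C" and \<phi>: "left_approximation C \<Y> N \<phi>"
  obtain R where R: "coresolution C \<Y> N R" and ac: "\<And>X. X \<in> \<X> \<Longrightarrow> Hom_from_acyclic C X R"
    using bp N unfolding balanced_pair_def by blast
  have cx: "R \<in> complexes C" and N1: "obj R (-1) = N" and Y0: "obj R 0 \<in> \<Y>"
    and z2: "zero_object C (obj R (-2))"
    using R by (auto simp: coresolution_def)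
  have d: "diff R (-1) \<in> Hom C N (obj R 0)" "diff R (-2) \<in> Hom C (obj R (-2)) N"
    using cx[unfolded complexes_def, simplified, THEN spec, of "-1"]
      cx[unfolded complexes_def, simplified, THEN spec, of "-2"] N1 by auto
  define Y where "Y = Cod C \<phi>"
  have \<phi>': "\<phi> \<in> Hom C N Y" using \<phi> by (auto simp: left_approximation_def Hom_def Y_def)
  obtain h where h: "h \<in> Hom C Y (obj R 0)" "h \<cdot> \<phi> = diff R (-1)"
    using \<phi> Y0 d(1) unfolding left_approximation_def Y_def by blast
  show "monic C \<phi>"
  proof (rule monicI[OF \<phi>'])
    fix Z w assume w: "w \<in> Hom C Z N" and w0: "\<phi> \<cdot> w = Zero C Z Y"
    have Z: "Z \<in> Ob C" using Hom_objects[OF w] by auto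
    obtain \<theta> where \<theta>: "right_approximation C \<X> Z \<theta>"
      using adm Z unfolding admissible_def contravariantly_finite_def by blast
    have ep: "epic C \<theta>" using adm Z \<theta> by (auto simp: admissible_def)
    define X where "X = Dom C \<theta>"
    have X: "X \<in> \<X>" and \<theta>': "\<theta> \<in> Hom C X Z"
      using \<theta> by (auto simp: right_approximation_def Hom_def X_def)
    have XO: "X \<in> Ob C" using Hom_objects[OF \<theta>'] by auto
    have w\<theta>: "w \<cdot> \<theta> \<in> Hom C X N" using Comp_in[OF \<theta>' w] .
    have "diff R (-1) \<cdot> w = h \<cdot> (\<phi> \<cdot> w)" using Comp_assoc[OF w \<phi>' h(1)] h(2) by simp
    also have "\<dots> = Zero C Z (obj R 0)" using w0 Comp_Zero_right[OF h(1) Z] by simp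
    finally have "diff R (-1) \<cdot> (w \<cdot> \<theta>) = Zero C X (obj R 0)"
      using Comp_assoc[OF \<theta>' w d(1)] Comp_Zero_left[OF \<theta>'] Hom_objects[OF d(1)] by simp
    then have "w \<cdot> \<theta> \<in> (\<lambda>v. diff R (-2) \<cdot> v) ` Hom C X (obj R (-2))"
      using ac[OF X, unfolded Hom_from_acyclic_def, THEN spec, of "-1"] w\<theta> N1 by auto
    then obtain v where v: "v \<in> Hom C X (obj R (-2))" "w \<cdot> \<theta> = diff R (-2) \<cdot> v" by blast
    have "w \<cdot> \<theta> = Zero C X N"
      using v from_zero_object[OF z2 d(2)] Comp_Zero_left[OF v(1)] Hom_objects[OF w] by simp
    also have "\<dots> = Zero C Z N \<cdot> \<theta>" using Comp_Zero_left[OF \<theta>'] Hom_objects[OF w] by simp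
    finally have eq: "w \<cdot> \<theta> = Zero C Z N \<cdot> \<theta>" .
    have "Cod C \<theta> = Z" using \<theta>' by (simp add: Hom_def)
    then show "w = Zero C Z N"
      using ep eq w Zero_in[OF Z N] N unfolding epic_def by blast
  qed
qed

lemma admissible_if_coadmissible:
  assumes bp: "balanced_pair C \<X> \<Y>" and coadm: "coadmissible C \<Y>"
  shows "admissible C \<X>"
  unfolding admissible_def
proof (intro conjI ballI allI impI)
  show "contravariantly_finite C \<X>" using bp by (simp add: balanced_pair_def)
next
  fix M \<theta> assume M: "M \<in> Ob C" and \<theta>: "right_approximation C \<X> M \<theta>"
  obtain R where R: "resolution C \<X> M R" and ac: "\<And>Y. Y \<in> \<Y> \<Longrightarrow> Hom_to_acyclic C Y R"
    using bp M unfolding balanced_pair_def by blast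
  have cx: "R \<in> complexes C" and M1: "obj R 1 = M" and X0: "obj R 0 \<in> \<X>"
    and z2: "zero_object C (obj R 2)"
    using R by (auto simp: resolution_def)
  have d: "diff R 0 \<in> Hom C (obj R 0) M" "diff R 1 \<in> Hom C M (obj R 2)"
    using cx[unfolded complexes_def, simplified, THEN spec, of "0"]
      cx[unfolded complexes_def, simplified, THEN spec, of "1"] M1 by auto
  define X where "X = Dom C \<theta>"
  have \<theta>': "\<theta> \<in> Hom C X M" using \<theta> by (auto simp: right_approximation_def Hom_def X_def)
  obtain h where h: "h \<in> Hom C (obj R 0) X" "\<theta> \<cdot> h = diff R 0"
    using \<theta> X0 d(1) unfolding right_approximation_def X_def by blast
  show "epic C \<theta>"
  proof (rule epicI[OF \<theta>'])
    fix Z w assume w: "w \<in> Hom C M Z" and w0: "w \<cdot> \<theta> = Zero C X Z"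
    have Z: "Z \<in> Ob C" using Hom_objects[OF w] by auto
    obtain \<phi> where \<phi>: "left_approximation C \<Y> Z \<phi>"
      using coadm Z unfolding coadmissible_def covariantly_finite_def by blast
    have mo: "monic C \<phi>" using coadm Z \<phi> by (auto simp: coadmissible_def)
    define Y where "Y = Cod C \<phi>"
    have Y: "Y \<in> \<Y>" and \<phi>': "\<phi> \<in> Hom C Z Y"
      using \<phi> by (auto simp: left_approximation_def Hom_def Y_def)
    have YO: "Y \<in> Ob C" using Hom_objects[OF \<phi>'] by auto
    have \<phi>w: "\<phi> \<cdot> w \<in> Hom C M Y" using Comp_in[OF w \<phi>'] .
    have "w \<cdot> diff R 0 = (w \<cdot> \<theta>) \<cdot> h" using Comp_assoc[OF h(1) \<theta>' w] h(2) by simp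
    also have "\<dots> = Zero C (obj R 0) Z" using w0 Comp_Zero_left[OF h(1) Z] by simp
    finally have "(\<phi> \<cdot> w) \<cdot> diff R 0 = Zero C (obj R 0) Y"
      using Comp_assoc[OF d(1) w \<phi>'] Comp_Zero_right[OF \<phi>'] Hom_objects[OF d(1)] by simp
    then have "\<phi> \<cdot> w \<in> (\<lambda>v. v \<cdot> diff R 1) ` Hom C (obj R 2) Y"
      using ac[OF Y, unfolded Hom_to_acyclic_def, THEN spec, of "1"] \<phi>w M1 by auto
    then obtain v where v: "v \<in> Hom C (obj R 2) Y" "\<phi> \<cdot> w = v \<cdot> diff R 1" by blast
    have "\<phi> \<cdot> w = Zero C M Y"
      using v to_zero_object[OF z2 d(2)] Comp_Zero_right[OF v(1)] M by simp
    also have "\<dots> = \<phi> \<cdot> Zero C M Z" using Comp_Zero_right[OF \<phi>' M] by simp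
    finally have eq: "\<phi> \<cdot> w = \<phi> \<cdot> Zero C M Z" .
    have "Dom C \<phi> = Z" using \<phi>' by (simp add: Hom_def)
    then show "w = Zero C M Z"
      using mo eq w Zero_in[OF M Z] M unfolding monic_def by blast
  qed
qed

lemma admissible_iff_coadmissible:
  "balanced_pair C \<X> \<Y> \<Longrightarrow> admissible C \<X> \<longleftrightarrow> coadmissible C \<Y>"
  using coadmissible_if_admissible admissible_if_coadmissible by blast

end


section \<open>Triangle equivalences\<close>

text \<open>
  The data of a triangulated category: a shift on objects and arrows, and the set of distinguished
  triangles, each given by its three arrows X -> Y -> Z -> Shift X.
\<close>

record ('o, 'm) tricat = "('o, 'm) precat" +
  ShiftOb :: "'o \<Rightarrow> 'o"
  ShiftArr :: "'m \<Rightarrow> 'm"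
  Dist :: "('m \<times> 'm \<times> 'm) set"

definition is_functor ::
  "('o, 'm, 'z) cat_scheme \<Rightarrow> ('p, 'n, 'y) cat_scheme \<Rightarrow> ('o \<Rightarrow> 'p) \<Rightarrow> ('m \<Rightarrow> 'n) \<Rightarrow> bool" where
  "is_functor C D Fo Fa \<longleftrightarrow>
     (\<forall>a \<in> Ob C. Fo a \<in> Ob D \<and> Fa (Id C a) = Id D (Fo a)) \<and>
     (\<forall>a \<in> Ob C. \<forall>b \<in> Ob C. \<forall>f \<in> Hom C a b. Fa f \<in> Hom D (Fo a) (Fo b)) \<and>
     (\<forall>a \<in> Ob C. \<forall>b \<in> Ob C. \<forall>c \<in> Ob C. \<forall>f \<in> Hom C a b. \<forall>g \<in> Hom C b c.
        Fa (g \<cdot>\<^bsub>C\<^esub> f) = Fa g \<cdot>\<^bsub>D\<^esub> Fa f)"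

definition additive_functor ::
  "('o, 'm, 'z) precat_scheme \<Rightarrow> ('p, 'n, 'y) precat_scheme \<Rightarrow> ('o \<Rightarrow> 'p) \<Rightarrow> ('m \<Rightarrow> 'n) \<Rightarrow> bool"
where
  "additive_functor C D Fo Fa \<longleftrightarrow> is_functor C D Fo Fa \<and>
     (\<forall>a \<in> Ob C. \<forall>b \<in> Ob C. \<forall>f \<in> Hom C a b. \<forall>g \<in> Hom C a b.
        Fa (f \<boxplus>\<^bsub>C\<^esub> g) = Fa f \<boxplus>\<^bsub>D\<^esub> Fa g)"

definition natural_iso ::
  "('o, 'm, 'z) cat_scheme \<Rightarrow> ('p, 'n, 'y) cat_scheme \<Rightarrow> ('o \<Rightarrow> 'p) \<Rightarrow> ('m \<Rightarrow> 'n)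
     \<Rightarrow> ('o \<Rightarrow> 'p) \<Rightarrow> ('m \<Rightarrow> 'n) \<Rightarrow> ('o \<Rightarrow> 'n) \<Rightarrow> bool" where
  "natural_iso C D Fo Fa Go Ga \<eta> \<longleftrightarrow>
     (\<forall>a \<in> Ob C. \<eta> a \<in> Hom D (Fo a) (Go a) \<and> iso_arr D (\<eta> a)) \<and>
     (\<forall>a \<in> Ob C. \<forall>b \<in> Ob C. \<forall>f \<in> Hom C a b. \<eta> b \<cdot>\<^bsub>D\<^esub> Fa f = Ga f \<cdot>\<^bsub>D\<^esub> \<eta> a)"

definition equivalence_functor ::
  "('o, 'm, 'z) cat_scheme \<Rightarrow> ('p, 'n, 'y) cat_scheme \<Rightarrow> ('o \<Rightarrow> 'p) \<Rightarrow> ('m \<Rightarrow> 'n) \<Rightarrow> bool" where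
  "equivalence_functor C D Fo Fa \<longleftrightarrow> is_functor C D Fo Fa \<and>
     (\<exists>Go Ga. is_functor D C Go Ga \<and>
        (\<exists>\<eta>. natural_iso C C (\<lambda>a. a) (\<lambda>f. f) (Go \<circ> Fo) (Ga \<circ> Fa) \<eta>) \<and>
        (\<exists>\<epsilon>. natural_iso D D (Fo \<circ> Go) (Fa \<circ> Ga) (\<lambda>a. a) (\<lambda>f. f) \<epsilon>))"

definition triangle_functor ::
  "('o, 'm, 'z) tricat_scheme \<Rightarrow> ('p, 'n, 'y) tricat_scheme \<Rightarrow> ('o \<Rightarrow> 'p) \<Rightarrow> ('m \<Rightarrow> 'n)
     \<Rightarrow> ('o \<Rightarrow> 'n) \<Rightarrow> bool" where
  "triangle_functor S T Fo Fa \<eta> \<longleftrightarrow> additive_functor S T Fo Fa \<and>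
     natural_iso S T (Fo \<circ> ShiftOb S) (Fa \<circ> ShiftArr S) (ShiftOb T \<circ> Fo) (ShiftArr T \<circ> Fa) \<eta> \<and>
     (\<forall>f g h. (f, g, h) \<in> Dist S \<longrightarrow> (Fa f, Fa g, \<eta> (Dom S f) \<cdot>\<^bsub>T\<^esub> Fa h) \<in> Dist T)"

definition triangle_equivalent ::
  "('o, 'm, 'z) tricat_scheme \<Rightarrow> ('p, 'n, 'y) tricat_scheme \<Rightarrow> bool" where
  "triangle_equivalent S T \<longleftrightarrow>
     (\<exists>Fo Fa \<eta>. triangle_functor S T Fo Fa \<eta> \<and> equivalence_functor S T Fo Fa)"


section \<open>Homotopy categories\<close>

text \<open>
  An arrow of the homotopy category is a triple of source, target and homotopy class of chain maps;
  source and target are recorded because a class of chain maps does not determine the differentials.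
\<close>

type_synonym ('o, 'm) harr = "('o, 'm) cplx \<times> ('o, 'm) cplx \<times> (int \<Rightarrow> 'm) set"

definition hclass ::
  "('o, 'm, 'z) precat_scheme \<Rightarrow> ('o, 'm) cplx \<Rightarrow> ('o, 'm) cplx \<Rightarrow> (int \<Rightarrow> 'm) \<Rightarrow> ('o, 'm) harr" where
  "hclass C X Y f = (X, Y, homotopy_rel C X Y `` {f})"

definition hcomp ::
  "('o, 'm, 'z) precat_scheme \<Rightarrow> ('o, 'm) harr \<Rightarrow> ('o, 'm) harr \<Rightarrow> ('o, 'm) harr" where
  "hcomp C = (\<lambda>(Y', Z, G) (X, Y, F).
     (X, Z, homotopy_rel C X Z `` {\<lambda>n. g n \<cdot>\<^bsub>C\<^esub> f n | f g. f \<in> F \<and> g \<in> G}))"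

definition hadd ::
  "('o, 'm, 'z) precat_scheme \<Rightarrow> ('o, 'm) harr \<Rightarrow> ('o, 'm) harr \<Rightarrow> ('o, 'm) harr" where
  "hadd C = (\<lambda>(X, Y, F) (X', Y', G).
     (X, Y, homotopy_rel C X Y `` {\<lambda>n. f n \<boxplus>\<^bsub>C\<^esub> g n | f g. f \<in> F \<and> g \<in> G}))"

definition homotopy_precat ::
  "('o, 'm, 'z) precat_scheme \<Rightarrow> (('o, 'm) cplx, ('o, 'm) harr) precat" where
  "homotopy_precat C = \<lparr>
     Ob = complexes C,
     Arr = {(X, Y, F). X \<in> complexes C \<and> Y \<in> complexes C \<and>
                       F \<in> chain_maps C X Y // homotopy_rel C X Y},
     Dom = (\<lambda>(X, Y, F). X),
     Cod = (\<lambda>(X, Y, F). Y),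
     Id = (\<lambda>X. hclass C X X (\<lambda>n. Id C (obj X n))),
     Comp = hcomp C,
     Zero = (\<lambda>X Y. hclass C X Y (\<lambda>n. Zero C (obj X n) (obj Y n))),
     Add = hadd C\<rparr>"

definition shift_cplx :: "('o, 'm, 'z) precat_scheme \<Rightarrow> ('o, 'm) cplx \<Rightarrow> ('o, 'm) cplx" where
  "shift_cplx C X = \<lparr>obj = (\<lambda>n. obj X (n + 1)), diff = (\<lambda>n. neg C (diff X (n + 1)))\<rparr>"

definition shift_harr :: "('o, 'm, 'z) precat_scheme \<Rightarrow> ('o, 'm) harr \<Rightarrow> ('o, 'm) harr" where
  "shift_harr C = (\<lambda>(X, Y, F). (shift_cplx C X, shift_cplx C Y, (\<lambda>f n. f (n + 1)) ` F))"

text \<open>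
  The mapping cone Z of f has components X(n+1) + Y(n) and differential with matrix rows
  (-d, 0) and (f, d). Direct sums are only determined up to isomorphism, so the cone is
  described relative to a choice of biproducts.
\<close>

definition mapping_cone ::
  "('o, 'm, 'z) precat_scheme \<Rightarrow> ('o, 'm) cplx \<Rightarrow> ('o, 'm) cplx \<Rightarrow> (int \<Rightarrow> 'm) \<Rightarrow> ('o, 'm) cplx
     \<Rightarrow> (int \<Rightarrow> 'm) \<Rightarrow> (int \<Rightarrow> 'm) \<Rightarrow> (int \<Rightarrow> 'm) \<Rightarrow> (int \<Rightarrow> 'm) \<Rightarrow> bool" where
  "mapping_cone C X Y f Z i1 i2 p1 p2 \<longleftrightarrow>
     (\<forall>n. biproduct C (obj X (n + 1)) (obj Y n) (obj Z n) (i1 n) (i2 n) (p1 n) (p2 n) \<and>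
        diff Z n = i1 (n + 1) \<cdot>\<^bsub>C\<^esub> (neg C (diff X (n + 1)) \<cdot>\<^bsub>C\<^esub> p1 n)
            \<boxplus>\<^bsub>C\<^esub> i2 (n + 1) \<cdot>\<^bsub>C\<^esub> (f (n + 1) \<cdot>\<^bsub>C\<^esub> p1 n \<boxplus>\<^bsub>C\<^esub> diff Y n \<cdot>\<^bsub>C\<^esub> p2 n))"

definition standard_triangles ::
  "('o, 'm, 'z) precat_scheme \<Rightarrow> (('o, 'm) harr \<times> ('o, 'm) harr \<times> ('o, 'm) harr) set" where
  "standard_triangles C =
     {(hclass C X Y f, hclass C Y Z i2, hclass C Z (shift_cplx C X) p1) | X Y Z f i1 i2 p1 p2.
        X \<in> complexes C \<and> Y \<in> complexes C \<and> f \<in> chain_maps C X Y \<and>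
        mapping_cone C X Y f Z i1 i2 p1 p2}"

definition distinguished_triangles ::
  "('o, 'm, 'z) precat_scheme \<Rightarrow> (('o, 'm) harr \<times> ('o, 'm) harr \<times> ('o, 'm) harr) set" where
  "distinguished_triangles C = (let K = homotopy_precat C in
     {(u, v, w). \<exists>X Y Z. u \<in> Hom K X Y \<and> v \<in> Hom K Y Z \<and> w \<in> Hom K Z (shift_cplx C X) \<and>
        (\<exists>u' v' w' X' Y' Z' a b c. (u', v', w') \<in> standard_triangles C \<and>
           u' \<in> Hom K X' Y' \<and> v' \<in> Hom K Y' Z' \<and>
           a \<in> Hom K X X' \<and> b \<in> Hom K Y Y' \<and> c \<in> Hom K Z Z' \<and>
           iso_arr K a \<and> iso_arr K b \<and> iso_arr K c \<and>
           b \<cdot>\<^bsub>K\<^esub> u = u' \<cdot>\<^bsub>K\<^esub> a \<and> c \<cdot>\<^bsub>K\<^esub> v = v' \<cdot>\<^bsub>K\<^esub> b \<and>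
           shift_harr C a \<cdot>\<^bsub>K\<^esub> w = w' \<cdot>\<^bsub>K\<^esub> c)})"

definition homotopy_category ::
  "('o, 'm, 'z) precat_scheme \<Rightarrow> (('o, 'm) cplx, ('o, 'm) harr) tricat" where
  "homotopy_category C = precat.extend (homotopy_precat C)
     \<lparr>ShiftOb = shift_cplx C, ShiftArr = shift_harr C, Dist = distinguished_triangles C\<rparr>"

end

theory Submission
  imports Defs
begin

text \<open>
  Call \<open>M \<rightarrow> B \<rightarrow> D\<close> a conflation if it is a short exact sequence that stays exact under \<open>Hom(X, -)\<close> for
  \<open>X\<close> in \<open>\<X>\<close> and under \<open>Hom(-, Y)\<close> for \<open>Y\<close> in \<open>\<Y>\<close>; every left \<open>\<Y>\<close>-approximation is the beginning of one.
  For a complex \<open>M\<close> choose conflations \<open>M n \<rightarrow> B n \<rightarrow> D (n + 1)\<close> with \<open>B n\<close> in \<open>\<Y>\<close>. The complexes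
  \<open>I n = B n \<oplus> B (n + 1)\<close>, which is contractible, and \<open>T[1] = coker(M \<rightarrow> I)\<close> yield a chain map
  \<open>j : M \<rightarrow> T\<close> that induces bijections on homotopy classes of maps to complexes over \<open>\<Y>\<close> and from complexes
  over \<open>\<X>\<close>: the total Hom complexes of \<open>0 \<rightarrow> M \<rightarrow> I \<rightarrow> T[1] \<rightarrow> 0\<close> are degreewise exact, and those of \<open>I\<close> are
  acyclic. The objects of \<open>T\<close> have smaller coresolution dimension than those of \<open>M\<close>, so finitely many steps
  lead to a complex over \<open>\<Y>\<close>. Starting with complexes over \<open>\<X>\<close> this gives a fully faithful functor
  \<open>K(\<X>) \<rightarrow> K(\<Y>)\<close>; the dual construction, starting with complexes over \<open>\<Y>\<close>, shows that it is essentially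
  surjective. The extension property of \<open>j\<close> passes to mapping cones, hence the functor is exact.
\<close>

section \<open>Calculating in preadditive categories\<close>

text \<open>The obstacle behind the shape of \<open>T\<close> is that extending the differential of
  \<open>M\<close> over the approximations only gives maps \<open>h\<close> with
  \<open>h \<phi> = \<phi> d\<close>; nothing forces \<open>h h = 0\<close>, so there is no double
  complex to totalize. But \<open>h h\<close> vanishes on \<open>\<phi>\<close> and hence factors
  through \<open>q\<close>, and this factorization becomes the entry \<open>g\<close> of the
  differential of \<open>T\<close>.

  The two properties of \<open>j\<close> differ in strength. Restriction along \<open>j\<close> is
  surjective in each degree on maps into objects of \<Y>, so extensions can be prescribed on the
  nose, homotopies included. Composition with \<open>j\<close> is merely injective in each degree,
  so maps out of complexes over \<X> lift only up to homotopy. The strict half is what survives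
  composition, shifts and cones without correction terms.

  Finite dimension bounds the number of steps simultaneously in all degrees, so no limit of
  complexes has to be formed. The chosen coresolutions of different complexes are unrelated;
  functoriality comes from uniqueness of extensions up to homotopy.\<close>

lemma Hom_iff: "f \<in> Hom C a b \<longleftrightarrow> f \<in> Arr C \<and> Dom C f = a \<and> Cod C f = b"
  by (simp add: Hom_def)

definition sub :: "('o, 'm, 'z) precat_scheme \<Rightarrow> 'm \<Rightarrow> 'm \<Rightarrow> 'm" (infixl "\<boxminus>\<index>" 65) where
  "f \<boxminus>\<^bsub>C\<^esub> g = f \<boxplus>\<^bsub>C\<^esub> neg C g"

context preadditive_category
begin

lemma Ob_DomCod [simp]: "f \<in> Arr C \<Longrightarrow> Dom C f \<in> Ob C" "f \<in> Arr C \<Longrightarrow> Cod C f \<in> Ob C"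
  by (simp_all add: Dom_in Cod_in)

lemma arr_Id [simp]:
  assumes "a \<in> Ob C"
  shows "Id C a \<in> Arr C" "Dom C (Id C a) = a" "Cod C (Id C a) = a"
  using Id_in[OF assms] by (simp_all add: Hom_iff)

lemma arr_Zero [simp]:
  assumes "a \<in> Ob C" "b \<in> Ob C"
  shows "Zero C a b \<in> Arr C" "Dom C (Zero C a b) = a" "Cod C (Zero C a b) = b"
  using Zero_in[OF assms] by (simp_all add: Hom_iff)

lemma arr_Comp [simp]:
  assumes "f \<in> Arr C" "g \<in> Arr C" "Dom C g = Cod C f"
  shows "g \<cdot> f \<in> Arr C" "Dom C (g \<cdot> f) = Dom C f" "Cod C (g \<cdot> f) = Cod C g"
  using Comp_in[of f "Dom C f" "Cod C f" g "Cod C g"] assms by (simp_all add: Hom_iff)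

lemma arr_Add [simp]:
  assumes "f \<in> Arr C" "g \<in> Arr C" "Dom C g = Dom C f" "Cod C g = Cod C f"
  shows "f \<boxplus> g \<in> Arr C" "Dom C (f \<boxplus> g) = Dom C f" "Cod C (f \<boxplus> g) = Cod C f"
proof -
  interpret G: comm_group "hom_group C (Dom C f) (Cod C f)" using assms by (intro hom_comm_group) simp_all
  have "f \<boxplus> g \<in> Hom C (Dom C f) (Cod C f)"
    using G.m_closed[of f g] assms by (simp add: hom_group_def Hom_iff)
  then show "f \<boxplus> g \<in> Arr C" "Dom C (f \<boxplus> g) = Dom C f" "Cod C (f \<boxplus> g) = Cod C f"
    by (simp_all add: Hom_iff)
qed

lemma arr_neg [simp]:
  assumes "f \<in> Arr C"
  shows "neg C f \<in> Arr C" "Dom C (neg C f) = Dom C f" "Cod C (neg C f) = Cod C f"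
proof -
  interpret G: comm_group "hom_group C (Dom C f) (Cod C f)" using assms by (intro hom_comm_group) simp_all
  have "neg C f \<in> Hom C (Dom C f) (Cod C f)"
    using G.inv_closed[of f] assms by (simp add: hom_group_def Hom_iff neg_def)
  then show "neg C f \<in> Arr C" "Dom C (neg C f) = Dom C f" "Cod C (neg C f) = Cod C f"
    by (simp_all add: Hom_iff)
qed

lemma arr_sub [simp]:
  assumes "f \<in> Arr C" "g \<in> Arr C" "Dom C g = Dom C f" "Cod C g = Cod C f"
  shows "f \<boxminus> g \<in> Arr C" "Dom C (f \<boxminus> g) = Dom C f" "Cod C (f \<boxminus> g) = Cod C f"
  using assms by (simp_all add: sub_def)

lemma add_assoc:
  assumes "f \<in> Arr C" "g \<in> Arr C" "Dom C g = Dom C f" "Cod C g = Cod C f"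
    "h \<in> Arr C" "Dom C h = Dom C f" "Cod C h = Cod C f"
  shows "f \<boxplus> g \<boxplus> h = f \<boxplus> (g \<boxplus> h)"
proof -
  interpret G: comm_group "hom_group C (Dom C f) (Cod C f)" using assms by (intro hom_comm_group) simp_all
  show ?thesis using G.m_assoc[of f g h] assms by (simp add: hom_group_def Hom_iff)
qed

lemma add_commute:
  assumes "f \<in> Arr C" "g \<in> Arr C" "Dom C g = Dom C f" "Cod C g = Cod C f"
  shows "f \<boxplus> g = g \<boxplus> f"
proof -
  interpret G: comm_group "hom_group C (Dom C f) (Cod C f)" using assms by (intro hom_comm_group) simp_all
  show ?thesis using G.m_comm[of f g] assms by (simp add: hom_group_def Hom_iff)
qed

lemma add_left_commute:
  assumes "f \<in> Arr C" "g \<in> Arr C" "Dom C g = Dom C f" "Cod C g = Cod C f"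
    "h \<in> Arr C" "Dom C h = Dom C f" "Cod C h = Cod C f"
  shows "f \<boxplus> (g \<boxplus> h) = g \<boxplus> (f \<boxplus> h)"
  using assms by (simp add: add_assoc[symmetric] add_commute[of f g])

lemmas add_ac = add_assoc add_commute add_left_commute

lemma add_Zero [simp]:
  assumes "f \<in> Arr C" "Dom C f = a" "Cod C f = b"
  shows "f \<boxplus> Zero C a b = f" "Zero C a b \<boxplus> f = f"
proof -
  interpret G: comm_group "hom_group C a b" using assms by (intro hom_comm_group) auto
  show "f \<boxplus> Zero C a b = f" "Zero C a b \<boxplus> f = f"
    using G.r_one[of f] G.l_one[of f] assms by (simp_all add: hom_group_def Hom_iff)
qed

lemma add_neg [simp]:
  assumes "f \<in> Arr C"
  shows "f \<boxplus> neg C f = Zero C (Dom C f) (Cod C f)" "neg C f \<boxplus> f = Zero C (Dom C f) (Cod C f)"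
proof -
  interpret G: comm_group "hom_group C (Dom C f) (Cod C f)" using assms by (intro hom_comm_group) simp_all
  show "f \<boxplus> neg C f = Zero C (Dom C f) (Cod C f)" "neg C f \<boxplus> f = Zero C (Dom C f) (Cod C f)"
    using G.r_inv[of f] G.l_inv[of f] assms by (simp_all add: hom_group_def Hom_iff neg_def)
qed

lemma add_neg_left [simp]:
  assumes "f \<in> Arr C" "g \<in> Arr C" "Dom C g = Dom C f" "Cod C g = Cod C f"
  shows "f \<boxplus> (neg C f \<boxplus> g) = g" "neg C f \<boxplus> (f \<boxplus> g) = g"
  using add_assoc[of f "neg C f" g] add_assoc[of "neg C f" f g] assms by simp_all

lemma add_cancel [simp]:
  assumes "f \<in> Arr C" "g \<in> Arr C" "Dom C g = Dom C f" "Cod C g = Cod C f"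
    "h \<in> Arr C" "Dom C h = Dom C f" "Cod C h = Cod C f"
  shows "f \<boxplus> g = f \<boxplus> h \<longleftrightarrow> g = h" "g \<boxplus> f = h \<boxplus> f \<longleftrightarrow> g = h"
proof -
  interpret G: comm_group "hom_group C (Dom C f) (Cod C f)" using assms by (intro hom_comm_group) simp_all
  show "f \<boxplus> g = f \<boxplus> h \<longleftrightarrow> g = h" using G.right_cancel[of f g h] G.m_comm[of f] assms by (simp add: hom_group_def Hom_iff)
  show "g \<boxplus> f = h \<boxplus> f \<longleftrightarrow> g = h" using G.right_cancel[of f g h] assms by (simp add: hom_group_def Hom_iff)
qed

lemma add_sub_cancel:
  assumes "f \<in> Arr C" "g \<in> Arr C" "Dom C g = Dom C f" "Cod C g = Cod C f"
  shows "f \<boxminus> g \<boxplus> g = f"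
  using assms by (simp add: sub_def add_assoc)

text \<open>
  Rules moving all subtractions across an equation, so that it becomes an equation between two
  sums, which ordered rewriting then decides.
\<close>

lemma sub_eq_iff:
  assumes "f \<in> Arr C" "g \<in> Arr C" "Dom C g = Dom C f" "Cod C g = Cod C f"
    "h \<in> Arr C" "Dom C h = Dom C f" "Cod C h = Cod C f"
  shows "f \<boxminus> g = h \<longleftrightarrow> f = h \<boxplus> g" "h = f \<boxminus> g \<longleftrightarrow> h \<boxplus> g = f"
proof -
  have "f \<boxminus> g = h \<longleftrightarrow> f \<boxminus> g \<boxplus> g = h \<boxplus> g" using assms by simp
  then show "f \<boxminus> g = h \<longleftrightarrow> f = h \<boxplus> g" using assms by (simp add: add_sub_cancel)
  then show "h = f \<boxminus> g \<longleftrightarrow> h \<boxplus> g = f" by metis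
qed

lemma sub_rules:
  assumes "f \<in> Arr C" "g \<in> Arr C" "Dom C g = Dom C f" "Cod C g = Cod C f"
    "h \<in> Arr C" "Dom C h = Dom C f" "Cod C h = Cod C f"
  shows "f \<boxplus> (g \<boxminus> h) = f \<boxplus> g \<boxminus> h" "f \<boxminus> g \<boxplus> h = f \<boxplus> h \<boxminus> g"
    "f \<boxminus> g \<boxminus> h = f \<boxminus> (g \<boxplus> h)" "f \<boxminus> (g \<boxminus> h) = f \<boxplus> h \<boxminus> g"
proof -
  show 1: "f \<boxplus> (g \<boxminus> h) = f \<boxplus> g \<boxminus> h" using assms by (simp add: sub_def add_assoc)
  show 2: "f \<boxminus> g \<boxplus> h = f \<boxplus> h \<boxminus> g" using assms by (simp add: sub_def add_ac)
  have "f \<boxminus> g \<boxminus> h \<boxplus> (g \<boxplus> h) = f \<boxminus> g \<boxminus> h \<boxplus> h \<boxplus> g"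
    using assms by (simp add: add_ac)
  also have "\<dots> = f" using assms by (simp add: add_sub_cancel)
  finally show 3: "f \<boxminus> g \<boxminus> h = f \<boxminus> (g \<boxplus> h)"
    using assms by (simp add: sub_eq_iff)
  have "f \<boxplus> h \<boxminus> g \<boxplus> (g \<boxminus> h) = f \<boxplus> h \<boxminus> g \<boxplus> g \<boxplus> neg C h"
    using assms by (simp add: sub_def add_assoc)
  also have "\<dots> = f" using assms by (simp add: add_sub_cancel) (simp add: add_assoc)
  finally show 4: "f \<boxminus> (g \<boxminus> h) = f \<boxplus> h \<boxminus> g"
    using assms sub_eq_iff(1)[of f "g \<boxminus> h" "f \<boxplus> h \<boxminus> g"] by simp
qed

lemma neg_eq: "f \<in> Arr C \<Longrightarrow> neg C f = Zero C (Dom C f) (Cod C f) \<boxminus> f"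
  by (simp add: sub_def)

lemma sub_Zero [simp]:
  assumes "f \<in> Arr C" "Dom C f = a" "Cod C f = b"
  shows "f \<boxminus> Zero C a b = f"
  using assms Ob_DomCod[of f] add_sub_cancel[of f "Zero C a b"] by simp

lemma sub_self [simp]: "f \<in> Arr C \<Longrightarrow> f \<boxminus> f = Zero C (Dom C f) (Cod C f)"
  by (simp add: sub_def)

lemma comp_assoc:
  assumes "f \<in> Arr C" "g \<in> Arr C" "Dom C g = Cod C f" "h \<in> Arr C" "Dom C h = Cod C g"
  shows "h \<cdot> g \<cdot> f = h \<cdot> (g \<cdot> f)"
  using Comp_assoc[of f "Dom C f" "Cod C f" g "Cod C g" h "Cod C h"] assms by (simp add: Hom_iff)

lemma comp_Add:
  assumes "f \<in> Arr C" "f' \<in> Arr C" "Dom C f' = Dom C f" "Cod C f' = Cod C f"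
    "g \<in> Arr C" "Dom C g = Cod C f"
  shows "g \<cdot> (f \<boxplus> f') = g \<cdot> f \<boxplus> g \<cdot> f'"
  using Comp_Add_right[of f "Dom C f" "Cod C f" f' g "Cod C g"] assms by (simp add: Hom_iff)

lemma Add_comp:
  assumes "g \<in> Arr C" "g' \<in> Arr C" "Dom C g' = Dom C g" "Cod C g' = Cod C g"
    "f \<in> Arr C" "Dom C g = Cod C f"
  shows "(g \<boxplus> g') \<cdot> f = g \<cdot> f \<boxplus> g' \<cdot> f"
  using Comp_Add_left[of f "Dom C f" "Cod C f" g "Cod C g" g'] assms by (simp add: Hom_iff)

lemma comp_sub:
  assumes "f \<in> Arr C" "f' \<in> Arr C" "Dom C f' = Dom C f" "Cod C f' = Cod C f"
    "g \<in> Arr C" "Dom C g = Cod C f"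
  shows "g \<cdot> (f \<boxminus> f') = g \<cdot> f \<boxminus> g \<cdot> f'"
proof -
  have "g \<cdot> (f \<boxminus> f') \<boxplus> g \<cdot> f' = g \<cdot> f"
    using assms comp_Add[of "f \<boxminus> f'" f' g, symmetric] by (simp add: add_sub_cancel)
  then show ?thesis using assms by (subst sub_eq_iff(2)) simp_all
qed

lemma sub_comp:
  assumes "g \<in> Arr C" "g' \<in> Arr C" "Dom C g' = Dom C g" "Cod C g' = Cod C g"
    "f \<in> Arr C" "Dom C g = Cod C f"
  shows "(g \<boxminus> g') \<cdot> f = g \<cdot> f \<boxminus> g' \<cdot> f"
proof -
  have "(g \<boxminus> g') \<cdot> f \<boxplus> g' \<cdot> f = g \<cdot> f"
    using assms Add_comp[of "g \<boxminus> g'" g' f, symmetric] by (simp add: add_sub_cancel)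
  then show ?thesis using assms by (subst sub_eq_iff(2)) simp_all
qed

lemma comp_Zero [simp]:
  "\<lbrakk>g \<in> Arr C; Dom C g = b; a \<in> Ob C\<rbrakk> \<Longrightarrow> g \<cdot> Zero C a b = Zero C a (Cod C g)"
  "\<lbrakk>f \<in> Arr C; Cod C f = b; c \<in> Ob C\<rbrakk> \<Longrightarrow> Zero C b c \<cdot> f = Zero C (Dom C f) c"
  using Comp_Zero_right[of g b "Cod C g" a] Comp_Zero_left[of f "Dom C f" b c]
  by (simp_all add: Hom_iff)

lemma comp_Id [simp]:
  "f \<in> Arr C \<Longrightarrow> Dom C f = a \<Longrightarrow> f \<cdot> Id C a = f"
  "f \<in> Arr C \<Longrightarrow> Cod C f = b \<Longrightarrow> Id C b \<cdot> f = f"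
  using Id_right[of f a "Cod C f"] Id_left[of f "Dom C f" b] by (simp_all add: Hom_iff)

text \<open>\<open>distrib\<close> expands an expression into sums of right-nested composites.
  \<open>arith\<close> then compares two such expressions in the hom group: negatives become
  differences from zero, and differences are moved across the equation until both sides are plain
  sums.\<close>

lemmas distrib = comp_assoc comp_Add Add_comp comp_sub sub_comp
lemmas arith = distrib neg_eq sub_rules sub_eq_iff add_ac

text \<open>An equation for \<open>g \<cdot> f\<close> does not match inside the right-nested
  composite \<open>g \<cdot> (f \<cdot> x)\<close>. The primed facts of later proofs, such as
  \<open>pv'\<close> or \<open>uk2'\<close>, are obtained from this rule.\<close>

lemma comp_eq_comp:
  assumes "g \<cdot> f = h" "f \<in> Arr C" "g \<in> Arr C" "Dom C g = Cod C f" "x \<in> Arr C" "Cod C x = Dom C f"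
  shows "g \<cdot> (f \<cdot> x) = h \<cdot> x"
  using assms comp_assoc[of x f g] by simp

end

section \<open>Complexes, chain maps and biproducts as rewrite rules\<close>

lemma index_simps [simp]:
  "n + 1 + 1 = n + (2 :: int)" "n + 1 + 2 = n + (3 :: int)"
  "n + 2 + 1 = n + (3 :: int)" "n - 1 + 2 = n + (1 :: int)" "n + 2 - 1 = n + (1 :: int)"
  by simp_all

text \<open>For \<open>S \<subseteq> Ob C\<close> these are the complexes of the full subcategory on
  \<open>S\<close>, but taken inside \<open>C\<close>, where they can be related to complexes whose
  objects lie outside \<open>S\<close>.\<close>

definition cplx_in :: "('o, 'm, 'z) precat_scheme \<Rightarrow> 'o set \<Rightarrow> ('o, 'm) cplx set" where
  "cplx_in C S = {M \<in> complexes C. \<forall>n. obj M n \<in> S}"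

text \<open>
  The homotopy \<open>\<sigma>\<close> is indexed by its target: \<open>\<sigma> n\<close> is the component \<open>M (n + 1) \<Rightarrow> N n\<close>.
\<close>

definition null_homotopy ::
  "('o, 'm, 'z) precat_scheme \<Rightarrow> ('o, 'm) cplx \<Rightarrow> ('o, 'm) cplx \<Rightarrow> (int \<Rightarrow> 'm) \<Rightarrow> (int \<Rightarrow> 'm) \<Rightarrow> bool" where
  "null_homotopy C M N u \<sigma> \<longleftrightarrow> (\<forall>n. \<sigma> n \<in> Hom C (obj M (n + 1)) (obj N n) \<and>
     u (n + 1) = diff N n \<cdot>\<^bsub>C\<^esub> \<sigma> n \<boxplus>\<^bsub>C\<^esub> \<sigma> (n + 1) \<cdot>\<^bsub>C\<^esub> diff M (n + 1))"

context preadditive_category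
begin

text \<open>The premise \<open>m = n + 1\<close> lets the simplifier cancel consecutive
  differentials whatever the form of their indices, for instance \<open>n - 1\<close> and
  \<open>n\<close>.\<close>

lemma cplx_simps:
  assumes "M \<in> complexes C"
  shows "obj M n \<in> Ob C" "diff M n \<in> Arr C" "Dom C (diff M n) = obj M n" "Cod C (diff M n) = obj M (n + 1)"
    "m = n + 1 \<Longrightarrow> diff M m \<cdot> diff M n = Zero C (obj M n) (obj M (m + 1))"
    "m = n + 1 \<Longrightarrow> x \<in> Arr C \<Longrightarrow> Cod C x = obj M n \<Longrightarrow>
       diff M m \<cdot> (diff M n \<cdot> x) = Zero C (Dom C x) (obj M (m + 1))"
proof -
  have *: "obj M n \<in> Ob C" "diff M n \<in> Arr C" "Dom C (diff M n) = obj M n" "Cod C (diff M n) = obj M (n + 1)"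
    "diff M (n + 1) \<cdot> diff M n = Zero C (obj M n) (obj M (n + 1 + 1))" for n
    using assms unfolding complexes_def Hom_iff by blast+
  then show "obj M n \<in> Ob C" "diff M n \<in> Arr C" "Dom C (diff M n) = obj M n" "Cod C (diff M n) = obj M (n + 1)"
    by auto
  show "diff M m \<cdot> diff M n = Zero C (obj M n) (obj M (m + 1))" if "m = n + 1"
    using *(5)[of n] that by simp
  then show "diff M m \<cdot> (diff M n \<cdot> x) = Zero C (Dom C x) (obj M (m + 1))"
    if "m = n + 1" "x \<in> Arr C" "Cod C x = obj M n"
    using that * comp_assoc[of x "diff M n" "diff M m"] by simp
qed

lemma chain_simps:
  assumes "f \<in> chain_maps C M N" "M \<in> complexes C" "N \<in> complexes C"
  shows "f n \<in> Arr C" "Dom C (f n) = obj M n" "Cod C (f n) = obj N n"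
    "diff N n \<cdot> f n = f (n + 1) \<cdot> diff M n"
    "x \<in> Arr C \<Longrightarrow> Cod C x = obj M n \<Longrightarrow> diff N n \<cdot> (f n \<cdot> x) = f (n + 1) \<cdot> (diff M n \<cdot> x)"
proof -
  have *: "f n \<in> Arr C" "Dom C (f n) = obj M n" "Cod C (f n) = obj N n"
    "diff N n \<cdot> f n = f (n + 1) \<cdot> diff M n" for n
    using assms(1) unfolding chain_maps_def Hom_iff by blast+
  then show "f n \<in> Arr C" "Dom C (f n) = obj M n" "Cod C (f n) = obj N n"
    "diff N n \<cdot> f n = f (n + 1) \<cdot> diff M n" by auto
  show "diff N n \<cdot> (f n \<cdot> x) = f (n + 1) \<cdot> (diff M n \<cdot> x)" if "x \<in> Arr C" "Cod C x = obj M n"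
    using that * cplx_simps[OF assms(2)] cplx_simps[OF assms(3)]
      comp_assoc[of x "f n" "diff N n"] comp_assoc[of x "diff M n" "f (n + 1)"] by simp
qed

lemma null_simps:
  assumes "null_homotopy C M N u \<sigma>"
  shows "\<sigma> n \<in> Arr C" "Dom C (\<sigma> n) = obj M (n + 1)" "Cod C (\<sigma> n) = obj N n"
    "m = n + 1 \<Longrightarrow> u m = diff N n \<cdot> \<sigma> n \<boxplus> \<sigma> m \<cdot> diff M m"
  using assms unfolding null_homotopy_def Hom_iff by auto

lemma biproduct_simps:
  assumes "biproduct C a b s i1 i2 p1 p2"
  shows "a \<in> Ob C" "b \<in> Ob C" "s \<in> Ob C"
    "i1 \<in> Arr C" "Dom C i1 = a" "Cod C i1 = s" "i2 \<in> Arr C" "Dom C i2 = b" "Cod C i2 = s"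
    "p1 \<in> Arr C" "Dom C p1 = s" "Cod C p1 = a" "p2 \<in> Arr C" "Dom C p2 = s" "Cod C p2 = b"
    "p1 \<cdot> i1 = Id C a" "p2 \<cdot> i2 = Id C b" "p1 \<cdot> i2 = Zero C b a" "p2 \<cdot> i1 = Zero C a b"
    "x \<in> Arr C \<Longrightarrow> Cod C x = a \<Longrightarrow> p1 \<cdot> (i1 \<cdot> x) = x"
    "x \<in> Arr C \<Longrightarrow> Cod C x = b \<Longrightarrow> p2 \<cdot> (i2 \<cdot> x) = x"
    "x \<in> Arr C \<Longrightarrow> Cod C x = b \<Longrightarrow> p1 \<cdot> (i2 \<cdot> x) = Zero C (Dom C x) a"
    "x \<in> Arr C \<Longrightarrow> Cod C x = a \<Longrightarrow> p2 \<cdot> (i1 \<cdot> x) = Zero C (Dom C x) b"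
proof -
  show *: "a \<in> Ob C" "b \<in> Ob C" "s \<in> Ob C"
    "i1 \<in> Arr C" "Dom C i1 = a" "Cod C i1 = s" "i2 \<in> Arr C" "Dom C i2 = b" "Cod C i2 = s"
    "p1 \<in> Arr C" "Dom C p1 = s" "Cod C p1 = a" "p2 \<in> Arr C" "Dom C p2 = s" "Cod C p2 = b"
    "p1 \<cdot> i1 = Id C a" "p2 \<cdot> i2 = Id C b" "p1 \<cdot> i2 = Zero C b a" "p2 \<cdot> i1 = Zero C a b"
    using assms by (simp_all add: biproduct_def Hom_iff)
  show "x \<in> Arr C \<Longrightarrow> Cod C x = a \<Longrightarrow> p1 \<cdot> (i1 \<cdot> x) = x"
    "x \<in> Arr C \<Longrightarrow> Cod C x = b \<Longrightarrow> p2 \<cdot> (i2 \<cdot> x) = x"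
    "x \<in> Arr C \<Longrightarrow> Cod C x = b \<Longrightarrow> p1 \<cdot> (i2 \<cdot> x) = Zero C (Dom C x) a"
    "x \<in> Arr C \<Longrightarrow> Cod C x = a \<Longrightarrow> p2 \<cdot> (i1 \<cdot> x) = Zero C (Dom C x) b"
    by (simp_all add: * comp_assoc[symmetric])
qed

text \<open>The identity of \<open>s\<close> is \<open>i1 p1 + i2 p2\<close>. This rule and the next
  reduce equations between maps of cones and of \<open>T\<close> to their matrix entries.\<close>

lemma biproduct_eq_in:
  assumes bp: "biproduct C a b s i1 i2 p1 p2"
    and "u \<in> Arr C" "Cod C u = s" "v \<in> Arr C" "Cod C v = s" "Dom C u = Dom C v"
    and "p1 \<cdot> u = p1 \<cdot> v" "p2 \<cdot> u = p2 \<cdot> v"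
  shows "u = v"
proof -
  note [simp] = biproduct_simps[OF bp]
  have "w = i1 \<cdot> (p1 \<cdot> w) \<boxplus> i2 \<cdot> (p2 \<cdot> w)" if "w \<in> Arr C" "Cod C w = s" for w
  proof -
    have "(i1 \<cdot> p1 \<boxplus> i2 \<cdot> p2) \<cdot> w = w" using bp that by (simp add: biproduct_def)
    then show ?thesis using that by (simp add: distrib)
  qed
  from this[of u] this[of v] show ?thesis using assms by simp
qed

lemma biproduct_eq_out:
  assumes bp: "biproduct C a b s i1 i2 p1 p2"
    and "u \<in> Arr C" "Dom C u = s" "v \<in> Arr C" "Dom C v = s" "Cod C u = Cod C v"
    and "u \<cdot> i1 = v \<cdot> i1" "u \<cdot> i2 = v \<cdot> i2"
  shows "u = v"
proof -
  note [simp] = biproduct_simps[OF bp]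
  have "w = w \<cdot> i1 \<cdot> p1 \<boxplus> w \<cdot> i2 \<cdot> p2" if "w \<in> Arr C" "Dom C w = s" for w
  proof -
    have "w \<cdot> (i1 \<cdot> p1 \<boxplus> i2 \<cdot> p2) = w" using bp that by (simp add: biproduct_def)
    then show ?thesis using that by (simp add: distrib)
  qed
  from this[of u] this[of v] show ?thesis using assms by simp
qed

end

section \<open>Conflations\<close>

text \<open>The last two clauses make the objects of \<X> projective and those of \<Y> injective
  relative to the sequence; the remaining exactness under both Hom functors is contained in the
  kernel and cokernel clauses.\<close>

definition conflation ::
  "('o, 'm, 'z) precat_scheme \<Rightarrow> 'o set \<Rightarrow> 'o set \<Rightarrow> 'm \<Rightarrow> 'm \<Rightarrow> bool" where
  "conflation C \<X> \<Y> \<phi> q \<longleftrightarrow> is_kernel C q \<phi> \<and> is_cokernel C \<phi> q \<and>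
     (\<forall>P \<in> \<X>. \<forall>u \<in> Hom C P (Cod C q). \<exists>v \<in> Hom C P (Dom C q). q \<cdot>\<^bsub>C\<^esub> v = u) \<and>
     (\<forall>Q \<in> \<Y>. \<forall>u \<in> Hom C (Dom C \<phi>) Q. \<exists>v \<in> Hom C (Cod C \<phi>) Q. v \<cdot>\<^bsub>C\<^esub> \<phi> = u)"

context preadditive_category
begin

lemma kernel_monic:
  assumes k: "is_kernel C f k" and "u \<in> Arr C" "v \<in> Arr C" "Cod C u = Dom C k" "Cod C v = Dom C k"
    "Dom C u = Dom C v" "k \<cdot> u = k \<cdot> v"
  shows "u = v"
proof -
  have [simp]: "f \<in> Arr C" "k \<in> Arr C" "Cod C k = Dom C f" "f \<cdot> k = Zero C (Dom C k) (Cod C f)"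
    using k by (simp_all add: is_kernel_def)
  have "f \<cdot> (k \<cdot> v) = Zero C (Dom C v) (Cod C f)"
    using assms by (simp add: comp_assoc[symmetric])
  moreover have "Dom C v \<in> Ob C" "k \<cdot> v \<in> Hom C (Dom C v) (Dom C f)"
    using assms by (simp_all add: Hom_iff)
  ultimately have "\<exists>!w. w \<in> Hom C (Dom C v) (Dom C k) \<and> k \<cdot> w = k \<cdot> v"
    using k unfolding is_kernel_def by blast
  then show ?thesis using assms by (auto simp: Hom_iff)
qed

lemma cokernel_epic:
  assumes k: "is_cokernel C f k" and "u \<in> Arr C" "v \<in> Arr C" "Dom C u = Cod C k" "Dom C v = Cod C k"
    "Cod C u = Cod C v" "u \<cdot> k = v \<cdot> k"
  shows "u = v"
proof -
  have [simp]: "f \<in> Arr C" "k \<in> Arr C" "Dom C k = Cod C f" "k \<cdot> f = Zero C (Dom C f) (Cod C k)"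
    using k by (simp_all add: is_cokernel_def)
  have "v \<cdot> k \<cdot> f = Zero C (Dom C f) (Cod C v)"
    using assms by (simp add: comp_assoc)
  moreover have "Cod C v \<in> Ob C" "v \<cdot> k \<in> Hom C (Cod C f) (Cod C v)"
    using assms by (simp_all add: Hom_iff)
  ultimately have "\<exists>!w. w \<in> Hom C (Cod C k) (Cod C v) \<and> w \<cdot> k = v \<cdot> k"
    using k unfolding is_cokernel_def by blast
  then show ?thesis using assms by (auto simp: Hom_iff)
qed

lemma kernel_lift:
  assumes k: "is_kernel C f k" and u: "u \<in> Arr C" "Cod C u = Dom C f" "f \<cdot> u = Zero C (Dom C u) (Cod C f)"
  obtains v where "v \<in> Arr C" "Dom C v = Dom C u" "Cod C v = Dom C k" "k \<cdot> v = u"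
proof -
  have "Dom C u \<in> Ob C" "u \<in> Hom C (Dom C u) (Dom C f)" using u by (simp_all add: Hom_iff)
  then have "\<exists>v. v \<in> Hom C (Dom C u) (Dom C k) \<and> k \<cdot> v = u"
    using k u(3) unfolding is_kernel_def by blast
  then show ?thesis using that by (auto simp: Hom_iff)
qed

lemma cokernel_extend:
  assumes k: "is_cokernel C f k" and u: "u \<in> Arr C" "Dom C u = Cod C f" "u \<cdot> f = Zero C (Dom C f) (Cod C u)"
  obtains v where "v \<in> Arr C" "Dom C v = Cod C k" "Cod C v = Cod C u" "v \<cdot> k = u"
proof -
  have "Cod C u \<in> Ob C" "u \<in> Hom C (Cod C f) (Cod C u)" using u by (simp_all add: Hom_iff)
  then have "\<exists>v. v \<in> Hom C (Cod C k) (Cod C u) \<and> v \<cdot> k = u"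
    using k u(3) unfolding is_cokernel_def by blast
  then show ?thesis using that by (auto simp: Hom_iff)
qed

lemma conflation_arr:
  assumes "conflation C \<X> \<Y> \<phi> q"
  shows "\<phi> \<in> Arr C" "q \<in> Arr C" "Dom C q = Cod C \<phi>" "q \<cdot> \<phi> = Zero C (Dom C \<phi>) (Cod C q)"
  using assms by (simp_all add: conflation_def is_cokernel_def)

lemma conflation_mono:
  assumes "conflation C \<X> \<Y> \<phi> q" "\<phi> \<cdot> u = \<phi> \<cdot> v" "u \<in> Arr C" "v \<in> Arr C" "Cod C u = Dom C \<phi>"
    "Cod C v = Dom C \<phi>" "Dom C u = Dom C v"
  shows "u = v"
  using assms kernel_monic[of q \<phi> u v] by (simp add: conflation_def)

lemma conflation_epi:
  assumes "conflation C \<X> \<Y> \<phi> q" "u \<cdot> q = v \<cdot> q" "u \<in> Arr C" "v \<in> Arr C" "Dom C u = Cod C q"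
    "Dom C v = Cod C q" "Cod C u = Cod C v"
  shows "u = v"
  using assms cokernel_epic[of \<phi> q u v] by (simp add: conflation_def)

lemma conflation_kernel:
  assumes "conflation C \<X> \<Y> \<phi> q" "u \<in> Arr C" "Cod C u = Cod C \<phi>" "q \<cdot> u = Zero C (Dom C u) (Cod C q)"
  shows "\<exists>v. v \<in> Arr C \<and> Dom C v = Dom C u \<and> Cod C v = Dom C \<phi> \<and> \<phi> \<cdot> v = u"
  using assms kernel_lift[of q \<phi> u] conflation_arr[OF assms(1)] by (metis conflation_def)

lemma conflation_cokernel:
  assumes "conflation C \<X> \<Y> \<phi> q" "u \<in> Arr C" "Dom C u = Cod C \<phi>" "u \<cdot> \<phi> = Zero C (Dom C \<phi>) (Cod C u)"
  shows "\<exists>v. v \<in> Arr C \<and> Dom C v = Cod C q \<and> Cod C v = Cod C u \<and> v \<cdot> q = u"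
  using assms cokernel_extend[of \<phi> q u] conflation_arr[OF assms(1)] by (metis conflation_def)

lemma conflation_lift:
  assumes "conflation C \<X> \<Y> \<phi> q" "u \<in> Arr C" "Cod C u = Cod C q" "Dom C u \<in> \<X>"
  shows "\<exists>v. v \<in> Arr C \<and> Dom C v = Dom C u \<and> Cod C v = Cod C \<phi> \<and> q \<cdot> v = u"
proof -
  have "u \<in> Hom C (Dom C u) (Cod C q)" using assms(2,3) by (simp add: Hom_iff)
  then obtain v where "v \<in> Hom C (Dom C u) (Dom C q)" "q \<cdot> v = u"
    using assms(1,4) unfolding conflation_def by blast
  then show ?thesis using conflation_arr[OF assms(1)] by (auto simp: Hom_iff)
qed

lemma conflation_extend:
  assumes "conflation C \<X> \<Y> \<phi> q" "u \<in> Arr C" "Dom C u = Dom C \<phi>" "Cod C u \<in> \<Y>"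
  shows "\<exists>v. v \<in> Arr C \<and> Dom C v = Cod C \<phi> \<and> Cod C v = Cod C u \<and> v \<cdot> \<phi> = u"
proof -
  have "u \<in> Hom C (Dom C \<phi>) (Cod C u)" using assms(2,3) by (simp add: Hom_iff)
  then obtain v where "v \<in> Hom C (Cod C \<phi>) (Cod C u)" "v \<cdot> \<phi> = u"
    using assms(1,4) unfolding conflation_def by blast
  then show ?thesis by (auto simp: Hom_iff)
qed

end

section \<open>Extending and lifting chain maps along a resolution\<close>

text \<open>
  Since null homotopies extend strictly, so do chain maps: a chain map \<open>M \<rightarrow> Q\<close> is a null homotopy of
  the zero map \<open>M \<rightarrow> Q[1]\<close>.
\<close>

definition null_extending ::
  "('o, 'm, 'z) precat_scheme \<Rightarrow> 'o set \<Rightarrow> ('o, 'm) cplx \<Rightarrow> ('o, 'm) cplx \<Rightarrow> (int \<Rightarrow> 'm) \<Rightarrow> bool" where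
  "null_extending C \<Y> M T j \<longleftrightarrow> (\<forall>Q \<in> cplx_in C \<Y>. \<forall>u \<in> chain_maps C T Q. \<forall>\<sigma>.
     null_homotopy C M Q (\<lambda>n. u n \<cdot>\<^bsub>C\<^esub> j n) \<sigma> \<longrightarrow>
     (\<exists>\<tau>. null_homotopy C T Q u \<tau> \<and> (\<forall>n. \<tau> n \<cdot>\<^bsub>C\<^esub> j (n + 1) = \<sigma> n)))"

text \<open>The two conjuncts are surjectivity and injectivity, on homotopy classes, of composition
  with \<open>j\<close>. Injectivity is phrased for null homotopic maps because it is applied to
  differences.\<close>

definition homotopy_lifting ::
  "('o, 'm, 'z) precat_scheme \<Rightarrow> 'o set \<Rightarrow> ('o, 'm) cplx \<Rightarrow> ('o, 'm) cplx \<Rightarrow> (int \<Rightarrow> 'm) \<Rightarrow> bool" where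
  "homotopy_lifting C \<X> M T j \<longleftrightarrow> (\<forall>P \<in> cplx_in C \<X>.
     (\<forall>v \<in> chain_maps C P T. \<exists>f \<in> chain_maps C P M. \<exists>\<sigma>. null_homotopy C P T (\<lambda>n. v n \<boxminus>\<^bsub>C\<^esub> j n \<cdot>\<^bsub>C\<^esub> f n) \<sigma>) \<and>
     (\<forall>f \<in> chain_maps C P M. \<forall>\<sigma>. null_homotopy C P T (\<lambda>n. j n \<cdot>\<^bsub>C\<^esub> f n) \<sigma> \<longrightarrow> (\<exists>\<tau>. null_homotopy C P M f \<tau>)))"

section \<open>One step of the coresolution of a complex\<close>

text \<open>
  Since \<open>h\<close> lifts the differential of \<open>M\<close> to \<open>B\<close>, the cokernel of \<open>(\<phi> n, \<phi> (n + 1) d) : M n \<rightarrow> B n \<oplus> B (n + 1)\<close> is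
  \<open>D (n + 1) \<oplus> B (n + 1)\<close>. Hence \<open>T n = D n \<oplus> B n\<close>, with differential given by the matrix rows \<open>(e, q)\<close> and
  \<open>(g, h)\<close>.
\<close>

locale coresolution_step = preadditive_category C
  for C :: "('o, 'm, 'z) precat_scheme" (structure) +
  fixes \<X> \<Y> :: "'o set" and M :: "('o, 'm) cplx" and B D S :: "int \<Rightarrow> 'o"
    and \<phi> q h e g i1 i2 p1 p2 :: "int \<Rightarrow> 'm"
  assumes M: "M \<in> complexes C"
    and conf: "conflation C \<X> \<Y> (\<phi> n) (q n)"
    and objs: "Dom C (\<phi> n) = obj M n" "Cod C (\<phi> n) = B n" "Cod C (q n) = D (n + 1)"
    and h: "h n \<in> Hom C (B n) (B (n + 1))" "h n \<cdot> \<phi> n = \<phi> (n + 1) \<cdot> diff M n"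
    and e: "e n \<in> Hom C (D n) (D (n + 1))" "e (n + 1) \<cdot> q n = Zero C (B n) (D (n + 2)) \<boxminus> q (n + 1) \<cdot> h n"
    and g: "g n \<in> Hom C (D n) (B (n + 1))" "g (n + 1) \<cdot> q n = Zero C (B n) (B (n + 2)) \<boxminus> h (n + 1) \<cdot> h n"
    and bp: "biproduct C (D n) (B n) (S n) (i1 n) (i2 n) (p1 n) (p2 n)"
begin

lemma typing [simp]:
  "\<phi> n \<in> Arr C" "q n \<in> Arr C" "Dom C (q n) = B n"
  "h n \<in> Arr C" "Dom C (h n) = B n" "Cod C (h n) = B (n + 1)"
  "e n \<in> Arr C" "Dom C (e n) = D n" "Cod C (e n) = D (n + 1)"
  "g n \<in> Arr C" "Dom C (g n) = D n" "Cod C (g n) = B (n + 1)"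
  using conflation_arr[OF conf] h(1) e(1) g(1) objs by (simp_all add: Hom_iff)

declare objs [simp] cplx_simps [OF M, simp] biproduct_simps [OF bp, simp]

lemma phi_mono:
  "\<phi> n \<cdot> u = \<phi> n \<cdot> v \<Longrightarrow> u \<in> Arr C \<Longrightarrow> v \<in> Arr C \<Longrightarrow> Cod C u = obj M n \<Longrightarrow> Cod C v = obj M n \<Longrightarrow>
   Dom C u = Dom C v \<Longrightarrow> u = v"
  using conflation_mono[OF conf[of n], of u v] by simp

lemma q_epi:
  "u \<cdot> q n = v \<cdot> q n \<Longrightarrow> u \<in> Arr C \<Longrightarrow> v \<in> Arr C \<Longrightarrow> Dom C u = D (n + 1) \<Longrightarrow> Dom C v = D (n + 1) \<Longrightarrow>
   Cod C u = Cod C v \<Longrightarrow> u = v"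
  using conflation_epi[OF conf[of n], of u v] by simp

lemma h_phi [simp]:
  "h n \<cdot> \<phi> n = \<phi> (n + 1) \<cdot> diff M n"
  "x \<in> Arr C \<Longrightarrow> Cod C x = obj M n \<Longrightarrow> h n \<cdot> (\<phi> n \<cdot> x) = \<phi> (n + 1) \<cdot> (diff M n \<cdot> x)"
  using h(2) comp_eq_comp[OF h(2), where x = x] by (simp_all add: comp_assoc)

lemma q_phi [simp]:
  "q n \<cdot> \<phi> n = Zero C (obj M n) (D (n + 1))"
  "x \<in> Arr C \<Longrightarrow> Cod C x = obj M n \<Longrightarrow> q n \<cdot> (\<phi> n \<cdot> x) = Zero C (Dom C x) (D (n + 1))"
  using conflation_arr(4)[OF conf[of n]] comp_eq_comp[OF conflation_arr(4)[OF conf[of n]], where x = x]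
  by (simp_all add: comp_assoc)

text \<open>The signs of \<open>e\<close> and \<open>g\<close> are chosen so that the square of the
  matrix with rows \<open>(e, q)\<close> and \<open>(g, h)\<close> vanishes: \<open>e_q\<close> and
  \<open>g_q\<close> are its second column, \<open>e_e\<close> and \<open>g_e\<close> its
  first.\<close>

lemma e_q:
  assumes "m = n + 1"
  shows "e m \<cdot> q n = Zero C (B n) (D (m + 1)) \<boxminus> q m \<cdot> h n"
    "x \<in> Arr C \<Longrightarrow> Cod C x = B n \<Longrightarrow> e m \<cdot> (q n \<cdot> x) = Zero C (Dom C x) (D (m + 1)) \<boxminus> q m \<cdot> (h n \<cdot> x)"
  using e(2)[of n] comp_eq_comp[OF e(2)[of n], where x = x] assms by (simp_all add: distrib)

lemma g_q:
  assumes "m = n + 1"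
  shows "g m \<cdot> q n = Zero C (B n) (B (m + 1)) \<boxminus> h m \<cdot> h n"
    "x \<in> Arr C \<Longrightarrow> Cod C x = B n \<Longrightarrow> g m \<cdot> (q n \<cdot> x) = Zero C (Dom C x) (B (m + 1)) \<boxminus> h m \<cdot> (h n \<cdot> x)"
  using g(2)[of n] comp_eq_comp[OF g(2)[of n], where x = x] assms by (simp_all add: distrib)

text \<open>\<open>q (n - 1)\<close> is epic onto \<open>D n\<close>, and after composition with it
  both sides become \<open>q h h\<close>.\<close>

lemma e_e:
  assumes "m = n + 1"
  shows "e m \<cdot> e n = Zero C (D n) (D (m + 1)) \<boxminus> q m \<cdot> g n"
    "x \<in> Arr C \<Longrightarrow> Cod C x = D n \<Longrightarrow> e m \<cdot> (e n \<cdot> x) = Zero C (Dom C x) (D (m + 1)) \<boxminus> q m \<cdot> (g n \<cdot> x)"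
proof -
  have "e m \<cdot> e n \<cdot> q (n - 1) = (Zero C (D n) (D (m + 1)) \<boxminus> q m \<cdot> g n) \<cdot> q (n - 1)"
    using assms by (simp add: arith e_q g_q)
  then show *: "e m \<cdot> e n = Zero C (D n) (D (m + 1)) \<boxminus> q m \<cdot> g n"
    by (rule q_epi) (use assms in \<open>simp_all add: cplx_simps\<close>)
  show "x \<in> Arr C \<Longrightarrow> Cod C x = D n \<Longrightarrow> e m \<cdot> (e n \<cdot> x) = Zero C (Dom C x) (D (m + 1)) \<boxminus> q m \<cdot> (g n \<cdot> x)"
    using comp_eq_comp[OF *, where x = x] assms by (simp add: distrib)
qed

lemma g_e:
  assumes "m = n + 1"
  shows "g m \<cdot> e n = Zero C (D n) (B (m + 1)) \<boxminus> h m \<cdot> g n"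
    "x \<in> Arr C \<Longrightarrow> Cod C x = D n \<Longrightarrow> g m \<cdot> (e n \<cdot> x) = Zero C (Dom C x) (B (m + 1)) \<boxminus> h m \<cdot> (g n \<cdot> x)"
proof -
  have "g m \<cdot> e n \<cdot> q (n - 1) = (Zero C (D n) (B (m + 1)) \<boxminus> h m \<cdot> g n) \<cdot> q (n - 1)"
    using assms by (simp add: arith e_q g_q)
  then show *: "g m \<cdot> e n = Zero C (D n) (B (m + 1)) \<boxminus> h m \<cdot> g n"
    by (rule q_epi) (use assms in \<open>simp_all\<close>)
  show "x \<in> Arr C \<Longrightarrow> Cod C x = D n \<Longrightarrow> g m \<cdot> (e n \<cdot> x) = Zero C (Dom C x) (B (m + 1)) \<boxminus> h m \<cdot> (g n \<cdot> x)"
    using comp_eq_comp[OF *, where x = x] assms by (simp add: distrib)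
qed

definition T :: "('o, 'm) cplx" where
  "T = \<lparr>obj = S, diff = (\<lambda>n. i1 (n + 1) \<cdot> (e n \<cdot> p1 n \<boxplus> q n \<cdot> p2 n) \<boxplus> i2 (n + 1) \<cdot> (g n \<cdot> p1 n \<boxplus> h n \<cdot> p2 n))\<rparr>"

definition j :: "int \<Rightarrow> 'm" where
  "j n = i2 n \<cdot> \<phi> n"

lemma T_complex: "T \<in> complexes C"
proof -
  have "diff T (n + 1) \<cdot> diff T n = Zero C (S n) (S (n + 2))" for n
    by (simp add: T_def arith e_q g_q e_e g_e)
  then show ?thesis by (simp add: complexes_def Hom_iff) (simp add: T_def)
qed

text \<open>The component of \<open>d j\<close> in \<open>D\<close> is \<open>q \<phi> = 0\<close>,
  the one in \<open>B\<close> is \<open>h \<phi> = \<phi> d\<close>.\<close>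

lemma j_chain: "j \<in> chain_maps C M T"
  by (simp add: chain_maps_def Hom_iff) (simp add: T_def j_def arith)


lemma T_simps: "obj T = S"
  "diff T n = i1 (n + 1) \<cdot> (e n \<cdot> p1 n \<boxplus> q n \<cdot> p2 n) \<boxplus> i2 (n + 1) \<cdot> (g n \<cdot> p1 n \<boxplus> h n \<cdot> p2 n)"
  by (simp_all add: T_def)

text \<open>The summand \<open>B\<close> comes first: there the homotopy is an extension of
  \<open>\<sigma>\<close> over \<open>\<phi>\<close>, possible because the objects of
  \<open>Q\<close> lie in \<Y>, and this already secures the prescribed restriction. The defect that
  remains on \<open>B\<close> dictates the homotopy on \<open>D\<close>.\<close>

lemma null_extending_j: "null_extending C \<Y> M T j"
  unfolding null_extending_def
proof (intro ballI allI impI)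
  fix Q u \<sigma> assume Q: "Q \<in> cplx_in C \<Y>" and u: "u \<in> chain_maps C T Q"
    and \<sigma>: "null_homotopy C M Q (\<lambda>n. u n \<cdot> j n) \<sigma>"
  have QC: "Q \<in> complexes C" and QY: "obj Q n \<in> \<Y>" for n using Q by (simp_all add: cplx_in_def)
  note [simp] = cplx_simps[OF QC] chain_simps(1-3)[OF u T_complex QC] null_simps(1-3)[OF \<sigma>] T_simps(1)
  have "\<exists>t. t \<in> Arr C \<and> Dom C t = B (n + 1) \<and> Cod C t = obj Q n \<and> t \<cdot> \<phi> (n + 1) = \<sigma> n" for n
    using conflation_extend[OF conf[of "n + 1"], of "\<sigma> n"] QY by simp
  then obtain t2 where t2 [simp]: "\<And>n. t2 n \<in> Arr C" "\<And>n. Dom C (t2 n) = B (n + 1)"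
      "\<And>n. Cod C (t2 n) = obj Q n" "\<And>n. t2 n \<cdot> \<phi> (n + 1) = \<sigma> n"
    by metis
  have t2\<phi> [simp]: "t2 n \<cdot> (\<phi> (n + 1) \<cdot> x) = \<sigma> n \<cdot> x" if "x \<in> Arr C" "Cod C x = obj M (n + 1)" for n x
    using comp_eq_comp[OF t2(4)[of n], where x = x] that by (simp add: comp_assoc)
  \<comment> \<open>By the hypothesis on \<open>\<sigma>\<close>, what \<open>t2\<close> misses on
    the summand \<open>B\<close> vanishes on \<open>\<phi> n\<close>, hence factors through
    \<open>q n\<close>.\<close>
  have "\<exists>t. t \<in> Arr C \<and> Dom C t = D (n + 1) \<and> Cod C t = obj Q n \<and>
      t \<cdot> q n = u n \<cdot> i2 n \<boxminus> (diff Q (n - 1) \<cdot> t2 (n - 1) \<boxplus> t2 n \<cdot> h n)" (is "\<exists>t. ?P n t") for n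
  proof -
    have "(u n \<cdot> i2 n \<boxminus> (diff Q (n - 1) \<cdot> t2 (n - 1) \<boxplus> t2 n \<cdot> h n)) \<cdot> \<phi> n = Zero C (obj M n) (obj Q n)"
      using null_simps(4)[OF \<sigma>, of n "n - 1"] t2(4)[of "n - 1"] by (simp add: arith j_def)
    then show ?thesis
      using conflation_cokernel[OF conf[of n], of "u n \<cdot> i2 n \<boxminus> (diff Q (n - 1) \<cdot> t2 (n - 1) \<boxplus> t2 n \<cdot> h n)"]
      by simp
  qed
  then obtain t where t: "\<And>n. ?P n (t n)" by metis
  define t1 where "t1 n = t n" for n
  have [simp]: "t n \<in> Arr C" "Dom C (t n) = D (n + 1)" "Cod C (t n) = obj Q n" for n
    using t by blast+
  have tq: "u n \<cdot> i2 n = t n \<cdot> q n \<boxplus> (diff Q (n - 1) \<cdot> t2 (n - 1) \<boxplus> t2 n \<cdot> h n)" for n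
    using t[of n] sub_eq_iff(2)[of "u n \<cdot> i2 n" "diff Q (n - 1) \<cdot> t2 (n - 1) \<boxplus> t2 n \<cdot> h n" "t n \<cdot> q n"]
    by simp
  have ui2: "u m \<cdot> (i2 m \<cdot> x) = t m \<cdot> (q m \<cdot> x) \<boxplus> (diff Q (m - 1) \<cdot> (t2 (m - 1) \<cdot> x) \<boxplus> t2 m \<cdot> (h m \<cdot> x))"
    if "x \<in> Arr C" "Cod C x = B m" for m x
    using comp_eq_comp[OF tq[of m], where x = x] that by (simp add: distrib)
  \<comment> \<open>The chain map equation of \<open>u\<close> on the summand \<open>B\<close>,
    solved for the part that passes through \<open>D\<close>.\<close>
  have uq: "u m \<cdot> (i1 m \<cdot> q n) = diff Q n \<cdot> (u n \<cdot> i2 n) \<boxminus> u m \<cdot> (i2 m \<cdot> h n)" if "m = n + 1" for m n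
  proof -
    have "diff Q n \<cdot> (u n \<cdot> i2 n) = u (n + 1) \<cdot> (diff T n \<cdot> i2 n)"
      using chain_simps(5)[OF u T_complex QC, of "i2 n" n] by simp
    then show ?thesis using that by (simp add: T_simps arith)
  qed
  \<comment> \<open>The homotopy equation on \<open>D\<close>; since \<open>q\<close> is epic it
    follows from the equation on \<open>B\<close> in two neighbouring degrees.\<close>
  have u1: "u (n + 1) \<cdot> i1 (n + 1) = diff Q n \<cdot> t n \<boxplus> (t (n + 1) \<cdot> e (n + 1) \<boxplus> t2 (n + 1) \<cdot> g (n + 1))" for n
  proof (rule q_epi)
    show "u (n + 1) \<cdot> i1 (n + 1) \<cdot> q n =
        (diff Q n \<cdot> t n \<boxplus> (t (n + 1) \<cdot> e (n + 1) \<boxplus> t2 (n + 1) \<cdot> g (n + 1))) \<cdot> q n"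
      by (simp add: arith uq tq ui2 e_q g_q)
  qed simp_all
  show "\<exists>\<tau>. null_homotopy C T Q u \<tau> \<and> (\<forall>n. \<tau> n \<cdot> j (n + 1) = \<sigma> n)"
  proof (intro exI conjI allI)
    show "null_homotopy C T Q u (\<lambda>n. t n \<cdot> p1 (n + 1) \<boxplus> t2 n \<cdot> p2 (n + 1))" (is "null_homotopy C T Q u ?\<tau>")
      unfolding null_homotopy_def
    proof (intro allI conjI)
      fix n
      show "?\<tau> n \<in> Hom C (obj T (n + 1)) (obj Q n)" by (simp add: Hom_iff)
      show "u (n + 1) = diff Q n \<cdot> ?\<tau> n \<boxplus> ?\<tau> (n + 1) \<cdot> diff T (n + 1)"
        by (rule biproduct_eq_out[OF bp[of "n + 1"]]) (simp_all add: T_simps arith u1 tq)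
    qed
    show "(t n \<cdot> p1 (n + 1) \<boxplus> t2 n \<cdot> p2 (n + 1)) \<cdot> j (n + 1) = \<sigma> n" for n
      by (simp add: j_def arith)
  qed
qed

text \<open>The component in \<open>D\<close> of a map from \<open>P\<close> lifts through
  \<open>q\<close>, because the objects of \<open>P\<close> lie in \<X>. The lift, regarded as a
  homotopy into the summand \<open>B\<close>, removes that component, and what remains in
  \<open>B\<close> is killed by \<open>q\<close>, so it comes from \<open>M\<close>. Null homotopies
  are treated like maps, one degree lower.\<close>

lemma homotopy_lifting_j: "homotopy_lifting C \<X> M T j"
  unfolding homotopy_lifting_def
proof (intro ballI conjI allI impI)
  fix P v assume P: "P \<in> cplx_in C \<X>" and v: "v \<in> chain_maps C P T"
  have PC: "P \<in> complexes C" and PX: "obj P n \<in> \<X>" for n using P by (simp_all add: cplx_in_def)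
  note [simp] = cplx_simps[OF PC] chain_simps(1-3)[OF v PC T_complex] T_simps(1)
  have "\<exists>s. s \<in> Arr C \<and> Dom C s = obj P (n + 1) \<and> Cod C s = B n \<and> q n \<cdot> s = p1 (n + 1) \<cdot> v (n + 1)" for n
    using conflation_lift[OF conf[of n], of "p1 (n + 1) \<cdot> v (n + 1)"] PX by simp
  then obtain s where s [simp]: "\<And>n. s n \<in> Arr C" "\<And>n. Dom C (s n) = obj P (n + 1)"
      "\<And>n. Cod C (s n) = B n" and qs: "\<And>n. q n \<cdot> s n = p1 (n + 1) \<cdot> v (n + 1)"
    by metis
  have pv: "p1 m \<cdot> v m = q n \<cdot> s n" if "m = n + 1" for m n using qs[of n] that by simp
  have pv': "p1 m \<cdot> (v m \<cdot> x) = q n \<cdot> (s n \<cdot> x)" if "m = n + 1" "x \<in> Arr C" "Cod C x = obj P m" for m n x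
    using comp_eq_comp[OF pv[OF that(1)], where x = x] that by (simp add: comp_assoc)
  have c1: "q n \<cdot> (p2 n \<cdot> v n) = p1 (n + 1) \<cdot> (v (n + 1) \<cdot> diff P n) \<boxminus> e n \<cdot> (p1 n \<cdot> v n)"
    and c2: "h n \<cdot> (p2 n \<cdot> v n) = p2 (n + 1) \<cdot> (v (n + 1) \<cdot> diff P n) \<boxminus> g n \<cdot> (p1 n \<cdot> v n)" for n
  proof -
    have "p1 (n + 1) \<cdot> (diff T n \<cdot> v n) = p1 (n + 1) \<cdot> (v (n + 1) \<cdot> diff P n)"
      "p2 (n + 1) \<cdot> (diff T n \<cdot> v n) = p2 (n + 1) \<cdot> (v (n + 1) \<cdot> diff P n)"
      using chain_simps(4)[OF v PC T_complex, of n] by simp_all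
    then show "q n \<cdot> (p2 n \<cdot> v n) = p1 (n + 1) \<cdot> (v (n + 1) \<cdot> diff P n) \<boxminus> e n \<cdot> (p1 n \<cdot> v n)"
      "h n \<cdot> (p2 n \<cdot> v n) = p2 (n + 1) \<cdot> (v (n + 1) \<cdot> diff P n) \<boxminus> g n \<cdot> (p1 n \<cdot> v n)"
      by (simp_all add: T_simps arith)
  qed
  \<comment> \<open>The component in \<open>B\<close> of \<open>v\<close> minus the boundary of the
    homotopy \<open>i2 n \<cdot> s n\<close>; the component in \<open>D\<close> of this difference
    is zero.\<close>
  let ?b = "\<lambda>n. p2 (n + 1) \<cdot> v (n + 1) \<boxminus> (h n \<cdot> s n \<boxplus> s (n + 1) \<cdot> diff P (n + 1))"
  have "\<exists>f. f \<in> Arr C \<and> Dom C f = obj P (n + 1) \<and> Cod C f = obj M (n + 1) \<and> \<phi> (n + 1) \<cdot> f = ?b n" for n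
  proof -
    have "q (n + 1) \<cdot> ?b n = Zero C (obj P (n + 1)) (D (n + 2))"
      by (simp add: arith c1 pv[where n = n] pv'[where n = "n + 1"] e_q)
    then show ?thesis using conflation_kernel[OF conf[of "n + 1"], of "?b n"] by simp
  qed
  then obtain f' where f': "\<And>n. f' n \<in> Arr C" "\<And>n. Dom C (f' n) = obj P (n + 1)"
      "\<And>n. Cod C (f' n) = obj M (n + 1)" "\<And>n. \<phi> (n + 1) \<cdot> f' n = ?b n"
    by metis
  \<comment> \<open>\<open>f' n\<close> is the component in degree \<open>n + 1\<close>, because
    \<open>s n\<close> starts there.\<close>
  define f where "f n = f' (n - 1)" for n
  have f [simp]: "f n \<in> Arr C" "Dom C (f n) = obj P n" "Cod C (f n) = obj M n" for n
    using f'[of "n - 1"] by (simp_all add: f_def)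
  have pf: "\<phi> m \<cdot> f m = p2 m \<cdot> v m \<boxminus> (h n \<cdot> s n \<boxplus> s m \<cdot> diff P m)" if "m = n + 1" for m n
    using f'(4)[of n] that by (simp add: f_def)
  have pf': "\<phi> m \<cdot> (f m \<cdot> x) = p2 m \<cdot> (v m \<cdot> x) \<boxminus> (h n \<cdot> (s n \<cdot> x) \<boxplus> s m \<cdot> (diff P m \<cdot> x))"
    if "m = n + 1" "x \<in> Arr C" "Cod C x = obj P m" for m n x
    using comp_eq_comp[OF pf[OF that(1)], where x = x] that by (simp add: distrib)
  have "f \<in> chain_maps C P M"
    unfolding chain_maps_def
  proof (intro CollectI allI conjI)
    fix n
    show "f n \<in> Hom C (obj P n) (obj M n)" by (simp add: Hom_iff)
    show "diff M n \<cdot> f n = f (n + 1) \<cdot> diff P n"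
    proof (rule phi_mono)
      have "\<phi> (n + 1) \<cdot> (diff M n \<cdot> f n) = h n \<cdot> (\<phi> n \<cdot> f n)" by simp
      also have "\<dots> = \<phi> (n + 1) \<cdot> (f (n + 1) \<cdot> diff P n)"
        by (simp add: arith pf[of n "n - 1"] pf'[of "n + 1" n] c2 pv[of n "n - 1"] g_q)
      finally show "\<phi> (n + 1) \<cdot> (diff M n \<cdot> f n) = \<phi> (n + 1) \<cdot> (f (n + 1) \<cdot> diff P n)" .
    qed simp_all
  qed
  moreover have "null_homotopy C P T (\<lambda>n. v n \<boxminus> j n \<cdot> f n) (\<lambda>n. i2 n \<cdot> s n)"
    unfolding null_homotopy_def
  proof (intro allI conjI)
    fix n
    show "i2 n \<cdot> s n \<in> Hom C (obj P (n + 1)) (obj T n)" by (simp add: Hom_iff)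
    show "v (n + 1) \<boxminus> j (n + 1) \<cdot> f (n + 1) = diff T n \<cdot> (i2 n \<cdot> s n) \<boxplus> i2 (n + 1) \<cdot> s (n + 1) \<cdot> diff P (n + 1)"
      by (rule biproduct_eq_in[OF bp[of "n + 1"]]) (simp_all add: T_simps j_def arith pf[of "n + 1" n] pv[of "n + 1" n])
  qed
  ultimately show "\<exists>f \<in> chain_maps C P M. \<exists>\<sigma>. null_homotopy C P T (\<lambda>n. v n \<boxminus> j n \<cdot> f n) \<sigma>" by blast
next
  fix P f \<sigma> assume P: "P \<in> cplx_in C \<X>" and f: "f \<in> chain_maps C P M"
    and \<sigma>: "null_homotopy C P T (\<lambda>n. j n \<cdot> f n) \<sigma>"
  have PC: "P \<in> complexes C" and PX: "obj P n \<in> \<X>" for n using P by (simp_all add: cplx_in_def)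
  note [simp] = cplx_simps[OF PC] chain_simps(1-3)[OF f PC M] null_simps(1-3)[OF \<sigma>] T_simps(1)
  have "\<exists>s. s \<in> Arr C \<and> Dom C s = obj P (n + 2) \<and> Cod C s = B n \<and> q n \<cdot> s = p1 (n + 1) \<cdot> \<sigma> (n + 1)" for n
    using conflation_lift[OF conf[of n], of "p1 (n + 1) \<cdot> \<sigma> (n + 1)"] PX by simp
  then obtain s where s [simp]: "\<And>n. s n \<in> Arr C" "\<And>n. Dom C (s n) = obj P (n + 2)"
      "\<And>n. Cod C (s n) = B n" and qs: "\<And>n. q n \<cdot> s n = p1 (n + 1) \<cdot> \<sigma> (n + 1)"
    by metis
  have ps: "p1 m \<cdot> \<sigma> m = q n \<cdot> s n" if "m = n + 1" for m n using qs[of n] that by simp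
  have ps': "p1 m \<cdot> (\<sigma> m \<cdot> x) = q n \<cdot> (s n \<cdot> x)" if "m = n + 1" "x \<in> Arr C" "Cod C x = obj P (m + 1)" for m n x
    using comp_eq_comp[OF ps[OF that(1)], where x = x] that by (simp add: comp_assoc)
  \<comment> \<open>The two components of the homotopy equation; the one in \<open>D\<close> has
    zero on the left because \<open>j\<close> lands in \<open>B\<close>.\<close>
  have c1: "q n \<cdot> (p2 n \<cdot> \<sigma> n) =
      Zero C (obj P (n + 1)) (D (n + 1)) \<boxminus> (e n \<cdot> (p1 n \<cdot> \<sigma> n) \<boxplus> p1 (n + 1) \<cdot> (\<sigma> (n + 1) \<cdot> diff P (n + 1)))"
    and c2: "\<phi> (n + 1) \<cdot> f (n + 1) =
      g n \<cdot> (p1 n \<cdot> \<sigma> n) \<boxplus> (h n \<cdot> (p2 n \<cdot> \<sigma> n) \<boxplus> p2 (n + 1) \<cdot> (\<sigma> (n + 1) \<cdot> diff P (n + 1)))" for n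
  proof -
    have *: "j (n + 1) \<cdot> f (n + 1) = diff T n \<cdot> \<sigma> n \<boxplus> \<sigma> (n + 1) \<cdot> diff P (n + 1)"
      using null_simps(4)[OF \<sigma>, of "n + 1" n] by simp
    have "p1 (n + 1) \<cdot> (j (n + 1) \<cdot> f (n + 1)) = p1 (n + 1) \<cdot> (diff T n \<cdot> \<sigma> n \<boxplus> \<sigma> (n + 1) \<cdot> diff P (n + 1))"
      "p2 (n + 1) \<cdot> (j (n + 1) \<cdot> f (n + 1)) = p2 (n + 1) \<cdot> (diff T n \<cdot> \<sigma> n \<boxplus> \<sigma> (n + 1) \<cdot> diff P (n + 1))"
      unfolding * by (rule refl)+
    then show "q n \<cdot> (p2 n \<cdot> \<sigma> n) =
        Zero C (obj P (n + 1)) (D (n + 1)) \<boxminus> (e n \<cdot> (p1 n \<cdot> \<sigma> n) \<boxplus> p1 (n + 1) \<cdot> (\<sigma> (n + 1) \<cdot> diff P (n + 1)))"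
      "\<phi> (n + 1) \<cdot> f (n + 1) =
        g n \<cdot> (p1 n \<cdot> \<sigma> n) \<boxplus> (h n \<cdot> (p2 n \<cdot> \<sigma> n) \<boxplus> p2 (n + 1) \<cdot> (\<sigma> (n + 1) \<cdot> diff P (n + 1)))"
      by (simp_all add: T_simps j_def arith)
  qed
  \<comment> \<open>\<open>\<sigma>\<close> is changed by the boundary of a map of degree -2, namely
    \<open>i2 (n - 1) \<cdot> s (n - 1)\<close>, which removes its component in \<open>D\<close>. In
    that degree the boundary of \<open>\<theta>\<close> is \<open>d \<theta> - \<theta> d\<close>,
    hence the plus sign of the last term.\<close>
  let ?b = "\<lambda>n. p2 n \<cdot> \<sigma> n \<boxminus> h (n - 1) \<cdot> s (n - 1) \<boxplus> s n \<cdot> diff P (n + 1)"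
  have "\<exists>t. t \<in> Arr C \<and> Dom C t = obj P (n + 1) \<and> Cod C t = obj M n \<and> \<phi> n \<cdot> t = ?b n" for n
  proof -
    have "q n \<cdot> ?b n = Zero C (obj P (n + 1)) (D (n + 1))"
      by (simp add: arith c1 ps[of n "n - 1"] ps'[of "n + 1" n] e_q)
    then show ?thesis using conflation_kernel[OF conf[of n], of "?b n"] by simp
  qed
  then obtain t where t [simp]: "\<And>n. t n \<in> Arr C" "\<And>n. Dom C (t n) = obj P (n + 1)"
      "\<And>n. Cod C (t n) = obj M n" and pt: "\<And>n. \<phi> n \<cdot> t n = ?b n"
    by metis
  have pt': "\<phi> n \<cdot> (t n \<cdot> x) = p2 n \<cdot> (\<sigma> n \<cdot> x) \<boxminus> h (n - 1) \<cdot> (s (n - 1) \<cdot> x) \<boxplus> s n \<cdot> (diff P (n + 1) \<cdot> x)"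
    if "x \<in> Arr C" "Cod C x = obj P (n + 1)" for n x
    using comp_eq_comp[OF pt[of n], where x = x] that by (simp add: distrib)
  have "null_homotopy C P M f t"
    unfolding null_homotopy_def
  proof (intro allI conjI)
    fix n
    show "t n \<in> Hom C (obj P (n + 1)) (obj M n)" by (simp add: Hom_iff)
    show "f (n + 1) = diff M n \<cdot> t n \<boxplus> t (n + 1) \<cdot> diff P (n + 1)"
    proof (rule phi_mono)
      have "\<phi> (n + 1) \<cdot> (diff M n \<cdot> t n \<boxplus> t (n + 1) \<cdot> diff P (n + 1)) =
          h n \<cdot> (\<phi> n \<cdot> t n) \<boxplus> \<phi> (n + 1) \<cdot> (t (n + 1) \<cdot> diff P (n + 1))"
        by (simp add: distrib)
      also have "\<dots> = \<phi> (n + 1) \<cdot> f (n + 1)"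
        by (simp add: arith pt pt' c2 ps[of n "n - 1"] g_q)
      finally show "\<phi> (n + 1) \<cdot> f (n + 1) = \<phi> (n + 1) \<cdot> (diff M n \<cdot> t n \<boxplus> t (n + 1) \<cdot> diff P (n + 1))"
        by (rule sym)
    qed simp_all
  qed
  then show "\<exists>\<tau>. null_homotopy C P M f \<tau>" by blast
qed

end

section \<open>Chain maps and null homotopies\<close>

context preadditive_category
begin

lemma chain_mapsI:
  assumes "\<And>n. f n \<in> Arr C" "\<And>n. Dom C (f n) = obj M n" "\<And>n. Cod C (f n) = obj N n"
    "\<And>n. diff N n \<cdot> f n = f (n + 1) \<cdot> diff M n"
  shows "f \<in> chain_maps C M N"
  using assms by (simp add: chain_maps_def Hom_iff)

lemma null_homotopyI:
  assumes "\<And>n. \<sigma> n \<in> Arr C" "\<And>n. Dom C (\<sigma> n) = obj M (n + 1)" "\<And>n. Cod C (\<sigma> n) = obj N n"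
    "\<And>n. u (n + 1) = diff N n \<cdot> \<sigma> n \<boxplus> \<sigma> (n + 1) \<cdot> diff M (n + 1)"
  shows "null_homotopy C M N u \<sigma>"
  using assms by (simp add: null_homotopy_def Hom_iff)

context
  fixes M :: "('o, 'm) cplx"
  assumes M: "M \<in> complexes C"
begin

lemma chain_Id: "(\<lambda>n. Id C (obj M n)) \<in> chain_maps C M M"
  by (rule chain_mapsI) (simp_all add: cplx_simps[OF M])

context
  fixes N :: "('o, 'm) cplx"
  assumes N: "N \<in> complexes C"
begin

lemma chain_Zero: "(\<lambda>n. Zero C (obj M n) (obj N n)) \<in> chain_maps C M N"
  by (rule chain_mapsI) (simp_all add: cplx_simps[OF M] cplx_simps[OF N])

lemma chain_Add:
  assumes f: "f \<in> chain_maps C M N" and g: "g \<in> chain_maps C M N"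
  shows "(\<lambda>n. f n \<boxplus> g n) \<in> chain_maps C M N"
  by (rule chain_mapsI)
    (simp_all add: cplx_simps[OF M] cplx_simps[OF N] chain_simps[OF f M N] chain_simps[OF g M N] distrib)

lemma chain_sub:
  assumes f: "f \<in> chain_maps C M N" and g: "g \<in> chain_maps C M N"
  shows "(\<lambda>n. f n \<boxminus> g n) \<in> chain_maps C M N"
  by (rule chain_mapsI)
    (simp_all add: cplx_simps[OF M] cplx_simps[OF N] chain_simps[OF f M N] chain_simps[OF g M N] distrib)

lemma null_Zero: "null_homotopy C M N (\<lambda>n. Zero C (obj M n) (obj N n)) (\<lambda>n. Zero C (obj M (n + 1)) (obj N n))"
  by (rule null_homotopyI) (simp_all add: cplx_simps[OF M] cplx_simps[OF N])

lemma null_Add: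
  assumes u: "null_homotopy C M N u \<sigma>" and v: "null_homotopy C M N v \<tau>"
  shows "null_homotopy C M N (\<lambda>n. u n \<boxplus> v n) (\<lambda>n. \<sigma> n \<boxplus> \<tau> n)"
  by (rule null_homotopyI)
    (simp_all add: cplx_simps[OF M] cplx_simps[OF N] null_simps(1-3)[OF u] null_simps(1-3)[OF v]
      null_simps(4)[OF u refl] null_simps(4)[OF v refl] arith)

lemma null_sub:
  assumes u: "null_homotopy C M N u \<sigma>" and v: "null_homotopy C M N v \<tau>"
  shows "null_homotopy C M N (\<lambda>n. u n \<boxminus> v n) (\<lambda>n. \<sigma> n \<boxminus> \<tau> n)"
  by (rule null_homotopyI)
    (simp_all add: cplx_simps[OF M] cplx_simps[OF N] null_simps(1-3)[OF u] null_simps(1-3)[OF v]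
      null_simps(4)[OF u refl] null_simps(4)[OF v refl] arith)

text \<open>Translates between two conventions: the homotopies of \<open>homotopy_rel\<close> are
  indexed by their source, those of \<open>null_homotopy\<close> by their target, so the indices
  differ by one, and a homotopy between two maps becomes a null homotopy of their
  difference.\<close>

lemma homotopy_rel_iff:
  "(f, g) \<in> homotopy_rel C M N \<longleftrightarrow>
    f \<in> chain_maps C M N \<and> g \<in> chain_maps C M N \<and> (\<exists>\<sigma>. null_homotopy C M N (\<lambda>n. f n \<boxminus> g n) \<sigma>)"
proof (cases "f \<in> chain_maps C M N \<and> g \<in> chain_maps C M N")
  case True
  then have f: "f \<in> chain_maps C M N" and g: "g \<in> chain_maps C M N" by blast+
  note [simp] = cplx_simps[OF M] cplx_simps[OF N] chain_simps(1-3)[OF f M N] chain_simps(1-3)[OF g M N]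
  let ?P = "\<lambda>s. \<forall>n. s n \<in> Hom C (obj M n) (obj N (n - 1)) \<and>
          f n = g n \<boxplus> (diff N (n - 1) \<cdot> s n \<boxplus> s (n + 1) \<cdot> diff M n)"
  have "(\<exists>s. ?P s) \<longleftrightarrow> (\<exists>\<sigma>. null_homotopy C M N (\<lambda>n. f n \<boxminus> g n) \<sigma>)"
  proof
    assume "\<exists>s. ?P s"
    then obtain s where s: "\<And>n. s n \<in> Hom C (obj M n) (obj N (n - 1))"
        "\<And>n. f n = g n \<boxplus> (diff N (n - 1) \<cdot> s n \<boxplus> s (n + 1) \<cdot> diff M n)"
      by blast
    have [simp]: "s n \<in> Arr C" "Dom C (s n) = obj M n" "Cod C (s n) = obj N (n - 1)" for n
      using s(1)[of n] by (simp_all add: Hom_iff)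
    have "null_homotopy C M N (\<lambda>n. f n \<boxminus> g n) (\<lambda>n. s (n + 1))"
    proof (rule null_homotopyI)
      fix n show "f (n + 1) \<boxminus> g (n + 1) = diff N n \<cdot> s (n + 1) \<boxplus> s (n + 1 + 1) \<cdot> diff M (n + 1)"
        using s(2)[of "n + 1"] by (simp add: sub_eq_iff add_ac)
    qed simp_all
    then show "\<exists>\<sigma>. null_homotopy C M N (\<lambda>n. f n \<boxminus> g n) \<sigma>" by blast
  next
    assume "\<exists>\<sigma>. null_homotopy C M N (\<lambda>n. f n \<boxminus> g n) \<sigma>"
    then obtain \<sigma> where \<sigma>: "null_homotopy C M N (\<lambda>n. f n \<boxminus> g n) \<sigma>" by blast
    note [simp] = null_simps(1-3)[OF \<sigma>]
    have "f n = g n \<boxplus> (diff N (n - 1) \<cdot> \<sigma> (n - 1) \<boxplus> \<sigma> n \<cdot> diff M n)" for n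
      using null_simps(4)[OF \<sigma>, of n "n - 1"] by (simp add: sub_eq_iff add_ac)
    then have "?P (\<lambda>n. \<sigma> (n - 1))" by (simp add: Hom_iff)
    then show "\<exists>s. ?P s" by (rule exI[where x = "\<lambda>n. \<sigma> (n - 1)"])
  qed
  then show ?thesis using True by (simp add: homotopy_rel_def)
next
  case False
  then show ?thesis by (auto simp: homotopy_rel_def)
qed

context
  fixes L :: "('o, 'm) cplx"
  assumes L: "L \<in> complexes C"
begin

lemma chain_Comp:
  assumes f: "f \<in> chain_maps C M N" and g: "g \<in> chain_maps C N L"
  shows "(\<lambda>n. g n \<cdot> f n) \<in> chain_maps C M L"
  by (rule chain_mapsI)
    (simp_all add: cplx_simps[OF M] cplx_simps[OF N] cplx_simps[OF L] chain_simps[OF f M N] chain_simps[OF g N L]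
      distrib)

lemma null_comp_left:
  assumes u: "null_homotopy C M N u \<sigma>" and f: "f \<in> chain_maps C N L"
  shows "null_homotopy C M L (\<lambda>n. f n \<cdot> u n) (\<lambda>n. f n \<cdot> \<sigma> n)"
  by (rule null_homotopyI)
    (simp_all add: cplx_simps[OF M] cplx_simps[OF N] cplx_simps[OF L] chain_simps[OF f N L] null_simps(1-3)[OF u]
      null_simps(4)[OF u refl] arith)

lemma null_comp_right:
  assumes f: "f \<in> chain_maps C M N" and u: "null_homotopy C N L u \<sigma>"
  shows "null_homotopy C M L (\<lambda>n. u n \<cdot> f n) (\<lambda>n. \<sigma> n \<cdot> f (n + 1))"
proof (rule null_homotopyI)
  fix n
  have "f (n + 1 + 1) \<cdot> diff M (n + 1) = diff N (n + 1) \<cdot> f (n + 1)"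
    using chain_simps(4)[OF f M N, of "n + 1"] by simp
  then show "u (n + 1) \<cdot> f (n + 1) = diff L n \<cdot> (\<sigma> n \<cdot> f (n + 1)) \<boxplus> \<sigma> (n + 1) \<cdot> f (n + 1 + 1) \<cdot> diff M (n + 1)"
    by (simp add: cplx_simps[OF M] cplx_simps[OF N] cplx_simps[OF L] chain_simps(1-3)[OF f M N] null_simps(1-3)[OF u]
      null_simps(4)[OF u refl] arith)
qed (simp_all add: cplx_simps[OF M] cplx_simps[OF N] cplx_simps[OF L] chain_simps(1-3)[OF f M N] null_simps(1-3)[OF u])

end

end

end

lemma null_extendingD:
  assumes "null_extending C \<Y> M T j" "Q \<in> cplx_in C \<Y>" "u \<in> chain_maps C T Q"
    "null_homotopy C M Q (\<lambda>n. u n \<cdot> j n) \<sigma>"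
  shows "\<exists>\<tau>. null_homotopy C T Q u \<tau> \<and> (\<forall>n. \<tau> n \<cdot> j (n + 1) = \<sigma> n)"
  using assms unfolding null_extending_def by blast

lemma homotopy_liftingD:
  assumes "homotopy_lifting C \<X> M T j" "P \<in> cplx_in C \<X>"
  shows "v \<in> chain_maps C P T \<Longrightarrow>
      \<exists>f \<in> chain_maps C P M. \<exists>\<sigma>. null_homotopy C P T (\<lambda>n. v n \<boxminus> j n \<cdot> f n) \<sigma>"
    "f \<in> chain_maps C P M \<Longrightarrow> null_homotopy C P T (\<lambda>n. j n \<cdot> f n) \<sigma> \<Longrightarrow> \<exists>\<tau>. null_homotopy C P M f \<tau>"
  using assms unfolding homotopy_lifting_def by blast+

text \<open>\<open>\<sigma>\<close> is extended over \<open>j\<close> and the result over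
  \<open>j'\<close>. Since each extension restricts strictly, the last one restricts to
  \<open>\<sigma>\<close> along the composite.\<close>

lemma null_extending_comp:
  assumes M: "M \<in> complexes C" and T: "T \<in> complexes C" and T': "T' \<in> complexes C"
    and j: "j \<in> chain_maps C M T" and j': "j' \<in> chain_maps C T T'"
    and ext: "null_extending C \<Y> M T j" "null_extending C \<Y> T T' j'"
  shows "null_extending C \<Y> M T' (\<lambda>n. j' n \<cdot> j n)"
  unfolding null_extending_def
proof (intro ballI allI impI)
  fix Q u \<sigma> assume Q: "Q \<in> cplx_in C \<Y>" and u: "u \<in> chain_maps C T' Q"
    and \<sigma>: "null_homotopy C M Q (\<lambda>n. u n \<cdot> (j' n \<cdot> j n)) \<sigma>"
  have QC: "Q \<in> complexes C" using Q by (simp add: cplx_in_def)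
  note [simp] = chain_simps(1-3)[OF j M T] chain_simps(1-3)[OF j' T T'] chain_simps(1-3)[OF u T' QC]
  have uj': "(\<lambda>n. u n \<cdot> j' n) \<in> chain_maps C T Q" by (rule chain_Comp[OF T T' QC j' u])
  have "null_homotopy C M Q (\<lambda>n. u n \<cdot> j' n \<cdot> j n) \<sigma>" using \<sigma> by (simp add: comp_assoc)
  then obtain \<tau> where \<tau>: "null_homotopy C T Q (\<lambda>n. u n \<cdot> j' n) \<tau>" "\<And>n. \<tau> n \<cdot> j (n + 1) = \<sigma> n"
    using null_extendingD[OF ext(1) Q uj'] by blast
  then obtain \<rho> where \<rho>: "null_homotopy C T' Q u \<rho>" "\<And>n. \<rho> n \<cdot> j' (n + 1) = \<tau> n"
    using null_extendingD[OF ext(2) Q u] by blast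
  have "\<rho> n \<cdot> (j' (n + 1) \<cdot> j (n + 1)) = \<sigma> n" for n
    using comp_eq_comp[OF \<rho>(2)[of n], where x = "j (n + 1)"] \<tau>(2)[of n] null_simps(1-3)[OF \<rho>(1)] by simp
  then show "\<exists>\<tau>. null_homotopy C T' Q u \<tau> \<and> (\<forall>n. \<tau> n \<cdot> (j' (n + 1) \<cdot> j (n + 1)) = \<sigma> n)"
    using \<rho>(1) by blast
qed

text \<open>A map is lifted first through \<open>j'\<close>, then through \<open>j\<close>; the
  homotopy of the first lifting and the image under \<open>j'\<close> of the second add up.\<close>

lemma homotopy_lifting_comp:
  assumes M: "M \<in> complexes C" and T: "T \<in> complexes C" and T': "T' \<in> complexes C"
    and j: "j \<in> chain_maps C M T" and j': "j' \<in> chain_maps C T T'"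
    and lift: "homotopy_lifting C \<X> M T j" "homotopy_lifting C \<X> T T' j'"
  shows "homotopy_lifting C \<X> M T' (\<lambda>n. j' n \<cdot> j n)"
  unfolding homotopy_lifting_def
proof (intro ballI conjI allI impI)
  fix P v assume P: "P \<in> cplx_in C \<X>" and v: "v \<in> chain_maps C P T'"
  have PC: "P \<in> complexes C" using P by (simp add: cplx_in_def)
  obtain f' \<sigma>' where f': "f' \<in> chain_maps C P T" and \<sigma>': "null_homotopy C P T' (\<lambda>n. v n \<boxminus> j' n \<cdot> f' n) \<sigma>'"
    using homotopy_liftingD(1)[OF lift(2) P v] by blast
  obtain f \<sigma> where f: "f \<in> chain_maps C P M" and \<sigma>: "null_homotopy C P T (\<lambda>n. f' n \<boxminus> j n \<cdot> f n) \<sigma>"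
    using homotopy_liftingD(1)[OF lift(1) P f'] by blast
  note [simp] = chain_simps(1-3)[OF j M T] chain_simps(1-3)[OF j' T T'] chain_simps(1-3)[OF v PC T']
    chain_simps(1-3)[OF f PC M] chain_simps(1-3)[OF f' PC T]
  have "(\<lambda>n. (v n \<boxminus> j' n \<cdot> f' n) \<boxplus> j' n \<cdot> (f' n \<boxminus> j n \<cdot> f n)) = (\<lambda>n. v n \<boxminus> j' n \<cdot> j n \<cdot> f n)"
    by (rule ext) (simp add: arith)
  then have "\<exists>\<tau>. null_homotopy C P T' (\<lambda>n. v n \<boxminus> j' n \<cdot> j n \<cdot> f n) \<tau>"
    using null_Add[OF PC T' \<sigma>' null_comp_left[OF PC T T' \<sigma> j']] by auto
  then show "\<exists>f \<in> chain_maps C P M. \<exists>\<sigma>. null_homotopy C P T' (\<lambda>n. v n \<boxminus> j' n \<cdot> j n \<cdot> f n) \<sigma>"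
    using f by blast
next
  fix P f \<sigma> assume P: "P \<in> cplx_in C \<X>" and f: "f \<in> chain_maps C P M"
    and \<sigma>: "null_homotopy C P T' (\<lambda>n. j' n \<cdot> j n \<cdot> f n) \<sigma>"
  have PC: "P \<in> complexes C" using P by (simp add: cplx_in_def)
  note [simp] = chain_simps(1-3)[OF j M T] chain_simps(1-3)[OF j' T T'] chain_simps(1-3)[OF f PC M]
  have "null_homotopy C P T' (\<lambda>n. j' n \<cdot> (j n \<cdot> f n)) \<sigma>" using \<sigma> by (simp add: comp_assoc)
  then obtain \<tau> where "null_homotopy C P T (\<lambda>n. j n \<cdot> f n) \<tau>"
    using homotopy_liftingD(2)[OF lift(2) P chain_Comp[OF PC M T f j]] by blast
  then show "\<exists>\<tau>. null_homotopy C P M f \<tau>"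
    using homotopy_liftingD(2)[OF lift(1) P f] by blast
qed

end

section \<open>Coresolving a complex\<close>

text \<open>A \<Y>-coresolution spliced from \<open>k\<close> conflations. The recursive form fits
  the construction, in which each step for a complex uses up the first conflation in every
  degree.\<close>

fun coresolvable ::
  "('o, 'm, 'z) precat_scheme \<Rightarrow> 'o set \<Rightarrow> 'o set \<Rightarrow> nat \<Rightarrow> 'o \<Rightarrow> bool" where
  "coresolvable C \<X> \<Y> 0 M \<longleftrightarrow> M \<in> \<Y>"
| "coresolvable C \<X> \<Y> (Suc k) M \<longleftrightarrow>
     (\<exists>\<phi> q. conflation C \<X> \<Y> \<phi> q \<and> Dom C \<phi> = M \<and> Cod C \<phi> \<in> \<Y> \<and> coresolvable C \<X> \<Y> k (Cod C q))"

lemma additive_subcategoryD: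
  assumes "additive_subcategory C \<Y>"
  shows "a \<in> \<Y> \<Longrightarrow> a \<in> Ob C"
    "biproduct C a b s i1 i2 p1 p2 \<Longrightarrow> a \<in> \<Y> \<Longrightarrow> b \<in> \<Y> \<Longrightarrow> s \<in> \<Y>"
    "biproduct C a b s i1 i2 p1 p2 \<Longrightarrow> s \<in> \<Y> \<Longrightarrow> a \<in> \<Y>"
    "\<exists>z \<in> \<Y>. zero_object C z"
  using assms unfolding additive_subcategory_def by blast+

context preadditive_category
begin

lemma conflationI:
  assumes "\<phi> \<in> Arr C" "q \<in> Arr C" "Dom C q = Cod C \<phi>" "q \<cdot> \<phi> = Zero C (Dom C \<phi>) (Cod C q)"
    and mono: "\<And>u v. \<lbrakk>u \<in> Arr C; v \<in> Arr C; Cod C u = Dom C \<phi>; Cod C v = Dom C \<phi>; Dom C u = Dom C v;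
      \<phi> \<cdot> u = \<phi> \<cdot> v\<rbrakk> \<Longrightarrow> u = v"
    and epi: "\<And>u v. \<lbrakk>u \<in> Arr C; v \<in> Arr C; Dom C u = Cod C q; Dom C v = Cod C q; Cod C u = Cod C v;
      u \<cdot> q = v \<cdot> q\<rbrakk> \<Longrightarrow> u = v"
    and ker: "\<And>u. \<lbrakk>u \<in> Arr C; Cod C u = Cod C \<phi>; q \<cdot> u = Zero C (Dom C u) (Cod C q)\<rbrakk> \<Longrightarrow>
      \<exists>v. v \<in> Arr C \<and> Dom C v = Dom C u \<and> Cod C v = Dom C \<phi> \<and> \<phi> \<cdot> v = u"
    and cok: "\<And>u. \<lbrakk>u \<in> Arr C; Dom C u = Cod C \<phi>; u \<cdot> \<phi> = Zero C (Dom C \<phi>) (Cod C u)\<rbrakk> \<Longrightarrow>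
      \<exists>v. v \<in> Arr C \<and> Dom C v = Cod C q \<and> Cod C v = Cod C u \<and> v \<cdot> q = u"
    and lift: "\<And>u. \<lbrakk>u \<in> Arr C; Cod C u = Cod C q; Dom C u \<in> \<X>\<rbrakk> \<Longrightarrow>
      \<exists>v. v \<in> Arr C \<and> Dom C v = Dom C u \<and> Cod C v = Cod C \<phi> \<and> q \<cdot> v = u"
    and ext: "\<And>u. \<lbrakk>u \<in> Arr C; Dom C u = Dom C \<phi>; Cod C u \<in> \<Y>\<rbrakk> \<Longrightarrow>
      \<exists>v. v \<in> Arr C \<and> Dom C v = Cod C \<phi> \<and> Cod C v = Cod C u \<and> v \<cdot> \<phi> = u"
  shows "conflation C \<X> \<Y> \<phi> q"
  unfolding conflation_def
proof (intro conjI ballI)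
  show "is_kernel C q \<phi>"
    unfolding is_kernel_def
  proof (intro conjI ballI impI)
    fix a u assume "u \<in> Hom C a (Dom C q)" "q \<cdot> u = Zero C a (Cod C q)"
    then have u: "u \<in> Arr C" "Dom C u = a" "Cod C u = Cod C \<phi>" "q \<cdot> u = Zero C (Dom C u) (Cod C q)"
      using assms(3) by (simp_all add: Hom_iff)
    obtain v where "v \<in> Arr C" "Dom C v = a" "Cod C v = Dom C \<phi>" "\<phi> \<cdot> v = u"
      using ker[OF u(1,3,4)] u(2) by blast
    then show "\<exists>!v. v \<in> Hom C a (Dom C \<phi>) \<and> \<phi> \<cdot> v = u"
      using mono by (intro ex1I[where a = v]) (auto simp: Hom_iff)
  qed (use assms(1-4) in simp_all)
  show "is_cokernel C \<phi> q"
    unfolding is_cokernel_def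
  proof (intro conjI ballI impI)
    fix a u assume "u \<in> Hom C (Cod C \<phi>) a" "u \<cdot> \<phi> = Zero C (Dom C \<phi>) a"
    then have u: "u \<in> Arr C" "Dom C u = Cod C \<phi>" "Cod C u = a" "u \<cdot> \<phi> = Zero C (Dom C \<phi>) (Cod C u)"
      by (simp_all add: Hom_iff)
    obtain v where "v \<in> Arr C" "Dom C v = Cod C q" "Cod C v = a" "v \<cdot> q = u"
      using cok[OF u(1,2,4)] u(3) by blast
    then show "\<exists>!v. v \<in> Hom C (Cod C q) a \<and> v \<cdot> q = u"
      using epi by (intro ex1I[where a = v]) (auto simp: Hom_iff)
  qed (use assms(1-4) in simp_all)
  show "\<exists>v \<in> Hom C P (Dom C q). q \<cdot> v = u" if "P \<in> \<X>" "u \<in> Hom C P (Cod C q)" for P u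
    using lift[of u] that assms(3) by (auto simp: Hom_iff)
  show "\<exists>v \<in> Hom C (Cod C \<phi>) Q. v \<cdot> \<phi> = u" if "Q \<in> \<Y>" "u \<in> Hom C (Dom C \<phi>) Q" for Q u
    using ext[of u] that by (auto simp: Hom_iff)
qed

text \<open>The sum of the given conflation and of the trivial one
  \<open>b = b \<rightarrow> 0\<close>: subobject and middle term grow by \<open>b\<close>, the
  quotient stays the same.\<close>

lemma conflation_biproduct:
  assumes conf: "conflation C \<X> \<Y> \<phi> q"
    and bp: "biproduct C (Dom C \<phi>) b s i1 i2 p1 p2" and bp': "biproduct C (Cod C \<phi>) b s' i1' i2' p1' p2'"
  shows "conflation C \<X> \<Y> (i1' \<cdot> (\<phi> \<cdot> p1) \<boxplus> i2' \<cdot> p2) (q \<cdot> p1')"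
proof -
  note [simp] = conflation_arr[OF conf] biproduct_simps[OF bp] biproduct_simps[OF bp']
  have [simp]: "q \<cdot> (\<phi> \<cdot> x) = Zero C (Dom C x) (Cod C q)" if "x \<in> Arr C" "Cod C x = Dom C \<phi>" for x
    using comp_eq_comp[OF conflation_arr(4)[OF conf], where x = x] that by simp
  let ?\<phi> = "i1' \<cdot> (\<phi> \<cdot> p1) \<boxplus> i2' \<cdot> p2" and ?q = "q \<cdot> p1'"
  have p1': "p1' \<cdot> (?\<phi> \<cdot> u) = \<phi> \<cdot> (p1 \<cdot> u)" and p2': "p2' \<cdot> (?\<phi> \<cdot> u) = p2 \<cdot> u" if "u \<in> Arr C" "Cod C u = s" for u
    using that by (simp_all add: distrib)
  show ?thesis
  proof (rule conflationI)
    fix u v assume uv: "u \<in> Arr C" "v \<in> Arr C" "Cod C u = Dom C ?\<phi>" "Cod C v = Dom C ?\<phi>" "Dom C u = Dom C v"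
      and eq: "?\<phi> \<cdot> u = ?\<phi> \<cdot> v"
    have "\<phi> \<cdot> (p1 \<cdot> u) = \<phi> \<cdot> (p1 \<cdot> v)" "p2 \<cdot> u = p2 \<cdot> v"
      using p1'[of u] p1'[of v] p2'[of u] p2'[of v] eq uv by simp_all
    moreover from this(1) have "p1 \<cdot> u = p1 \<cdot> v" by (rule conflation_mono[OF conf]) (use uv in simp_all)
    ultimately show "u = v" using uv biproduct_eq_in[OF bp, of u v] by simp
  next
    fix u v assume uv: "u \<in> Arr C" "v \<in> Arr C" "Dom C u = Cod C ?q" "Dom C v = Cod C ?q" "Cod C u = Cod C v"
      and eq: "u \<cdot> ?q = v \<cdot> ?q"
    have "u \<cdot> ?q \<cdot> i1' = v \<cdot> ?q \<cdot> i1'" using eq by simp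
    then have "u \<cdot> q = v \<cdot> q" using uv by (simp add: comp_assoc)
    then show "u = v" by (rule conflation_epi[OF conf]) (use uv in simp_all)
  next
    fix u assume u: "u \<in> Arr C" "Cod C u = Cod C ?\<phi>" "?q \<cdot> u = Zero C (Dom C u) (Cod C ?q)"
    have "q \<cdot> (p1' \<cdot> u) = Zero C (Dom C u) (Cod C q)" using u by (simp add: comp_assoc)
    then obtain v where v [simp]: "v \<in> Arr C" "Dom C v = Dom C u" "Cod C v = Dom C \<phi>" "\<phi> \<cdot> v = p1' \<cdot> u"
      using conflation_kernel[OF conf, of "p1' \<cdot> u"] u by auto
    have "?\<phi> \<cdot> (i1 \<cdot> v \<boxplus> i2 \<cdot> (p2' \<cdot> u)) = u"
      by (rule biproduct_eq_in[OF bp']) (use u in \<open>simp_all add: distrib\<close>)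
    then show "\<exists>v. v \<in> Arr C \<and> Dom C v = Dom C u \<and> Cod C v = Dom C ?\<phi> \<and> ?\<phi> \<cdot> v = u"
      using u by (intro exI[where x = "i1 \<cdot> v \<boxplus> i2 \<cdot> (p2' \<cdot> u)"]) simp
  next
    fix u assume u: "u \<in> Arr C" "Dom C u = Cod C ?\<phi>" "u \<cdot> ?\<phi> = Zero C (Dom C ?\<phi>) (Cod C u)"
    have "u \<cdot> ?\<phi> \<cdot> i1 = Zero C (Dom C \<phi>) (Cod C u)" "u \<cdot> ?\<phi> \<cdot> i2 = Zero C b (Cod C u)"
      unfolding u(3) using u(1) by simp_all
    then have "u \<cdot> i2' = Zero C b (Cod C u)" "u \<cdot> i1' \<cdot> \<phi> = Zero C (Dom C \<phi>) (Cod C u)"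
      using u(1,2) by (simp_all add: distrib)
    then obtain v where v [simp]: "v \<in> Arr C" "Dom C v = Cod C q" "Cod C v = Cod C u" "v \<cdot> q = u \<cdot> i1'"
      and [simp]: "u \<cdot> i2' = Zero C b (Cod C u)"
      using conflation_cokernel[OF conf, of "u \<cdot> i1'"] u by auto
    have "v \<cdot> ?q = u"
      by (rule biproduct_eq_out[OF bp']) (use u(1,2) in \<open>simp_all add: distrib\<close>)
    then show "\<exists>v. v \<in> Arr C \<and> Dom C v = Cod C ?q \<and> Cod C v = Cod C u \<and> v \<cdot> ?q = u"
      by (intro exI[where x = v] conjI) simp_all
  next
    fix u assume u: "u \<in> Arr C" "Cod C u = Cod C ?q" "Dom C u \<in> \<X>"
    then obtain v where [simp]: "v \<in> Arr C" "Dom C v = Dom C u" "Cod C v = Cod C \<phi>" "q \<cdot> v = u"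
      using conflation_lift[OF conf, of u] by auto
    show "\<exists>v. v \<in> Arr C \<and> Dom C v = Dom C u \<and> Cod C v = Cod C ?\<phi> \<and> ?q \<cdot> v = u"
      by (rule exI[where x = "i1' \<cdot> v"]) (simp add: comp_assoc)
  next
    fix u assume u: "u \<in> Arr C" "Dom C u = Dom C ?\<phi>" "Cod C u \<in> \<Y>"
    then obtain v where v [simp]: "v \<in> Arr C" "Dom C v = Cod C \<phi>" "Cod C v = Cod C u" "v \<cdot> \<phi> = u \<cdot> i1"
      using conflation_extend[OF conf, of "u \<cdot> i1"] by auto
    have [simp]: "v \<cdot> (\<phi> \<cdot> x) = u \<cdot> (i1 \<cdot> x)" if "x \<in> Arr C" "Cod C x = Dom C \<phi>" for x
      using comp_eq_comp[OF v(4), where x = x] that u by (simp add: comp_assoc)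
    have "(v \<cdot> p1' \<boxplus> u \<cdot> (i2 \<cdot> p2')) \<cdot> ?\<phi> = u"
      by (rule biproduct_eq_out[OF bp]) (use u in \<open>simp_all add: distrib\<close>)
    then show "\<exists>v. v \<in> Arr C \<and> Dom C v = Cod C ?\<phi> \<and> Cod C v = Cod C u \<and> v \<cdot> ?\<phi> = u"
      using u by (intro exI[where x = "v \<cdot> p1' \<boxplus> u \<cdot> (i2 \<cdot> p2')"]) simp
  qed (simp_all add: distrib)
qed

end

context additive_category
begin

text \<open>A summand in \<Y> is absorbed by the middle term of the first conflation. This is what
  keeps the dimension of \<open>T n\<close> down, which contains \<open>B n\<close> besides the
  quotient \<open>D n\<close>.\<close>

lemma coresolvable_biproduct:
  assumes \<Y>: "additive_subcategory C \<Y>" and b: "b \<in> \<Y>"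
    and bp: "biproduct C a b s i1 i2 p1 p2" and a: "coresolvable C \<X> \<Y> k a"
  shows "coresolvable C \<X> \<Y> k s"
  using bp a
proof (cases k)
  case 0
  then show ?thesis using additive_subcategoryD(2)[OF \<Y> bp] a b by simp
next
  case (Suc k')
  then obtain \<phi> q where conf: "conflation C \<X> \<Y> \<phi> q" and [simp]: "Dom C \<phi> = a"
      and Y: "Cod C \<phi> \<in> \<Y>" and q: "coresolvable C \<X> \<Y> k' (Cod C q)"
    using a by auto
  note [simp] = conflation_arr[OF conf] biproduct_simps[OF bp]
  obtain s' i1' i2' p1' p2' where bp': "biproduct C (Cod C \<phi>) b s' i1' i2' p1' p2'"
    using ex_biproduct[of "Cod C \<phi>" b] by auto
  note [simp] = biproduct_simps[OF bp']
  have "s' \<in> \<Y>" using additive_subcategoryD(2)[OF \<Y> bp' Y b] .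
  then have "conflation C \<X> \<Y> (i1' \<cdot> (\<phi> \<cdot> p1) \<boxplus> i2' \<cdot> p2) (q \<cdot> p1') \<and>
      Dom C (i1' \<cdot> (\<phi> \<cdot> p1) \<boxplus> i2' \<cdot> p2) = s \<and> Cod C (i1' \<cdot> (\<phi> \<cdot> p1) \<boxplus> i2' \<cdot> p2) \<in> \<Y> \<and>
      coresolvable C \<X> \<Y> k' (Cod C (q \<cdot> p1'))"
    using conflation_biproduct[OF conf _ bp', of s i1 i2 p1 p2] bp q by simp
  then show ?thesis unfolding Suc coresolvable.simps by blast
qed

lemma ex_coresolution_step:
  assumes \<Y>: "additive_subcategory C \<Y>" and M: "M \<in> complexes C"
    and res: "\<And>n. coresolvable C \<X> \<Y> (Suc k) (obj M n)"
  shows "\<exists>T \<in> complexes C. \<exists>j \<in> chain_maps C M T.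
    null_extending C \<Y> M T j \<and> homotopy_lifting C \<X> M T j \<and> (\<forall>n. coresolvable C \<X> \<Y> k (obj T n))"
proof -
  note [simp] = cplx_simps[OF M]
  obtain \<phi> q where conf: "\<And>n. conflation C \<X> \<Y> (\<phi> n) (q n)" and \<phi>: "\<And>n. Dom C (\<phi> n) = obj M n"
      and Y: "\<And>n. Cod C (\<phi> n) \<in> \<Y>" and q: "\<And>n. coresolvable C \<X> \<Y> k (Cod C (q n))"
    using res by simp metis
  define B where "B n = Cod C (\<phi> n)" for n
  \<comment> \<open>The quotient of the conflation in degree \<open>n - 1\<close> contributes to
    degree \<open>n\<close> of \<open>T\<close>.\<close>
  define D where "D n = Cod C (q (n - 1))" for n
  have [simp]: "Cod C (\<phi> n) = B n" "Cod C (q n) = D (n + 1)" for n by (simp_all add: B_def D_def)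
  note [simp] = conflation_arr(1,2)[OF conf] \<phi>
  have [simp]: "Dom C (q n) = B n" "q n \<cdot> \<phi> n = Zero C (obj M n) (D (n + 1))" for n
    using conflation_arr(3,4)[OF conf[of n]] by simp_all
  have [simp]: "q n \<cdot> (\<phi> n \<cdot> x) = Zero C (Dom C x) (D (n + 1))" if "x \<in> Arr C" "Cod C x = obj M n" for n x
    using comp_eq_comp[of "q n" "\<phi> n" "Zero C (obj M n) (D (n + 1))" x] Ob_DomCod(2)[of "q n"] that by simp
  have [simp]: "B n \<in> Ob C" "D n \<in> Ob C" for n
    using Ob_DomCod(2)[of "\<phi> n"] Ob_DomCod(2)[of "q (n - 1)"] by simp_all
  \<comment> \<open>\<open>\<phi> (n + 1) \<cdot> diff M n\<close> ends in \<Y> and therefore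
    extends over \<open>\<phi> n\<close>.\<close>
  have "\<exists>h. h \<in> Arr C \<and> Dom C h = B n \<and> Cod C h = B (n + 1) \<and> h \<cdot> \<phi> n = \<phi> (n + 1) \<cdot> diff M n" for n
    using conflation_extend[OF conf[of n], of "\<phi> (n + 1) \<cdot> diff M n"] Y[of "n + 1"] by simp
  then obtain h where h [simp]: "\<And>n. h n \<in> Arr C" "\<And>n. Dom C (h n) = B n" "\<And>n. Cod C (h n) = B (n + 1)"
      "\<And>n. h n \<cdot> \<phi> n = \<phi> (n + 1) \<cdot> diff M n"
    by metis
  have [simp]: "h n \<cdot> (\<phi> n \<cdot> x) = \<phi> (n + 1) \<cdot> (diff M n \<cdot> x)" if "x \<in> Arr C" "Cod C x = obj M n" for n x
    using comp_eq_comp[OF h(4)[of n], where x = x] that by (simp add: comp_assoc)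
  \<comment> \<open>\<open>q h \<phi> = q \<phi> d = 0\<close>, so \<open>- q h\<close> factors
    through the cokernel of \<open>\<phi>\<close>.\<close>
  have "\<exists>e. e \<in> Arr C \<and> Dom C e = D (n + 1) \<and> Cod C e = D (n + 2) \<and>
      e \<cdot> q n = Zero C (B n) (D (n + 2)) \<boxminus> q (n + 1) \<cdot> h n" for n
    using conflation_cokernel[OF conf[of n], of "Zero C (B n) (D (n + 2)) \<boxminus> q (n + 1) \<cdot> h n"]
    by (simp add: distrib)
  then obtain e' where e' [simp]: "\<And>n. e' n \<in> Arr C" "\<And>n. Dom C (e' n) = D (n + 1)"
      "\<And>n. Cod C (e' n) = D (n + 2)" "\<And>n. e' n \<cdot> q n = Zero C (B n) (D (n + 2)) \<boxminus> q (n + 1) \<cdot> h n"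
    by metis
  \<comment> \<open>\<open>h h \<phi> = \<phi> d d = 0\<close>: the failure of \<open>h\<close> to
    be a differential factors through \<open>q\<close> as well.\<close>
  have "\<exists>g. g \<in> Arr C \<and> Dom C g = D (n + 1) \<and> Cod C g = B (n + 2) \<and>
      g \<cdot> q n = Zero C (B n) (B (n + 2)) \<boxminus> h (n + 1) \<cdot> h n" for n
    using conflation_cokernel[OF conf[of n], of "Zero C (B n) (B (n + 2)) \<boxminus> h (n + 1) \<cdot> h n"]
    by (simp add: distrib)
  then obtain g' where g' [simp]: "\<And>n. g' n \<in> Arr C" "\<And>n. Dom C (g' n) = D (n + 1)"
      "\<And>n. Cod C (g' n) = B (n + 2)" "\<And>n. g' n \<cdot> q n = Zero C (B n) (B (n + 2)) \<boxminus> h (n + 1) \<cdot> h n"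
    by metis
  have "\<exists>s i1 i2 p1 p2. biproduct C (D n) (B n) s i1 i2 p1 p2" for n by (rule ex_biproduct) simp_all
  then obtain S i1 i2 p1 p2 where bp: "\<And>n. biproduct C (D n) (B n) (S n) (i1 n) (i2 n) (p1 n) (p2 n)"
    by metis
  \<comment> \<open>The factorizations \<open>e' n\<close> and \<open>g' n\<close> start at
    \<open>D (n + 1)\<close>, the entries of the differential of \<open>T\<close> at
    \<open>D n\<close>, hence the shift by one.\<close>
  interpret coresolution_step C \<X> \<Y> M B D S \<phi> q h "\<lambda>n. e' (n - 1)" "\<lambda>n. g' (n - 1)" i1 i2 p1 p2
    by unfold_locales (use M conf bp in \<open>simp_all add: Hom_iff\<close>)
  have "coresolvable C \<X> \<Y> k (obj T n)" for n
    using coresolvable_biproduct[OF \<Y> _ bp[of n]] Y[of n] q[of "n - 1"] by (simp add: T_simps)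
  then show ?thesis using T_complex j_chain null_extending_j homotopy_lifting_j by blast
qed

lemma ex_coresolution:
  assumes \<Y>: "additive_subcategory C \<Y>"
  shows "M \<in> complexes C \<Longrightarrow> (\<And>n. coresolvable C \<X> \<Y> k (obj M n)) \<Longrightarrow>
    \<exists>T \<in> cplx_in C \<Y>. \<exists>j \<in> chain_maps C M T. null_extending C \<Y> M T j \<and> homotopy_lifting C \<X> M T j"
proof (induction k arbitrary: M)
  case 0
  have M: "M \<in> complexes C" by fact
  have "M \<in> cplx_in C \<Y>" using 0 by (simp add: cplx_in_def)
  moreover have "null_extending C \<Y> M M (\<lambda>n. Id C (obj M n))"
    unfolding null_extending_def
  proof (intro ballI allI impI)
    fix Q u \<sigma> assume Q: "Q \<in> cplx_in C \<Y>" and u: "u \<in> chain_maps C M Q"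
      and \<sigma>: "null_homotopy C M Q (\<lambda>n. u n \<cdot> Id C (obj M n)) \<sigma>"
    have "Q \<in> complexes C" using Q by (simp add: cplx_in_def)
    then have "null_homotopy C M Q u \<sigma>" using \<sigma> chain_simps(1-3)[OF u M] by simp
    then show "\<exists>\<tau>. null_homotopy C M Q u \<tau> \<and> (\<forall>n. \<tau> n \<cdot> Id C (obj M (n + 1)) = \<sigma> n)"
      using null_simps(1-3)[of M Q u \<sigma>] by auto
  qed
  moreover have "homotopy_lifting C \<X> M M (\<lambda>n. Id C (obj M n))"
    unfolding homotopy_lifting_def
  proof (intro ballI conjI allI impI)
    fix P f assume P: "P \<in> cplx_in C \<X>" and f: "f \<in> chain_maps C P M"
    have PC: "P \<in> complexes C" using P by (simp add: cplx_in_def)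
    note [simp] = chain_simps(1-3)[OF f PC M]
    show "\<exists>g \<in> chain_maps C P M. \<exists>\<sigma>. null_homotopy C P M (\<lambda>n. f n \<boxminus> Id C (obj M n) \<cdot> g n) \<sigma>"
      using f null_Zero[OF PC M] by (intro bexI[where x = f] exI) simp_all
    show "\<exists>\<tau>. null_homotopy C P M f \<tau>" if "null_homotopy C P M (\<lambda>n. Id C (obj M n) \<cdot> f n) \<sigma>" for \<sigma>
      using that by auto
  qed
  ultimately show ?case using chain_Id[OF M] by blast
next
  case (Suc k)
  obtain T j where T: "T \<in> complexes C" "j \<in> chain_maps C M T" "null_extending C \<Y> M T j"
      "homotopy_lifting C \<X> M T j" "\<And>n. coresolvable C \<X> \<Y> k (obj T n)"
    using ex_coresolution_step[OF \<Y> Suc.prems(1), where k = k and \<X> = \<X>] Suc.prems(2) by blast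
  obtain T' j' where T': "T' \<in> cplx_in C \<Y>" "j' \<in> chain_maps C T T'" "null_extending C \<Y> T T' j'"
      "homotopy_lifting C \<X> T T' j'"
    using Suc.IH[OF T(1,5)] by blast
  have T'C: "T' \<in> complexes C" using T'(1) by (simp add: cplx_in_def)
  show ?case
    using T'(1) chain_Comp[OF Suc.prems(1) T(1) T'C T(2) T'(2)]
      null_extending_comp[OF Suc.prems(1) T(1) T'C T(2) T'(2) T(3) T'(3)]
      homotopy_lifting_comp[OF Suc.prems(1) T(1) T'C T(2) T'(2) T(4) T'(4)] by blast
qed

end

section \<open>Finite coresolutions in an abelian category\<close>

context preadditive_category
begin

lemma left_approximation_extend:
  assumes "left_approximation C \<Y> M \<phi>" "u \<in> Arr C" "Dom C u = M" "Cod C u \<in> \<Y>"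
  shows "\<exists>v. v \<in> Arr C \<and> Dom C v = Cod C \<phi> \<and> Cod C v = Cod C u \<and> v \<cdot> \<phi> = u"
proof -
  have "u \<in> Hom C M (Cod C u)" using assms by (simp add: Hom_iff)
  then obtain v where "v \<in> Hom C (Cod C \<phi>) (Cod C u)" "v \<cdot> \<phi> = u"
    using assms unfolding left_approximation_def by blast
  then show ?thesis by (auto simp: Hom_iff)
qed

text \<open>
  Two left approximations of the same object factor through each other; the difference to the
  identity factors through the cokernel, as in Schanuel's lemma.
\<close>

lemma conflation_transfer:
  assumes ker: "is_kernel C q \<phi>" and cok: "is_cokernel C \<phi> q" and app: "left_approximation C \<Y> M \<phi>"
    and conf: "conflation C \<X> \<Y> \<phi>' q'" and app': "left_approximation C \<Y> M \<phi>'"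
  shows "conflation C \<X> \<Y> \<phi> q"
proof -
  have [simp]: "\<phi> \<in> Arr C" "q \<in> Arr C" "Dom C q = Cod C \<phi>" "Dom C \<phi> = M" "q \<cdot> \<phi> = Zero C M (Cod C q)"
    using cok app by (simp_all add: is_cokernel_def left_approximation_def)
  have M' [simp]: "Dom C \<phi>' = M" using app' by (simp add: left_approximation_def)
  note [simp] = conflation_arr[OF conf, simplified]
  have M [simp]: "M \<in> Ob C" using Ob_DomCod(1)[of \<phi>] by simp
  have Y: "Cod C \<phi> \<in> \<Y>" "Cod C \<phi>' \<in> \<Y>" using app app' by (simp_all add: left_approximation_def)
  obtain a where a [simp]: "a \<in> Arr C" "Dom C a = Cod C \<phi>" "Cod C a = Cod C \<phi>'" "a \<cdot> \<phi> = \<phi>'"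
    using left_approximation_extend[OF app, of \<phi>'] Y by auto
  obtain b where b [simp]: "b \<in> Arr C" "Dom C b = Cod C \<phi>'" "Cod C b = Cod C \<phi>" "b \<cdot> \<phi>' = \<phi>"
    using left_approximation_extend[OF app', of \<phi>] Y by auto
  obtain a' where a' [simp]: "a' \<in> Arr C" "Dom C a' = Cod C q" "Cod C a' = Cod C q'" "a' \<cdot> q = q' \<cdot> a"
    using cokernel_extend[OF cok, of "q' \<cdot> a"] by (auto simp: comp_assoc)
  \<comment> \<open>\<open>1 - b a\<close> vanishes on \<open>\<phi>\<close> because
    \<open>b a \<phi> = b \<phi>' = \<phi>\<close>.\<close>
  obtain w where w [simp]: "w \<in> Arr C" "Dom C w = Cod C q" "Cod C w = Cod C \<phi>"
      "w \<cdot> q = Id C (Cod C \<phi>) \<boxminus> b \<cdot> a"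
    using cokernel_extend[OF cok, of "Id C (Cod C \<phi>) \<boxminus> b \<cdot> a"] by (auto simp: distrib)
  obtain b' where b' [simp]: "b' \<in> Arr C" "Dom C b' = Cod C q'" "Cod C b' = Cod C q" "b' \<cdot> q' = q \<cdot> b"
    using conflation_cokernel[OF conf, of "q \<cdot> b"] by (auto simp: comp_assoc)
  have b'q': "b' \<cdot> (q' \<cdot> x) = q \<cdot> (b \<cdot> x)" if "x \<in> Arr C" "Cod C x = Cod C \<phi>'" for x
    using comp_eq_comp[OF b'(4), where x = x] that by (simp add: comp_assoc)
  have eq: "q \<cdot> w = Id C (Cod C q) \<boxminus> b' \<cdot> a'"
    by (rule cokernel_epic[OF cok]) (simp_all add: distrib b'q')
  \<comment> \<open>By \<open>eq\<close>, \<open>u = b' a' u + q w u\<close>. The second term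
    visibly lifts through \<open>q\<close>; the first does because \<open>a' u\<close> lifts through
    \<open>q'\<close> and \<open>b' q' = q b\<close>.\<close>
  have lift: "\<exists>v. v \<in> Arr C \<and> Dom C v = Dom C u \<and> Cod C v = Cod C \<phi> \<and> q \<cdot> v = u"
    if u: "u \<in> Arr C" "Cod C u = Cod C q" "Dom C u \<in> \<X>" for u
  proof -
    obtain y where y [simp]: "y \<in> Arr C" "Dom C y = Dom C u" "Cod C y = Cod C \<phi>'" "q' \<cdot> y = a' \<cdot> u"
      using conflation_lift[OF conf, of "a' \<cdot> u"] u by auto
    have "q \<cdot> (b \<cdot> y) = b' \<cdot> (q' \<cdot> y)" by (rule b'q'[symmetric]) simp_all
    also have "\<dots> = b' \<cdot> (a' \<cdot> u)" by (simp only: y)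
    finally have 1: "q \<cdot> (b \<cdot> y) = b' \<cdot> (a' \<cdot> u)" .
    have "q \<cdot> (w \<cdot> u) = u \<boxminus> b' \<cdot> (a' \<cdot> u)"
      using comp_eq_comp[OF eq, where x = u] u by (simp add: distrib)
    then have "q \<cdot> (b \<cdot> y \<boxplus> w \<cdot> u) = u"
      using u by (simp add: distrib 1 sub_rules sub_eq_iff add_ac)
    then show ?thesis using u by (intro exI[where x = "b \<cdot> y \<boxplus> w \<cdot> u"]) simp
  qed
  show ?thesis
    unfolding conflation_def
  proof (intro conjI ballI)
    show "\<exists>v \<in> Hom C P (Dom C q). q \<cdot> v = u" if "P \<in> \<X>" "u \<in> Hom C P (Cod C q)" for P u
    proof -
      have u: "u \<in> Arr C" "Cod C u = Cod C q" "Dom C u = P" "P \<in> \<X>" using that by (simp_all add: Hom_iff)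
      obtain v where "v \<in> Arr C" "Dom C v = P" "Cod C v = Cod C \<phi>" "q \<cdot> v = u"
        using lift[OF u(1,2)] u(4) unfolding u(3) by blast
      then show ?thesis by (intro bexI[where x = v]) (simp_all add: Hom_iff)
    qed
    show "\<exists>v \<in> Hom C (Cod C \<phi>) Q. v \<cdot> \<phi> = u" if "Q \<in> \<Y>" "u \<in> Hom C (Dom C \<phi>) Q" for Q u
    proof -
      have u: "u \<in> Arr C" "Dom C u = M" "Cod C u = Q" "Q \<in> \<Y>" using that by (simp_all add: Hom_iff)
      obtain v where "v \<in> Arr C" "Dom C v = Cod C \<phi>" "Cod C v = Q" "v \<cdot> \<phi> = u"
        using left_approximation_extend[OF app u(1,2)] u(4) unfolding u(3) by blast
      then show ?thesis by (intro bexI[where x = v]) (simp_all add: Hom_iff)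
    qed
  qed (rule ker cok)+
qed

text \<open>The zero object \<open>z\<close> of \<Y> is also a biproduct of \<open>c\<close> and
  \<open>z\<close>, all four arrows being zero, so closure under direct summands applies.\<close>

lemma zero_object_in_additive_subcategory:
  assumes \<Y>: "additive_subcategory C \<Y>" and c: "c \<in> Ob C" "Id C c = Zero C c c"
  shows "c \<in> \<Y>"
proof -
  obtain z where z: "z \<in> \<Y>" "zero_object C z" using additive_subcategoryD(4)[OF \<Y>] by blast
  have [simp]: "z \<in> Ob C" "c \<in> Ob C" using z(2) c(1) by (simp_all add: zero_object_def)
  have [simp]: "Id C z = Zero C z z" using from_zero_object[OF z(2) Id_in] by simp
  have "biproduct C c z z (Zero C c z) (Zero C z z) (Zero C z c) (Zero C z z)"
    using c(2) by (simp add: biproduct_def Hom_iff)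
  then show ?thesis using additive_subcategoryD(3)[OF \<Y>] z(1) by blast
qed

end

section \<open>Admissibility, exactness and coresolution dimension in the abelian category\<close>

context abelian_category
begin

text \<open>An \<open>f\<close> with kernel \<open>\<phi>\<close> kills \<open>\<phi>\<close> and so
  factors through the cokernel \<open>q\<close>; hence whatever is killed by \<open>q\<close> is
  killed by \<open>f\<close> and lifts to the kernel.\<close>

lemma monic_is_kernel_of_cokernel:
  assumes "monic C \<phi>" and cok: "is_cokernel C \<phi> q"
  shows "is_kernel C q \<phi>"
proof -
  obtain f where f: "is_kernel C f \<phi>" using monic_is_kernel[OF assms(1)] by blast
  have [simp]: "f \<in> Arr C" "\<phi> \<in> Arr C" "q \<in> Arr C" "Dom C f = Cod C \<phi>" "Dom C q = Cod C \<phi>"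
      "f \<cdot> \<phi> = Zero C (Dom C \<phi>) (Cod C f)" "q \<cdot> \<phi> = Zero C (Dom C \<phi>) (Cod C q)"
    using f cok by (simp_all add: is_kernel_def is_cokernel_def)
  obtain f' where f' [simp]: "f' \<in> Arr C" "Dom C f' = Cod C q" "Cod C f' = Cod C f" and f'q: "f' \<cdot> q = f"
    using cokernel_extend[OF cok, of f] by auto
  show ?thesis
    unfolding is_kernel_def
  proof (intro conjI ballI impI)
    fix a u assume "u \<in> Hom C a (Dom C q)" and 0: "q \<cdot> u = Zero C a (Cod C q)"
    then have u: "u \<in> Arr C" "Dom C u = a" "Cod C u = Cod C \<phi>" by (simp_all add: Hom_iff)
    have "f \<cdot> u = f' \<cdot> (q \<cdot> u)" using u f'q by (simp add: comp_assoc[symmetric])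
    also have "\<dots> = Zero C (Dom C u) (Cod C f)" unfolding 0 using u Ob_DomCod(1)[of u] by simp
    finally obtain v where "v \<in> Arr C" "Dom C v = a" "Cod C v = Dom C \<phi>" "\<phi> \<cdot> v = u"
      using kernel_lift[OF f, of u] u by auto
    then show "\<exists>!v. v \<in> Hom C a (Dom C \<phi>) \<and> \<phi> \<cdot> v = u"
      using kernel_monic[OF f] by (intro ex1I[where a = v]) (auto simp: Hom_iff)
  qed simp_all
qed

text \<open>Admissibility makes the objects of \<X> generators: the equation is tested on a right
  approximation of the source, which is epic.\<close>

lemma right_approximation_cancel:
  assumes "admissible C \<X>" and u: "u \<in> Arr C" "v \<in> Arr C" "Dom C u = Dom C v" "Cod C u = Cod C v"
    and eq: "\<And>x. x \<in> Arr C \<Longrightarrow> Dom C x \<in> \<X> \<Longrightarrow> Cod C x = Dom C u \<Longrightarrow> u \<cdot> x = v \<cdot> x"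
  shows "u = v"
proof -
  have D: "Dom C u \<in> Ob C" using u by simp
  obtain \<theta> where \<theta>: "right_approximation C \<X> (Dom C u) \<theta>"
    using assms(1) D unfolding admissible_def contravariantly_finite_def by blast
  then have "epic C \<theta>" using assms(1) D unfolding admissible_def by blast
  moreover have "\<theta> \<in> Arr C" "Cod C \<theta> = Dom C u" "Dom C \<theta> \<in> \<X>"
    using \<theta> by (simp_all add: right_approximation_def)
  moreover have "u \<in> Hom C (Cod C \<theta>) (Cod C u)" "v \<in> Hom C (Cod C \<theta>) (Cod C u)" "Cod C u \<in> Ob C"
    using u calculation by (simp_all add: Hom_iff)
  ultimately show ?thesis using eq[of \<theta>] unfolding epic_def by blast
qed

text \<open>
  The comparison \<open>c\<close> of the cokernel of \<open>M \<rightarrow> R 0\<close> with \<open>R 1\<close> is monic: if \<open>c w = 0\<close>, then \<open>q\<close> factors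
  through \<open>coker w \<circ> q\<close>, since the latter is a cokernel.
\<close>

lemma cokernel_comparison_mono:
  assumes adm: "admissible C \<X>" and cok: "is_cokernel C \<phi> q"
    and c: "c \<in> Arr C" "Dom C c = Cod C q"
    and exact: "\<And>x. x \<in> Arr C \<Longrightarrow> Dom C x \<in> \<X> \<Longrightarrow> Cod C x = Cod C \<phi> \<Longrightarrow> c \<cdot> (q \<cdot> x) = Zero C (Dom C x) (Cod C c) \<Longrightarrow>
      q \<cdot> x = Zero C (Dom C x) (Cod C q)"
    and w: "w \<in> Arr C" "Cod C w = Cod C q" "c \<cdot> w = Zero C (Dom C w) (Cod C c)"
  shows "w = Zero C (Dom C w) (Cod C q)"
proof -
  obtain r where r: "is_cokernel C w r" using ex_cokernel[OF w(1)] by blast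
  have [simp]: "q \<in> Arr C" "Dom C q = Cod C \<phi>" "r \<in> Arr C" "Dom C r = Cod C q" "r \<cdot> w = Zero C (Dom C w) (Cod C r)"
    "\<phi> \<in> Arr C"
    using cok r w by (simp_all add: is_cokernel_def)
  note [simp] = c w(1,2)
  obtain c' where c' [simp]: "c' \<in> Arr C" "Dom C c' = Cod C r" "Cod C c' = Cod C c" "c' \<cdot> r = c"
    using cokernel_extend[OF r, of c] w by auto
  have "epic C (r \<cdot> q)"
  proof (rule epicI)
    show "r \<cdot> q \<in> Hom C (Cod C \<phi>) (Cod C r)" by (simp add: Hom_iff)
    fix a v assume "v \<in> Hom C (Cod C r) a" "v \<cdot> (r \<cdot> q) = Zero C (Cod C \<phi>) a"
    then have v: "v \<in> Arr C" "Dom C v = Cod C r" "Cod C v = a" "v \<cdot> r \<cdot> q = Zero C (Cod C q) a \<cdot> q"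
      using Ob_DomCod(2)[of v] by (auto simp: Hom_iff comp_assoc)
    have [simp]: "a \<in> Ob C" using v Ob_DomCod(2)[of v] by simp
    have "v \<cdot> r = Zero C (Cod C r) a \<cdot> r"
      using cokernel_epic[OF cok, of "v \<cdot> r" "Zero C (Cod C q) a"] v by simp
    then show "v = Zero C (Cod C r) a"
      using cokernel_epic[OF r, of v "Zero C (Cod C r) a"] v by simp
  qed
  then obtain g where g: "is_cokernel C g (r \<cdot> q)" using epic_is_cokernel by blast
  have [simp]: "g \<in> Arr C" "Cod C g = Cod C \<phi>" and rqg: "r \<cdot> q \<cdot> g = Zero C (Dom C g) (Cod C r)"
    using g by (simp_all add: is_cokernel_def)
  \<comment> \<open>Tested on objects of \<X>: \<open>c q g x = c' r q g x = 0\<close>, and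
    \<open>exact\<close> turns this into \<open>q g x = 0\<close>.\<close>
  have "q \<cdot> g = Zero C (Dom C g) (Cod C q)"
  proof (rule right_approximation_cancel[OF adm])
    fix x assume x: "x \<in> Arr C" "Dom C x \<in> \<X>" "Cod C x = Dom C (q \<cdot> g)"
    have "c \<cdot> (q \<cdot> (g \<cdot> x)) = c' \<cdot> (r \<cdot> q \<cdot> g) \<cdot> x"
      using x comp_eq_comp[OF c'(4), of "q \<cdot> (g \<cdot> x)"] by (simp add: comp_assoc)
    also have "\<dots> = Zero C (Dom C x) (Cod C c)" unfolding rqg using x by simp
    finally have "q \<cdot> (g \<cdot> x) = Zero C (Dom C x) (Cod C q)"
      using exact[of "g \<cdot> x"] x by simp
    then show "q \<cdot> g \<cdot> x = Zero C (Dom C g) (Cod C q) \<cdot> x" using x by (simp add: comp_assoc)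
  qed simp_all
  then obtain s where s [simp]: "s \<in> Arr C" "Dom C s = Cod C r" "Cod C s = Cod C q" and sq: "s \<cdot> (r \<cdot> q) = q"
    using cokernel_extend[OF g, of q] by auto
  \<comment> \<open>So \<open>r\<close> is a split monomorphism, and it kills
    \<open>w\<close>.\<close>
  have "s \<cdot> r = Id C (Cod C q)"
    by (rule cokernel_epic[OF cok]) (simp_all add: comp_assoc sq)
  then have "w = s \<cdot> r \<cdot> w" by simp
  also have "\<dots> = Zero C (Dom C w) (Cod C q)" by (simp add: comp_assoc)
  finally show ?thesis .
qed

lemma coresolution_simps:
  assumes R: "coresolution C \<Y> M R"
  shows "R \<in> complexes C" "obj R (-1) = M" "0 \<le> n \<Longrightarrow> obj R n \<in> \<Y>"
    "diff R (-2) = Zero C (obj R (-2)) M"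
proof -
  show *: "R \<in> complexes C" "obj R (-1) = M" "0 \<le> n \<Longrightarrow> obj R n \<in> \<Y>"
    using R by (simp_all add: coresolution_def)
  have "zero_object C (obj R (-2))" using R by (simp add: coresolution_def)
  then show "diff R (-2) = Zero C (obj R (-2)) M"
    using from_zero_object[of "obj R (-2)" "diff R (-2)" M] cplx_simps[OF *(1), of "-2"] *(2) by (simp add: Hom_iff)
qed

lemma coresolution_exact:
  assumes R: "coresolution C \<Y> M R" and u: "u \<in> Arr C" "Dom C u = obj R m" "Cod C u \<in> \<Y>" and m: "m = n + 1"
    and 0: "u \<cdot> diff R n = Zero C (obj R n) (Cod C u)"
  shows "\<exists>v. v \<in> Arr C \<and> Dom C v = obj R (m + 1) \<and> Cod C v = Cod C u \<and> v \<cdot> diff R m = u"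
proof -
  have "Hom_to_acyclic C (Cod C u) R" using R u by (simp add: coresolution_def)
  then have "{v \<in> Hom C (obj R m) (Cod C u). v \<cdot> diff R (m - 1) = Zero C (obj R (m - 1)) (Cod C u)}
      = (\<lambda>v. v \<cdot> diff R m) ` Hom C (obj R (m + 1)) (Cod C u)"
    unfolding Hom_to_acyclic_def by blast
  then have "u \<in> (\<lambda>v. v \<cdot> diff R m) ` Hom C (obj R (m + 1)) (Cod C u)"
    using u 0 m by (auto simp: Hom_iff)
  then show ?thesis by (auto simp: Hom_iff)
qed

text \<open>Acyclicity under \<open>Hom(-, Y)\<close> in degree -1 amounts to this, because the
  differential entering degree -1 is zero.\<close>

lemma coresolution_left_approximation:
  assumes R: "coresolution C \<Y> M R"
  shows "left_approximation C \<Y> M (diff R (-1))"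
proof -
  note [simp] = coresolution_simps(2-4)[OF R] cplx_simps[OF coresolution_simps(1)[OF R]]
  have [simp]: "M \<in> Ob C" using cplx_simps(1)[OF coresolution_simps(1)[OF R], of "-1"] by simp
  show ?thesis
    unfolding left_approximation_def
  proof (intro conjI ballI)
    fix Y g assume Y: "Y \<in> \<Y>" and "g \<in> Hom C M Y"
    then have g: "g \<in> Arr C" "Dom C g = M" "Cod C g = Y" by (simp_all add: Hom_iff)
    have "\<exists>h. h \<in> Arr C \<and> Dom C h = obj R (-1 + 1) \<and> Cod C h = Cod C g \<and> h \<cdot> diff R (-1) = g"
    proof (rule coresolution_exact[OF R])
      show "g \<cdot> diff R (-2) = Zero C (obj R (-2)) (Cod C g)" using g Ob_DomCod(2)[of g] by simp
    qed (use g Y in simp_all)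
    then obtain h where "h \<in> Arr C" "Dom C h = obj R 0" "Cod C h = Y" "h \<cdot> diff R (-1) = g"
      using g by auto
    then show "\<exists>h \<in> Hom C (Cod C (diff R (-1))) Y. h \<cdot> diff R (-1) = g"
      by (intro bexI[where x = h]) (simp_all add: Hom_iff)
  qed simp_all
qed

text \<open>Acyclicity under \<open>Hom(X, -)\<close> is known for a coresolution \<open>R\<close>,
  whereas a conflation concerns the cokernel of its first map. Since this cokernel embeds into
  \<open>R 1\<close>, maps from \<X> into it can be lifted as cocycles of \<open>R\<close>. The
  result for the first map of \<open>R\<close> is then transferred to the given
  approximation.\<close>

lemma left_approximation_conflation:
  assumes bp: "balanced_pair C \<X> \<Y>" and adm: "admissible C \<X>" and app: "left_approximation C \<Y> M \<phi>"
  shows "\<exists>q. conflation C \<X> \<Y> \<phi> q"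
proof -
  have coadm: "coadmissible C \<Y>" using coadmissible_if_admissible[OF bp adm] .
  have M: "M \<in> Ob C" using app Ob_DomCod(1)[of \<phi>] by (auto simp: left_approximation_def)
  obtain R where R: "coresolution C \<Y> M R" and ac: "\<And>X. X \<in> \<X> \<Longrightarrow> Hom_from_acyclic C X R"
    using bp M unfolding balanced_pair_def by blast
  note [simp] = coresolution_simps(2-4)[OF R] cplx_simps[OF coresolution_simps(1)[OF R]] M
  define \<phi>' where "\<phi>' = diff R (-1)"
  have [simp]: "\<phi>' \<in> Arr C" "Dom C \<phi>' = M" "Cod C \<phi>' = obj R 0" by (simp_all add: \<phi>'_def)
  have app': "left_approximation C \<Y> M \<phi>'"
    unfolding \<phi>'_def by (rule coresolution_left_approximation[OF R])
  obtain q' where q': "is_cokernel C \<phi>' q'" using ex_cokernel[of \<phi>'] by auto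
  have [simp]: "q' \<in> Arr C" "Dom C q' = obj R 0" "q' \<cdot> \<phi>' = Zero C M (Cod C q')"
    using q' by (simp_all add: is_cokernel_def)
  have "diff R 0 \<cdot> \<phi>' = Zero C M (obj R 1)" by (simp add: \<phi>'_def)
  then obtain c where c [simp]: "c \<in> Arr C" "Dom C c = Cod C q'" "Cod C c = obj R 1" and cq: "c \<cdot> q' = diff R 0"
    using cokernel_extend[OF q', of "diff R 0"] by auto
  have exact: "\<exists>v. v \<in> Arr C \<and> Dom C v = Dom C x \<and> Cod C v = obj R n \<and> diff R n \<cdot> v = x"
    if x: "x \<in> Arr C" "Dom C x \<in> \<X>" "Cod C x = obj R m" "m = n + 1" "diff R m \<cdot> x = Zero C (Dom C x) (obj R (m + 1))"
    for x m n
  proof -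
    have "{u \<in> Hom C (Dom C x) (obj R m). diff R m \<cdot> u = Zero C (Dom C x) (obj R (m + 1))}
        = (\<lambda>v. diff R (m - 1) \<cdot> v) ` Hom C (Dom C x) (obj R (m - 1))"
      using ac[OF x(2)] unfolding Hom_from_acyclic_def by blast
    then have "x \<in> (\<lambda>v. diff R (m - 1) \<cdot> v) ` Hom C (Dom C x) (obj R (m - 1))"
      using x by (auto simp: Hom_iff)
    then obtain v where "v \<in> Hom C (Dom C x) (obj R n)" "diff R n \<cdot> v = x" unfolding x(4) by auto
    then show ?thesis unfolding Hom_iff by blast
  qed
  have mono: "w = Zero C (Dom C w) (Cod C q')"
    if w: "w \<in> Arr C" "Cod C w = Cod C q'" "c \<cdot> w = Zero C (Dom C w) (obj R 1)" for w
  proof (rule cokernel_comparison_mono[OF adm q' c(1,2)])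
    fix x assume x: "x \<in> Arr C" "Dom C x \<in> \<X>" "Cod C x = Cod C \<phi>'" "c \<cdot> (q' \<cdot> x) = Zero C (Dom C x) (Cod C c)"
    have "diff R 0 \<cdot> x = Zero C (Dom C x) (obj R 1)"
      using x comp_eq_comp[OF cq, of x] by simp
    then obtain v where "v \<in> Arr C" "Dom C v = Dom C x" "Cod C v = M" "\<phi>' \<cdot> v = x"
      using exact[of x 0 "-1"] x by (auto simp: \<phi>'_def)
    then show "q' \<cdot> x = Zero C (Dom C x) (Cod C q')"
      using comp_eq_comp[of q' \<phi>' _ v] by auto
  qed (use w in simp_all)
  \<comment> \<open>\<open>c u\<close> is a cocycle in degree 1, so \<open>c u = d v\<close> for
    some \<open>v\<close> into \<open>R 0\<close>; since \<open>d = c q'\<close> and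
    \<open>c\<close> is monic, \<open>q' v = u\<close>.\<close>
  have lift: "\<exists>v. v \<in> Arr C \<and> Dom C v = Dom C u \<and> Cod C v = obj R 0 \<and> q' \<cdot> v = u"
    if u: "u \<in> Arr C" "Cod C u = Cod C q'" "Dom C u \<in> \<X>" for u
  proof -
    have "diff R 1 \<cdot> c \<cdot> q' = Zero C (Cod C q') (obj R 2) \<cdot> q'"
      using cq by (simp add: comp_assoc)
    then have "diff R 1 \<cdot> c = Zero C (Cod C q') (obj R 2)"
      by (rule cokernel_epic[OF q', rotated -1]) simp_all
    then have "diff R 1 \<cdot> (c \<cdot> u) = Zero C (Dom C u) (obj R 2)"
      using u comp_eq_comp[of "diff R 1" c _ u] by simp
    then obtain v where v: "v \<in> Arr C" "Dom C v = Dom C u" "Cod C v = obj R 0" "diff R 0 \<cdot> v = c \<cdot> u"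
      using exact[of "c \<cdot> u" 1 0] u by auto
    have "c \<cdot> (q' \<cdot> v \<boxminus> u) = Zero C (Dom C u) (obj R 1)"
      using v u comp_eq_comp[OF cq, of v] by (simp add: distrib)
    then have "q' \<cdot> v \<boxminus> u = Zero C (Dom C u) (Cod C q')"
      using mono[of "q' \<cdot> v \<boxminus> u"] v(1-3) u by simp
    then have "q' \<cdot> v = u" using v(1-3) u by (simp add: sub_eq_iff)
    then show ?thesis using v by blast
  qed
  have "monic C \<phi>'" "monic C \<phi>" using coadm M app app' unfolding coadmissible_def by blast+
  have conf': "conflation C \<X> \<Y> \<phi>' q'"
    unfolding conflation_def
  proof (intro conjI ballI)
    show "is_kernel C q' \<phi>'" by (rule monic_is_kernel_of_cokernel) fact+
    show "is_cokernel C \<phi>' q'" by fact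
    show "\<exists>v \<in> Hom C P (Dom C q'). q' \<cdot> v = u" if "P \<in> \<X>" "u \<in> Hom C P (Cod C q')" for P u
    proof -
      have u: "u \<in> Arr C" "Cod C u = Cod C q'" "Dom C u = P" "P \<in> \<X>" using that by (simp_all add: Hom_iff)
      obtain v where "v \<in> Arr C" "Dom C v = P" "Cod C v = obj R 0" "q' \<cdot> v = u"
        using lift[OF u(1,2)] u(4) unfolding u(3) by blast
      then show ?thesis by (intro bexI[where x = v]) (simp_all add: Hom_iff)
    qed
    show "\<exists>v \<in> Hom C (Cod C \<phi>') Q. v \<cdot> \<phi>' = u" if "Q \<in> \<Y>" "u \<in> Hom C (Dom C \<phi>') Q" for Q u
    proof -
      have u: "u \<in> Arr C" "Dom C u = M" "Cod C u = Q" "Q \<in> \<Y>" using that by (simp_all add: Hom_iff)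
      obtain v where "v \<in> Arr C" "Dom C v = Cod C \<phi>'" "Cod C v = Q" "v \<cdot> \<phi>' = u"
        using left_approximation_extend[OF app' u(1,2)] u(4) unfolding u(3) by blast
      then show ?thesis by (intro bexI[where x = v]) (simp_all add: Hom_iff)
    qed
  qed
  obtain q where q: "is_cokernel C \<phi> q" using ex_cokernel[of \<phi>] app by (auto simp: left_approximation_def)
  have "is_kernel C q \<phi>" by (rule monic_is_kernel_of_cokernel) fact+
  then show ?thesis using conflation_transfer[OF _ q app conf' app'] by blast
qed

text \<open>Induction along the coresolution with \<open>M\<close> replaced by a cosyzygy
  \<open>Z\<close>: the comparison of the next cosyzygy with the next term is again a left
  approximation, hence begins a conflation. At the end the last quotient is shown to be zero, rather
  than the last approximation to be invertible; this accounts for \<open>Suc m\<close> conflations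
  with \<open>m = N - k\<close>.\<close>

lemma finite_coresolution_coresolvable:
  assumes \<Y>: "additive_subcategory C \<Y>" and bp: "balanced_pair C \<X> \<Y>" and adm: "admissible C \<X>"
    and R: "coresolution C \<Y> M R" and fin: "\<And>i. int N < i \<Longrightarrow> zero_object C (obj R i)"
  shows "\<lbrakk>left_approximation C \<Y> Z \<phi>; Cod C \<phi> = obj R k; diff R k \<cdot> \<phi> = Zero C Z (obj R (k + 1));
     \<And>u. u \<in> Arr C \<Longrightarrow> Dom C u = obj R k \<Longrightarrow> Cod C u \<in> \<Y> \<Longrightarrow> u \<cdot> \<phi> = Zero C Z (Cod C u) \<Longrightarrow>
       \<exists>v. v \<in> Arr C \<and> Dom C v = obj R (k + 1) \<and> Cod C v = Cod C u \<and> v \<cdot> diff R k = u;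
     0 \<le> k; k = int N - int m\<rbrakk> \<Longrightarrow> coresolvable C \<X> \<Y> (Suc m) Z"
proof (induction m arbitrary: Z \<phi> k)
  case (0 Z \<phi> k)
  note [simp] = coresolution_simps(2-4)[OF R] cplx_simps[OF coresolution_simps(1)[OF R]]
  have [simp]: "\<phi> \<in> Arr C" "Dom C \<phi> = Z" "Cod C \<phi> = obj R k" using 0 by (simp_all add: left_approximation_def)
  obtain q where conf: "conflation C \<X> \<Y> \<phi> q" using left_approximation_conflation[OF bp adm 0(1)] by blast
  note [simp] = conflation_arr[OF conf]
  have Zo [simp]: "Z \<in> Ob C" using Ob_DomCod(1)[of \<phi>] by simp
  have "coadmissible C \<Y>" using coadmissible_if_admissible[OF bp adm] .
  moreover have D: "Cod C q \<in> Ob C" by simp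
  ultimately obtain \<psi> where \<psi>: "left_approximation C \<Y> (Cod C q) \<psi>" "monic C \<psi>"
    unfolding coadmissible_def covariantly_finite_def by blast
  then have [simp]: "\<psi> \<in> Arr C" "Dom C \<psi> = Cod C q" and Y: "Cod C \<psi> \<in> \<Y>" by (simp_all add: left_approximation_def)
  obtain v where v: "v \<in> Arr C" "Dom C v = obj R (k + 1)" "Cod C v = Cod C \<psi>" "v \<cdot> diff R k = \<psi> \<cdot> q"
    using 0(4)[of "\<psi> \<cdot> q"] Y by (auto simp: comp_assoc)
  \<comment> \<open>Here \<open>k = N\<close>, so the next term is a zero object.\<close>
  have "diff R k = Zero C (obj R k) (obj R (k + 1))"
    using to_zero_object[OF fin, of "k + 1" "diff R k" "obj R k"] 0(6) by (simp add: Hom_iff)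
  then have "\<psi> \<cdot> q = Zero C (Cod C q) (Cod C \<psi>) \<cdot> q" using v by simp
  then have "\<psi> = Zero C (Cod C q) (Cod C \<psi>)"
    using conflation_epi[OF conf, of \<psi> "Zero C (Cod C q) (Cod C \<psi>)"] by simp
  \<comment> \<open>A monomorphism that is zero has a zero object as its source.\<close>
  then have "\<psi> \<cdot> Id C (Cod C q) = \<psi> \<cdot> Zero C (Cod C q) (Cod C q)" by simp
  moreover have "Id C (Cod C q) \<in> Hom C (Cod C q) (Dom C \<psi>)" "Zero C (Cod C q) (Cod C q) \<in> Hom C (Cod C q) (Dom C \<psi>)"
    by (simp_all add: Hom_iff)
  ultimately have "Id C (Cod C q) = Zero C (Cod C q) (Cod C q)" using \<psi>(2) D unfolding monic_def by blast
  then have "Cod C q \<in> \<Y>" using zero_object_in_additive_subcategory[OF \<Y> D] by blast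
  moreover have "Cod C \<phi> \<in> \<Y>" using 0(5) by simp
  ultimately show ?case using conf \<open>Dom C \<phi> = Z\<close> unfolding coresolvable.simps by blast
next
  case (Suc m Z \<phi> k)
  note [simp] = coresolution_simps(2-4)[OF R] cplx_simps[OF coresolution_simps(1)[OF R]]
  have [simp]: "\<phi> \<in> Arr C" "Dom C \<phi> = Z" "Cod C \<phi> = obj R k" using Suc.prems by (simp_all add: left_approximation_def)
  obtain q where conf: "conflation C \<X> \<Y> \<phi> q" using left_approximation_conflation[OF bp adm Suc.prems(1)] by blast
  note [simp] = conflation_arr[OF conf]
  have [simp]: "Z \<in> Ob C" using Ob_DomCod(1)[of \<phi>] by simp
  obtain c where c [simp]: "c \<in> Arr C" "Dom C c = Cod C q" "Cod C c = obj R (k + 1)" and cq: "c \<cdot> q = diff R k"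
    using conflation_cokernel[OF conf, of "diff R k"] Suc.prems(3) by auto
  have "coresolvable C \<X> \<Y> (Suc m) (Cod C q)"
  proof (rule Suc.IH)
    \<comment> \<open>For \<open>g\<close> into \<Y>, \<open>g q\<close> vanishes on
      \<open>\<phi>\<close>, so by exactness it equals \<open>v d\<close>; as \<open>d = c q\<close>
      and \<open>q\<close> is epic, \<open>g = v c\<close>.\<close>
    show "left_approximation C \<Y> (Cod C q) c"
      unfolding left_approximation_def
    proof (intro conjI ballI)
      fix Y g assume Y: "Y \<in> \<Y>" and "g \<in> Hom C (Cod C q) Y"
      then have g [simp]: "g \<in> Arr C" "Dom C g = Cod C q" "Cod C g = Y" by (simp_all add: Hom_iff)
      have [simp]: "Y \<in> Ob C" using Ob_DomCod(2)[of g] by simp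
      obtain v where v: "v \<in> Arr C" "Dom C v = obj R (k + 1)" "Cod C v = Y" "v \<cdot> diff R k = g \<cdot> q"
        using Suc.prems(4)[of "g \<cdot> q"] Y by (auto simp: comp_assoc)
      have "v \<cdot> c = g"
        by (rule conflation_epi[OF conf]) (use v cq in \<open>simp_all add: comp_assoc\<close>)
      then show "\<exists>h \<in> Hom C (Cod C c) Y. h \<cdot> c = g" using v by (intro bexI[where x = v]) (simp_all add: Hom_iff)
    qed (use Suc.prems(5) in simp_all)
    show "diff R (k + 1) \<cdot> c = Zero C (Cod C q) (obj R (k + 1 + 1))"
      by (rule conflation_epi[OF conf]) (use cq in \<open>simp_all add: comp_assoc\<close>)
    show "\<exists>v. v \<in> Arr C \<and> Dom C v = obj R (k + 1 + 1) \<and> Cod C v = Cod C u \<and> v \<cdot> diff R (k + 1) = u"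
      if u: "u \<in> Arr C" "Dom C u = obj R (k + 1)" "Cod C u \<in> \<Y>" "u \<cdot> c = Zero C (Cod C q) (Cod C u)" for u
    proof (rule coresolution_exact[OF R u(1-3) refl])
      have "u \<cdot> (c \<cdot> q) = Zero C (obj R k) (Cod C u)"
        using comp_eq_comp[OF u(4), of q] u by simp
      then show "u \<cdot> diff R k = Zero C (obj R k) (Cod C u)" using cq by simp
    qed
  qed (use Suc.prems(5,6) in simp_all)
  moreover have "Cod C \<phi> \<in> \<Y>" using Suc.prems(5) by simp
  ultimately show ?case using conf coresolvable.simps(2)[of C \<X> \<Y> "Suc m" Z] \<open>Dom C \<phi> = Z\<close> by blast
qed

text \<open>The number of conflations does not depend on \<open>M\<close>. This uniformity matters
  because all objects of an unbounded complex must reach \<Y> after the same number of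
  steps.\<close>

lemma cores_dim_coresolvable:
  assumes \<Y>: "additive_subcategory C \<Y>" and bp: "balanced_pair C \<X> \<Y>" and adm: "admissible C \<X>"
    and N: "cores_dim C \<Y> = enat N" and M: "M \<in> Ob C"
  shows "coresolvable C \<X> \<Y> (Suc N) M"
proof -
  have "cores_dim_ob C \<Y> M \<le> enat N"
    using N M unfolding cores_dim_def by (metis SUP_upper)
  \<comment> \<open>A strict bound on an infimum yields a member of the set below it.\<close>
  then have "cores_dim_ob C \<Y> M < enat (Suc N)" by (meson enat_ord_simps(2) lessI order_le_less_trans)
  then obtain n R where n: "n < Suc N" and R: "coresolution C \<Y> M R" and z: "\<forall>i > int n. zero_object C (obj R i)"
    unfolding cores_dim_ob_def Inf_less_iff by auto
  note [simp] = coresolution_simps(2-4)[OF R] cplx_simps[OF coresolution_simps(1)[OF R]]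
  have fin: "zero_object C (obj R i)" if "int N < i" for i using z n that by simp
  show ?thesis
  proof (rule finite_coresolution_coresolvable[OF \<Y> bp adm R fin, where k = 0])
    show "left_approximation C \<Y> M (diff R (-1))" by (rule coresolution_left_approximation[OF R])
    show "\<exists>v. v \<in> Arr C \<and> Dom C v = obj R (0 + 1) \<and> Cod C v = Cod C u \<and> v \<cdot> diff R 0 = u"
      if "u \<in> Arr C" "Dom C u = obj R 0" "Cod C u \<in> \<Y>" "u \<cdot> diff R (-1) = Zero C M (Cod C u)" for u
      using coresolution_exact[OF R that(1-3), of "-1"] that(4) by simp
  qed simp_all
qed

lemma ex_coresolution_complex:
  assumes "additive_subcategory C \<Y>" "balanced_pair C \<X> \<Y>" "admissible C \<X>" "cores_dim C \<Y> < \<infinity>"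
    and M: "M \<in> complexes C"
  shows "\<exists>T \<in> cplx_in C \<Y>. \<exists>j \<in> chain_maps C M T. null_extending C \<Y> M T j \<and> homotopy_lifting C \<X> M T j"
proof -
  obtain N where "cores_dim C \<Y> = enat N" using assms(4) by (cases "cores_dim C \<Y>") auto
  then show ?thesis
    using ex_coresolution[OF assms(1) M] cores_dim_coresolvable[OF assms(1-3)] cplx_simps(1)[OF M] by blast
qed

end

section \<open>Duality\<close>

definition opposite :: "('o, 'm, 'z) precat_scheme \<Rightarrow> ('o, 'm, 'z) precat_scheme" where
  "opposite C = C\<lparr>Dom := Cod C, Cod := Dom C, Comp := (\<lambda>g f. f \<cdot>\<^bsub>C\<^esub> g), Zero := (\<lambda>a b. Zero C b a)\<rparr>"

text \<open>The reversal needs no sign. The differential leaving degree \<open>n\<close> is the one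
  of \<open>M\<close> that enters degree \<open>- n\<close>, which has index
  \<open>- n - 1\<close>.\<close>

definition op_cplx :: "('o, 'm) cplx \<Rightarrow> ('o, 'm) cplx" where
  "op_cplx M = \<lparr>obj = (\<lambda>n. obj M (- n)), diff = (\<lambda>n. diff M (- n - 1))\<rparr>"

text \<open>The dual of \<open>homotopy_lifting\<close>: restriction along \<open>k\<close> is
  bijective on homotopy classes of maps into complexes over \<Y>.\<close>

definition homotopy_extending ::
  "('o, 'm, 'z) precat_scheme \<Rightarrow> 'o set \<Rightarrow> ('o, 'm) cplx \<Rightarrow> ('o, 'm) cplx \<Rightarrow> (int \<Rightarrow> 'm) \<Rightarrow> bool" where
  "homotopy_extending C \<Y> P M k \<longleftrightarrow> (\<forall>Q \<in> cplx_in C \<Y>.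
     (\<forall>v \<in> chain_maps C P Q. \<exists>f \<in> chain_maps C M Q. \<exists>\<sigma>. null_homotopy C P Q (\<lambda>n. v n \<boxminus>\<^bsub>C\<^esub> f n \<cdot>\<^bsub>C\<^esub> k n) \<sigma>) \<and>
     (\<forall>f \<in> chain_maps C M Q. \<forall>\<sigma>. null_homotopy C P Q (\<lambda>n. f n \<cdot>\<^bsub>C\<^esub> k n) \<sigma> \<longrightarrow> (\<exists>\<tau>. null_homotopy C M Q f \<tau>)))"

lemma opposite_simps [simp]:
  "Ob (opposite C) = Ob C" "Arr (opposite C) = Arr C" "Dom (opposite C) = Cod C" "Cod (opposite C) = Dom C"
  "Id (opposite C) = Id C" "Comp (opposite C) g f = Comp C f g" "Zero (opposite C) a b = Zero C b a"
  "Add (opposite C) = Add C"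
  by (simp_all add: opposite_def)

lemma opposite_opposite [simp]: "opposite (opposite C) = C"
  by (simp add: opposite_def)

lemma Hom_opposite [simp]: "Hom (opposite C) a b = Hom C b a"
  by (auto simp: Hom_def)

lemma hom_group_opposite [simp]: "hom_group (opposite C) a b = hom_group C b a"
  by (simp add: hom_group_def)

lemma neg_opposite [simp]: "neg (opposite C) f = neg C f"
  by (simp add: neg_def)

lemma sub_opposite [simp]: "sub (opposite C) f g = sub C f g"
  by (simp add: sub_def)

lemma zero_object_opposite [simp]: "zero_object (opposite C) z \<longleftrightarrow> zero_object C z"
  by (auto simp: zero_object_def)

lemma biproduct_opposite [simp]: "biproduct (opposite C) a b s i1 i2 p1 p2 \<longleftrightarrow> biproduct C a b s p1 p2 i1 i2"
  unfolding biproduct_def by auto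

lemma kernel_opposite [simp]:
  "is_kernel (opposite C) f k \<longleftrightarrow> is_cokernel C f k" "is_cokernel (opposite C) f k \<longleftrightarrow> is_kernel C f k"
  by (simp_all add: is_kernel_def is_cokernel_def)

lemma monic_opposite [simp]:
  "monic (opposite C) f \<longleftrightarrow> epic C f" "epic (opposite C) f \<longleftrightarrow> monic C f"
  by (simp_all add: monic_def epic_def)

lemma additive_subcategory_opposite [simp]:
  "additive_subcategory (opposite C) \<X> \<longleftrightarrow> additive_subcategory C \<X>"
  unfolding additive_subcategory_def by simp blast

lemma approximation_opposite [simp]:
  "left_approximation (opposite C) \<X> M \<theta> \<longleftrightarrow> right_approximation C \<X> M \<theta>"
  "right_approximation (opposite C) \<X> M \<theta> \<longleftrightarrow> left_approximation C \<X> M \<theta>"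
  by (simp_all add: left_approximation_def right_approximation_def)

lemma finite_opposite [simp]:
  "covariantly_finite (opposite C) \<X> \<longleftrightarrow> contravariantly_finite C \<X>"
  "contravariantly_finite (opposite C) \<X> \<longleftrightarrow> covariantly_finite C \<X>"
  by (simp_all add: covariantly_finite_def contravariantly_finite_def)

lemma admissible_opposite [simp]: "admissible (opposite C) \<X> \<longleftrightarrow> coadmissible C \<X>"
  by (simp add: admissible_def coadmissible_def)

lemma (in abelian_category) abelian_opposite: "abelian_category (opposite C)"
proof (intro abelian_category.intro additive_category.intro preadditive_category.intro category.intro
    preadditive_category_axioms.intro additive_category_axioms.intro abelian_category_axioms.intro)
  fix f g h a b c d
  show "f \<in> Arr (opposite C) \<Longrightarrow> Dom (opposite C) f \<in> Ob (opposite C)"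
    "f \<in> Arr (opposite C) \<Longrightarrow> Cod (opposite C) f \<in> Ob (opposite C)"
    "a \<in> Ob (opposite C) \<Longrightarrow> Id (opposite C) a \<in> Hom (opposite C) a a"
    by (simp_all add: Id_in)
  show "f \<in> Hom (opposite C) a b \<Longrightarrow> g \<in> Hom (opposite C) b c \<Longrightarrow> g \<cdot>\<^bsub>opposite C\<^esub> f \<in> Hom (opposite C) a c"
    by (simp add: Comp_in)
  show "f \<in> Hom (opposite C) a b \<Longrightarrow> Id (opposite C) b \<cdot>\<^bsub>opposite C\<^esub> f = f"
    "f \<in> Hom (opposite C) a b \<Longrightarrow> f \<cdot>\<^bsub>opposite C\<^esub> Id (opposite C) a = f"
    by (simp_all add: Id_left Id_right)
  show "f \<in> Hom (opposite C) a b \<Longrightarrow> g \<in> Hom (opposite C) b c \<Longrightarrow> h \<in> Hom (opposite C) c d \<Longrightarrow>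
      h \<cdot>\<^bsub>opposite C\<^esub> g \<cdot>\<^bsub>opposite C\<^esub> f = h \<cdot>\<^bsub>opposite C\<^esub> (g \<cdot>\<^bsub>opposite C\<^esub> f)"
    by (simp add: Comp_assoc)
next
  fix f f' g g' a b c
  show "a \<in> Ob (opposite C) \<Longrightarrow> b \<in> Ob (opposite C) \<Longrightarrow> comm_group (hom_group (opposite C) a b)"
    by (simp add: hom_comm_group)
  show "f \<in> Hom (opposite C) a b \<Longrightarrow> f' \<in> Hom (opposite C) a b \<Longrightarrow> g \<in> Hom (opposite C) b c \<Longrightarrow>
      g \<cdot>\<^bsub>opposite C\<^esub> (f \<boxplus>\<^bsub>opposite C\<^esub> f') = g \<cdot>\<^bsub>opposite C\<^esub> f \<boxplus>\<^bsub>opposite C\<^esub> g \<cdot>\<^bsub>opposite C\<^esub> f'"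
    by (simp add: Comp_Add_left)
  show "f \<in> Hom (opposite C) a b \<Longrightarrow> g \<in> Hom (opposite C) b c \<Longrightarrow> g' \<in> Hom (opposite C) b c \<Longrightarrow>
      (g \<boxplus>\<^bsub>opposite C\<^esub> g') \<cdot>\<^bsub>opposite C\<^esub> f = g \<cdot>\<^bsub>opposite C\<^esub> f \<boxplus>\<^bsub>opposite C\<^esub> g' \<cdot>\<^bsub>opposite C\<^esub> f"
    by (simp add: Comp_Add_right)
next
  show "\<exists>z. zero_object (opposite C) z" by (simp add: ex_zero_object)
  show "\<exists>s i1 i2 p1 p2. biproduct (opposite C) a b s i1 i2 p1 p2" if "a \<in> Ob (opposite C)" "b \<in> Ob (opposite C)" for a b
    using ex_biproduct[of a b] that unfolding biproduct_opposite opposite_simps by blast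
  fix f
  show "f \<in> Arr (opposite C) \<Longrightarrow> \<exists>k. is_kernel (opposite C) f k"
    "f \<in> Arr (opposite C) \<Longrightarrow> \<exists>k. is_cokernel (opposite C) f k"
    "monic (opposite C) f \<Longrightarrow> \<exists>k. is_kernel (opposite C) k f"
    "epic (opposite C) f \<Longrightarrow> \<exists>k. is_cokernel (opposite C) k f"
    by (simp_all add: ex_kernel ex_cokernel monic_is_kernel epic_is_cokernel)
qed

section \<open>Complexes and balanced pairs in the opposite category\<close>

lemma op_cplx_simps [simp]:
  "obj (op_cplx M) n = obj M (- n)" "diff (op_cplx M) n = diff M (- n - 1)" "op_cplx (op_cplx M) = M"
  by (simp_all add: op_cplx_def)

lemma all_uminus_int: "(\<forall>n :: int. P n) \<longleftrightarrow> (\<forall>n. P (- n))"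
  by (metis minus_minus)

lemma op_cplx_complexesI:
  assumes "M \<in> complexes C"
  shows "op_cplx M \<in> complexes (opposite C)"
proof -
  have M: "obj M n \<in> Ob C" "diff M n \<in> Hom C (obj M n) (obj M (n + 1))"
    "diff M (n + 1) \<cdot>\<^bsub>C\<^esub> diff M n = Zero C (obj M n) (obj M (n + 1 + 1))" for n
    using assms by (auto simp: complexes_def)
  show ?thesis
    unfolding complexes_def
  proof (intro CollectI allI conjI)
    fix n :: int
    have [simp]: "- 1 - n = - n - 1" "- 2 - n = - n - 2" by simp_all
    show "obj (op_cplx M) n \<in> Ob (opposite C)" by (simp add: M)
    show "diff (op_cplx M) n \<in> Hom (opposite C) (obj (op_cplx M) n) (obj (op_cplx M) (n + 1))"
      using M(2)[of "- n - 1"] by simp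
    show "diff (op_cplx M) (n + 1) \<cdot>\<^bsub>opposite C\<^esub> diff (op_cplx M) n =
        Zero (opposite C) (obj (op_cplx M) n) (obj (op_cplx M) (n + 1 + 1))"
      using M(3)[of "- n - 2"] by simp
  qed
qed

lemma op_cplx_complexes [simp]: "op_cplx M \<in> complexes (opposite C) \<longleftrightarrow> M \<in> complexes C"
  using op_cplx_complexesI[of M C] op_cplx_complexesI[of "op_cplx M" "opposite C"] by auto

lemma op_cplx_in [simp]: "op_cplx M \<in> cplx_in (opposite C) S \<longleftrightarrow> M \<in> cplx_in C S"
  using all_uminus_int[of "\<lambda>n. obj M n \<in> S"] by (simp add: cplx_in_def)

lemma chain_maps_oppositeI:
  assumes "f \<in> chain_maps C M N"
  shows "(\<lambda>n. f (- n)) \<in> chain_maps (opposite C) (op_cplx N) (op_cplx M)"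
proof -
  have f: "f n \<in> Hom C (obj M n) (obj N n)" "diff N n \<cdot>\<^bsub>C\<^esub> f n = f (n + 1) \<cdot>\<^bsub>C\<^esub> diff M n" for n
    using assms by (auto simp: chain_maps_def)
  show ?thesis
    unfolding chain_maps_def using f(1) f(2)[of "- n - 1" for n] by simp
qed

lemma chain_maps_opposite:
  "f \<in> chain_maps (opposite C) (op_cplx N) (op_cplx M) \<longleftrightarrow> (\<lambda>n. f (- n)) \<in> chain_maps C M N"
  using chain_maps_oppositeI[of "\<lambda>n. f (- n)" C M N] chain_maps_oppositeI[of f "opposite C" "op_cplx N" "op_cplx M"]
  by auto

text \<open>\<open>\<sigma> m\<close> leads from degree \<open>m + 1\<close> to degree
  \<open>m\<close>. With arrows and degrees reversed its target is degree \<open>- m - 1\<close>,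
  and homotopies are indexed by their target.\<close>

lemma null_homotopy_opposite:
  assumes "preadditive_category C" "M \<in> complexes C" "N \<in> complexes C" "null_homotopy C M N u \<sigma>"
  shows "null_homotopy (opposite C) (op_cplx N) (op_cplx M) (\<lambda>n. u (- n)) (\<lambda>n. \<sigma> (- n - 1))"
proof -
  interpret preadditive_category C by fact
  note [simp] = cplx_simps[OF assms(2)] cplx_simps[OF assms(3)] null_simps(1-3)[OF assms(4)]
  have *: "u (- n - 1) = diff N (- n - 2) \<cdot>\<^bsub>C\<^esub> \<sigma> (- n - 2) \<boxplus>\<^bsub>C\<^esub> \<sigma> (- n - 1) \<cdot>\<^bsub>C\<^esub> diff M (- n - 1)" for n
    using null_simps(4)[OF assms(4), of "- n - 1" "- n - 2"] by simp
  show ?thesis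
    unfolding null_homotopy_def
  proof (intro allI conjI)
    fix n :: int
    have [simp]: "- 1 - n = - n - 1" "- 2 - n = - n - 2" by simp_all
    show "\<sigma> (- n - 1) \<in> Hom (opposite C) (obj (op_cplx N) (n + 1)) (obj (op_cplx M) n)"
      by (simp add: Hom_iff)
    show "u (- (n + 1)) = diff (op_cplx M) n \<cdot>\<^bsub>opposite C\<^esub> \<sigma> (- n - 1) \<boxplus>\<^bsub>opposite C\<^esub>
        \<sigma> (- (n + 1) - 1) \<cdot>\<^bsub>opposite C\<^esub> diff (op_cplx N) (n + 1)"
      using *[of n] by (simp add: add_commute)
  qed
qed

lemma Hom_acyclic_opposite [simp]:
  "Hom_from_acyclic (opposite C) a (op_cplx M) \<longleftrightarrow> Hom_to_acyclic C a M"
  "Hom_to_acyclic (opposite C) a (op_cplx M) \<longleftrightarrow> Hom_from_acyclic C a M"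
  unfolding Hom_from_acyclic_def Hom_to_acyclic_def
  using all_uminus_int[of "\<lambda>n. {u \<in> Hom C (obj M n) a. u \<cdot>\<^bsub>C\<^esub> diff M (n - 1) = Zero C (obj M (n - 1)) a} =
      (\<lambda>v. v \<cdot>\<^bsub>C\<^esub> diff M n) ` Hom C (obj M (n + 1)) a"]
    all_uminus_int[of "\<lambda>n. {u \<in> Hom C a (obj M n). diff M n \<cdot>\<^bsub>C\<^esub> u = Zero C a (obj M (n + 1))} =
      (\<lambda>v. diff M (n - 1) \<cdot>\<^bsub>C\<^esub> v) ` Hom C a (obj M (n - 1))"]
  by simp_all

lemma resolution_opposite:
  "resolution C \<X> M R \<Longrightarrow> coresolution (opposite C) \<X> M (op_cplx R)"
  "coresolution C \<X> M R \<Longrightarrow> resolution (opposite C) \<X> M (op_cplx R)"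
  by (simp_all add: resolution_def coresolution_def)

lemma balanced_pair_opposite:
  assumes "balanced_pair C \<X> \<Y>"
  shows "balanced_pair (opposite C) \<Y> \<X>"
  unfolding balanced_pair_def
proof (intro conjI ballI)
  fix M assume "M \<in> Ob (opposite C)"
  then obtain R R' where R: "coresolution C \<Y> M R" "\<forall>X \<in> \<X>. Hom_from_acyclic C X R"
      and R': "resolution C \<X> M R'" "\<forall>Y \<in> \<Y>. Hom_to_acyclic C Y R'"
    using assms unfolding balanced_pair_def opposite_simps by meson
  show "\<exists>R. resolution (opposite C) \<Y> M R \<and> (\<forall>Y \<in> \<X>. Hom_to_acyclic (opposite C) Y R)"
    using resolution_opposite(2)[OF R(1)] R(2) by (intro exI[where x = "op_cplx R"]) simp
  show "\<exists>R. coresolution (opposite C) \<X> M R \<and> (\<forall>X \<in> \<Y>. Hom_from_acyclic (opposite C) X R)"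
    using resolution_opposite(1)[OF R'(1)] R'(2) by (intro exI[where x = "op_cplx R'"]) simp
qed (use assms in \<open>simp_all add: balanced_pair_def\<close>)

text \<open>Reversal sends a resolution of length \<open>n\<close> to a coresolution of length
  \<open>n\<close>, so the infimum on the left is taken over a larger set.\<close>

lemma cores_dim_opposite_le: "cores_dim (opposite C) \<X> \<le> res_dim C \<X>"
  unfolding cores_dim_def res_dim_def opposite_simps
proof (rule SUP_mono')
  fix M
  have "\<exists>R'. coresolution (opposite C) \<X> M R' \<and> (\<forall>i > int n. zero_object (opposite C) (obj R' i))"
    if "resolution C \<X> M R" "\<forall>i < - int n. zero_object C (obj R i)" for n R
    using that resolution_opposite(1)[OF that(1)] by (intro exI[where x = "op_cplx R"]) simp
  then show "cores_dim_ob (opposite C) \<X> M \<le> res_dim_ob C \<X> M"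
    unfolding cores_dim_ob_def res_dim_ob_def by (intro Inf_superset_mono) blast
qed

text \<open>The reversed complex is coresolved in the opposite category. There the balanced pair
  becomes \<open>(\<Y>, \<X>)\<close>, and \<Y> is admissible because it is coadmissible in
  \<open>C\<close>. The lifting property obtained there is homotopy extension here.\<close>

lemma (in abelian_category) ex_resolution_complex:
  assumes \<X>: "additive_subcategory C \<X>" and bp: "balanced_pair C \<X> \<Y>" and adm: "admissible C \<X>"
    and dim: "res_dim C \<X> < \<infinity>" and M: "M \<in> complexes C"
  shows "\<exists>P \<in> cplx_in C \<X>. \<exists>k \<in> chain_maps C P M. homotopy_extending C \<Y> P M k"
proof -
  interpret op: abelian_category "opposite C" by (rule abelian_opposite)
  have "cores_dim (opposite C) \<X> < \<infinity>" using cores_dim_opposite_le[of C \<X>] dim by (rule le_less_trans)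
  then obtain T j where T: "T \<in> cplx_in (opposite C) \<X>" and j: "j \<in> chain_maps (opposite C) (op_cplx M) T"
    and lift: "homotopy_lifting (opposite C) \<Y> (op_cplx M) T j"
    using op.ex_coresolution_complex[of \<X> \<Y> "op_cplx M"] \<X> M balanced_pair_opposite[OF bp]
      coadmissible_if_admissible[OF bp adm] by auto
  define P where "P = op_cplx T"
  define k where "k n = j (- n)" for n
  have T': "T = op_cplx P" by (simp add: P_def)
  have P: "P \<in> cplx_in C \<X>" using T by (simp add: T')
  then have PC: "P \<in> complexes C" by (simp add: cplx_in_def)
  have j': "j = (\<lambda>n. k (- n))" by (simp add: k_def)
  have k: "k \<in> chain_maps C P M" using j unfolding T' j' chain_maps_opposite by simp
  have "homotopy_extending C \<Y> P M k"
    unfolding homotopy_extending_def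
  proof (intro ballI conjI allI impI)
    fix Q v assume Q: "Q \<in> cplx_in C \<Y>" and v: "v \<in> chain_maps C P Q"
    have QC: "Q \<in> complexes C" using Q by (simp add: cplx_in_def)
    have "(\<lambda>n. v (- n)) \<in> chain_maps (opposite C) (op_cplx Q) T"
      unfolding T' chain_maps_opposite using v by simp
    from op.homotopy_liftingD(1)[OF lift _ this] Q obtain f \<sigma>
      where f: "f \<in> chain_maps (opposite C) (op_cplx Q) (op_cplx M)"
        and \<sigma>: "null_homotopy (opposite C) (op_cplx Q) (op_cplx P) (\<lambda>n. v (- n) \<boxminus> f n \<cdot> k (- n)) \<sigma>"
      by (auto simp: T' j')
    have "null_homotopy C P Q (\<lambda>n. v n \<boxminus> f (- n) \<cdot> k n) (\<lambda>n. \<sigma> (- n - 1))"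
      using null_homotopy_opposite[OF _ _ _ \<sigma>] op.preadditive_category_axioms QC PC by simp
    then show "\<exists>f \<in> chain_maps C M Q. \<exists>\<sigma>. null_homotopy C P Q (\<lambda>n. v n \<boxminus> f n \<cdot> k n) \<sigma>"
      using f unfolding chain_maps_opposite by (intro bexI[where x = "\<lambda>n. f (- n)"] exI)
  next
    fix Q f \<sigma> assume Q: "Q \<in> cplx_in C \<Y>" and f: "f \<in> chain_maps C M Q"
      and \<sigma>: "null_homotopy C P Q (\<lambda>n. f n \<cdot> k n) \<sigma>"
    have QC: "Q \<in> complexes C" using Q by (simp add: cplx_in_def)
    have f': "(\<lambda>n. f (- n)) \<in> chain_maps (opposite C) (op_cplx Q) (op_cplx M)"
      unfolding chain_maps_opposite using f by simp
    have "null_homotopy (opposite C) (op_cplx Q) T (\<lambda>n. j n \<cdot>\<^bsub>opposite C\<^esub> f (- n)) (\<lambda>n. \<sigma> (- n - 1))"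
      using null_homotopy_opposite[OF preadditive_category_axioms PC QC \<sigma>] by (simp add: T' j')
    then obtain \<tau> where \<tau>: "null_homotopy (opposite C) (op_cplx Q) (op_cplx M) (\<lambda>n. f (- n)) \<tau>"
      using op.homotopy_liftingD(2)[OF lift _ f'] Q by auto
    show "\<exists>\<tau>. null_homotopy C M Q f \<tau>"
      using null_homotopy_opposite[OF _ _ _ \<tau>] op.preadditive_category_axioms QC M by auto
  qed
  then show ?thesis using P k by blast
qed

section \<open>The homotopy category of a full subcategory\<close>

context preadditive_category
begin

lemma homotopy_relI:
  "M \<in> complexes C \<Longrightarrow> N \<in> complexes C \<Longrightarrow> f \<in> chain_maps C M N \<Longrightarrow> g \<in> chain_maps C M N \<Longrightarrow>
   null_homotopy C M N (\<lambda>n. f n \<boxminus> g n) \<sigma> \<Longrightarrow> (f, g) \<in> homotopy_rel C M N"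
  by (auto simp: homotopy_rel_iff)

lemma homotopy_rel_refl:
  assumes M: "M \<in> complexes C" and N: "N \<in> complexes C" and f: "f \<in> chain_maps C M N"
  shows "(f, f) \<in> homotopy_rel C M N"
  using null_Zero[OF M N] chain_simps(1-3)[OF f M N] by (intro homotopy_relI[OF M N f f]) simp

lemma homotopy_rel_sym:
  assumes M: "M \<in> complexes C" and N: "N \<in> complexes C" and fg: "(f, g) \<in> homotopy_rel C M N"
  shows "(g, f) \<in> homotopy_rel C M N"
proof -
  obtain \<sigma> where f: "f \<in> chain_maps C M N" and g: "g \<in> chain_maps C M N"
      and \<sigma>: "null_homotopy C M N (\<lambda>n. f n \<boxminus> g n) \<sigma>"
    using fg by (auto simp: homotopy_rel_iff[OF M N])
  note [simp] = cplx_simps[OF M] cplx_simps[OF N] chain_simps(1-3)[OF f M N] chain_simps(1-3)[OF g M N]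
  have "(\<lambda>n. Zero C (obj M n) (obj N n) \<boxminus> (f n \<boxminus> g n)) = (\<lambda>n. g n \<boxminus> f n)"
    by (rule ext) (simp add: arith)
  then show ?thesis using homotopy_relI[OF M N g f] null_sub[OF M N null_Zero[OF M N] \<sigma>] by simp
qed

lemma homotopy_rel_trans:
  assumes M: "M \<in> complexes C" and N: "N \<in> complexes C"
    and fg: "(f, g) \<in> homotopy_rel C M N" and gh: "(g, h) \<in> homotopy_rel C M N"
  shows "(f, h) \<in> homotopy_rel C M N"
proof -
  obtain \<sigma> \<tau> where f: "f \<in> chain_maps C M N" and g: "g \<in> chain_maps C M N" and h: "h \<in> chain_maps C M N"
      and \<sigma>: "null_homotopy C M N (\<lambda>n. f n \<boxminus> g n) \<sigma>" and \<tau>: "null_homotopy C M N (\<lambda>n. g n \<boxminus> h n) \<tau>"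
    using fg gh by (auto simp: homotopy_rel_iff[OF M N])
  note [simp] = cplx_simps[OF M] cplx_simps[OF N] chain_simps(1-3)[OF f M N] chain_simps(1-3)[OF g M N]
    chain_simps(1-3)[OF h M N]
  have "(\<lambda>n. (f n \<boxminus> g n) \<boxplus> (g n \<boxminus> h n)) = (\<lambda>n. f n \<boxminus> h n)"
    by (rule ext) (simp add: arith)
  then show ?thesis using homotopy_relI[OF M N f h] null_Add[OF M N \<sigma> \<tau>] by simp
qed

lemma homotopy_rel_Add:
  assumes M: "M \<in> complexes C" and N: "N \<in> complexes C"
    and ff': "(f, f') \<in> homotopy_rel C M N" and gg': "(g, g') \<in> homotopy_rel C M N"
  shows "(\<lambda>n. f n \<boxplus> g n, \<lambda>n. f' n \<boxplus> g' n) \<in> homotopy_rel C M N"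
proof -
  obtain \<sigma> \<tau> where f: "f \<in> chain_maps C M N" and f': "f' \<in> chain_maps C M N"
      and g: "g \<in> chain_maps C M N" and g': "g' \<in> chain_maps C M N"
      and \<sigma>: "null_homotopy C M N (\<lambda>n. f n \<boxminus> f' n) \<sigma>" and \<tau>: "null_homotopy C M N (\<lambda>n. g n \<boxminus> g' n) \<tau>"
    using ff' gg' by (auto simp: homotopy_rel_iff[OF M N])
  note [simp] = cplx_simps[OF M] cplx_simps[OF N] chain_simps(1-3)[OF f M N] chain_simps(1-3)[OF g M N]
    chain_simps(1-3)[OF f' M N] chain_simps(1-3)[OF g' M N]
  have "(\<lambda>n. (f n \<boxminus> f' n) \<boxplus> (g n \<boxminus> g' n)) = (\<lambda>n. (f n \<boxplus> g n) \<boxminus> (f' n \<boxplus> g' n))"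
    by (rule ext) (simp add: arith)
  then show ?thesis
    using homotopy_relI[OF M N chain_Add[OF M N f g] chain_Add[OF M N f' g']] null_Add[OF M N \<sigma> \<tau>] by simp
qed

lemma homotopy_rel_Comp:
  assumes M: "M \<in> complexes C" and N: "N \<in> complexes C" and L: "L \<in> complexes C"
    and ff': "(f, f') \<in> homotopy_rel C M N" and gg': "(g, g') \<in> homotopy_rel C N L"
  shows "(\<lambda>n. g n \<cdot> f n, \<lambda>n. g' n \<cdot> f' n) \<in> homotopy_rel C M L"
proof -
  obtain \<sigma> \<tau> where f: "f \<in> chain_maps C M N" and f': "f' \<in> chain_maps C M N"
      and g: "g \<in> chain_maps C N L" and g': "g' \<in> chain_maps C N L"
      and \<sigma>: "null_homotopy C M N (\<lambda>n. f n \<boxminus> f' n) \<sigma>" and \<tau>: "null_homotopy C N L (\<lambda>n. g n \<boxminus> g' n) \<tau>"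
    using ff' gg' by (auto simp: homotopy_rel_iff[OF M N] homotopy_rel_iff[OF N L])
  note [simp] = cplx_simps[OF M] cplx_simps[OF N] cplx_simps[OF L] chain_simps(1-3)[OF f M N]
    chain_simps(1-3)[OF g N L] chain_simps(1-3)[OF f' M N] chain_simps(1-3)[OF g' N L]
  \<comment> \<open>The two factors are changed one at a time.\<close>
  have "(\<lambda>n. g n \<cdot> (f n \<boxminus> f' n) \<boxplus> (g n \<boxminus> g' n) \<cdot> f' n) = (\<lambda>n. g n \<cdot> f n \<boxminus> g' n \<cdot> f' n)"
    by (rule ext) (simp add: arith)
  then show ?thesis
    using homotopy_relI[OF M L chain_Comp[OF M N L f g] chain_Comp[OF M N L f' g']]
      null_Add[OF M L null_comp_left[OF M N L \<sigma> g] null_comp_right[OF M N L f' \<tau>]] by simp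
qed

lemma hclass_eq_iff:
  assumes M: "M \<in> complexes C" and N: "N \<in> complexes C" and f: "f \<in> chain_maps C M N"
  shows "hclass C M N f = hclass C M N g \<longleftrightarrow> (f, g) \<in> homotopy_rel C M N"
proof
  assume "hclass C M N f = hclass C M N g"
  then have "f \<in> homotopy_rel C M N `` {g}" using homotopy_rel_refl[OF M N f] by (auto simp: hclass_def)
  then show "(f, g) \<in> homotopy_rel C M N" using homotopy_rel_sym[OF M N] by blast
next
  assume "(f, g) \<in> homotopy_rel C M N"
  then show "hclass C M N f = hclass C M N g"
    using homotopy_rel_sym[OF M N] homotopy_rel_trans[OF M N] unfolding hclass_def by blast
qed

text \<open>The composites of all representatives need not form a full class; the closure under
  homotopy in \<open>hcomp\<close> completes them to one.\<close>

lemma hcomp_hclass: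
  assumes M: "M \<in> complexes C" and N: "N \<in> complexes C" and L: "L \<in> complexes C"
    and f: "f \<in> chain_maps C M N" and g: "g \<in> chain_maps C N L"
  shows "hcomp C (hclass C N L g) (hclass C M N f) = hclass C M L (\<lambda>n. g n \<cdot> f n)"
proof -
  let ?F = "homotopy_rel C M N `` {f}" and ?G = "homotopy_rel C N L `` {g}"
  have "homotopy_rel C M L `` {\<lambda>n. g' n \<cdot> f' n | f' g'. f' \<in> ?F \<and> g' \<in> ?G} = homotopy_rel C M L `` {\<lambda>n. g n \<cdot> f n}"
  proof (intro equalityI subsetI)
    fix u assume "u \<in> homotopy_rel C M L `` {\<lambda>n. g' n \<cdot> f' n | f' g'. f' \<in> ?F \<and> g' \<in> ?G}"
    then obtain f' g' where "(f, f') \<in> homotopy_rel C M N" "(g, g') \<in> homotopy_rel C N L"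
        "(\<lambda>n. g' n \<cdot> f' n, u) \<in> homotopy_rel C M L" by blast
    then show "u \<in> homotopy_rel C M L `` {\<lambda>n. g n \<cdot> f n}"
      using homotopy_rel_trans[OF M L homotopy_rel_Comp[OF M N L]] by blast
  next
    fix u assume "u \<in> homotopy_rel C M L `` {\<lambda>n. g n \<cdot> f n}"
    then show "u \<in> homotopy_rel C M L `` {\<lambda>n. g' n \<cdot> f' n | f' g'. f' \<in> ?F \<and> g' \<in> ?G}"
      using homotopy_rel_refl[OF M N f] homotopy_rel_refl[OF N L g] by blast
  qed
  then show ?thesis by (simp add: hcomp_def hclass_def)
qed

lemma hadd_hclass:
  assumes M: "M \<in> complexes C" and N: "N \<in> complexes C"
    and f: "f \<in> chain_maps C M N" and g: "g \<in> chain_maps C M N"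
  shows "hadd C (hclass C M N f) (hclass C M N g) = hclass C M N (\<lambda>n. f n \<boxplus> g n)"
proof -
  let ?F = "homotopy_rel C M N `` {f}" and ?G = "homotopy_rel C M N `` {g}"
  have "homotopy_rel C M N `` {\<lambda>n. f' n \<boxplus> g' n | f' g'. f' \<in> ?F \<and> g' \<in> ?G} = homotopy_rel C M N `` {\<lambda>n. f n \<boxplus> g n}"
  proof (intro equalityI subsetI)
    fix u assume "u \<in> homotopy_rel C M N `` {\<lambda>n. f' n \<boxplus> g' n | f' g'. f' \<in> ?F \<and> g' \<in> ?G}"
    then obtain f' g' where "(f, f') \<in> homotopy_rel C M N" "(g, g') \<in> homotopy_rel C M N"
        "(\<lambda>n. f' n \<boxplus> g' n, u) \<in> homotopy_rel C M N" by blast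
    then show "u \<in> homotopy_rel C M N `` {\<lambda>n. f n \<boxplus> g n}"
      using homotopy_rel_trans[OF M N homotopy_rel_Add[OF M N]] by blast
  next
    fix u assume "u \<in> homotopy_rel C M N `` {\<lambda>n. f n \<boxplus> g n}"
    then show "u \<in> homotopy_rel C M N `` {\<lambda>n. f' n \<boxplus> g' n | f' g'. f' \<in> ?F \<and> g' \<in> ?G}"
      using homotopy_rel_refl[OF M N f] homotopy_rel_refl[OF M N g] by blast
  qed
  then show ?thesis by (simp add: hadd_def hclass_def)
qed

lemma shift_cplx_complexes:
  assumes M: "M \<in> complexes C"
  shows "shift_cplx C M \<in> complexes C"
proof -
  note [simp] = cplx_simps[OF M]
  have "neg C (diff M (n + 2)) \<cdot> neg C (diff M (n + 1)) = Zero C (obj M (n + 1)) (obj M (n + 3))" for n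
    by (simp add: arith)
  then show ?thesis by (simp add: complexes_def shift_cplx_def Hom_iff)
qed

lemma shift_simps [simp]: "obj (shift_cplx C M) n = obj M (n + 1)" "diff (shift_cplx C M) n = neg C (diff M (n + 1))"
  by (simp_all add: shift_cplx_def)

text \<open>The differentials of the shifted complexes carry a sign, so a homotopy has to be shifted
  and negated.\<close>

lemma homotopy_rel_shift:
  assumes M: "M \<in> complexes C" and N: "N \<in> complexes C"
  shows "(\<lambda>n. f (n + 1), \<lambda>n. g (n + 1)) \<in> homotopy_rel C (shift_cplx C M) (shift_cplx C N) \<longleftrightarrow>
    (f, g) \<in> homotopy_rel C M N"
proof -
  note [simp] = cplx_simps[OF M] cplx_simps[OF N]
  have ch: "(\<lambda>n. f (n + 1)) \<in> chain_maps C (shift_cplx C M) (shift_cplx C N) \<longleftrightarrow> f \<in> chain_maps C M N" for f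
  proof
    assume f: "f \<in> chain_maps C M N"
    show "(\<lambda>n. f (n + 1)) \<in> chain_maps C (shift_cplx C M) (shift_cplx C N)"
      by (rule chain_mapsI) (simp_all add: chain_simps[OF f M N] arith)
  next
    assume f: "(\<lambda>n. f (n + 1)) \<in> chain_maps C (shift_cplx C M) (shift_cplx C N)"
    show "f \<in> chain_maps C M N"
    proof (rule chain_mapsI)
      fix n
      show *: "f n \<in> Arr C" "Dom C (f n) = obj M n" "Cod C (f n) = obj N n" for n
        using chain_simps(1-3)[OF f shift_cplx_complexes[OF M] shift_cplx_complexes[OF N], of "n - 1"] by simp_all
      show "diff N n \<cdot> f n = f (n + 1) \<cdot> diff M n"
        using chain_simps(4)[OF f shift_cplx_complexes[OF M] shift_cplx_complexes[OF N], of "n - 1"] *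
        by (simp add: arith)
    qed
  qed
  have "(\<exists>\<sigma>. null_homotopy C (shift_cplx C M) (shift_cplx C N) (\<lambda>n. u (n + 1)) \<sigma>) \<longleftrightarrow>
      (\<exists>\<sigma>. null_homotopy C M N u \<sigma>)" for u
  proof
    assume "\<exists>\<sigma>. null_homotopy C (shift_cplx C M) (shift_cplx C N) (\<lambda>n. u (n + 1)) \<sigma>"
    then obtain \<sigma> where \<sigma>: "null_homotopy C (shift_cplx C M) (shift_cplx C N) (\<lambda>n. u (n + 1)) \<sigma>" by blast
    have [simp]: "\<sigma> n \<in> Arr C" "Dom C (\<sigma> n) = obj M (n + 2)" "Cod C (\<sigma> n) = obj N (n + 1)" for n
      using null_simps(1-3)[OF \<sigma>, of n] by simp_all
    have "null_homotopy C M N u (\<lambda>n. neg C (\<sigma> (n - 1)))"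
    proof (rule null_homotopyI)
      fix n
      show "u (n + 1) = diff N n \<cdot> neg C (\<sigma> (n - 1)) \<boxplus> neg C (\<sigma> (n + 1 - 1)) \<cdot> diff M (n + 1)"
        using null_simps(4)[OF \<sigma>, of n "n - 1"] by (simp add: arith)
    qed simp_all
    then show "\<exists>\<sigma>. null_homotopy C M N u \<sigma>" by blast
  next
    assume "\<exists>\<sigma>. null_homotopy C M N u \<sigma>"
    then obtain \<sigma> where \<sigma>: "null_homotopy C M N u \<sigma>" by blast
    note [simp] = null_simps(1-3)[OF \<sigma>]
    have "null_homotopy C (shift_cplx C M) (shift_cplx C N) (\<lambda>n. u (n + 1)) (\<lambda>n. neg C (\<sigma> (n + 1)))"
      by (rule null_homotopyI) (simp_all add: null_simps(4)[OF \<sigma>, of "n + 2" "n + 1" for n] arith)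
    then show "\<exists>\<sigma>. null_homotopy C (shift_cplx C M) (shift_cplx C N) (\<lambda>n. u (n + 1)) \<sigma>" by blast
  qed
  from this[of "\<lambda>n. f n \<boxminus> g n"] show ?thesis
    by (simp add: homotopy_rel_iff[OF M N] homotopy_rel_iff[OF shift_cplx_complexes[OF M] shift_cplx_complexes[OF N]] ch)
qed

text \<open>\<open>shift_harr\<close> takes the image of a class without closing it under homotopy.
  The image is a full class because every map between the shifted complexes can be shifted
  back.\<close>

lemma shift_harr_hclass:
  assumes M: "M \<in> complexes C" and N: "N \<in> complexes C"
  shows "shift_harr C (hclass C M N f) = hclass C (shift_cplx C M) (shift_cplx C N) (\<lambda>n. f (n + 1))"
proof -
  have "u \<in> (\<lambda>f n. f (n + 1)) ` homotopy_rel C M N `` {f}"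
    if "(\<lambda>n. f (n + 1), u) \<in> homotopy_rel C (shift_cplx C M) (shift_cplx C N)" for u
    using that homotopy_rel_shift[OF M N, of f "\<lambda>n. u (n - 1)"]
    by (intro image_eqI[where x = "\<lambda>n. u (n - 1)"]) simp_all
  moreover have "(\<lambda>n. f (n + 1), u) \<in> homotopy_rel C (shift_cplx C M) (shift_cplx C N)"
    if "u \<in> (\<lambda>f n. f (n + 1)) ` homotopy_rel C M N `` {f}" for u
    using that homotopy_rel_shift[OF M N, of f] by auto
  ultimately show ?thesis unfolding shift_harr_def hclass_def by auto
qed

end

section \<open>Complexes over a full subcategory, seen in the ambient category\<close>

lemma homotopy_category_simps [simp]:
  "Ob (homotopy_category C) = complexes C"
  "Arr (homotopy_category C) = {(X, Y, F). X \<in> complexes C \<and> Y \<in> complexes C \<and>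
     F \<in> chain_maps C X Y // homotopy_rel C X Y}"
  "Dom (homotopy_category C) (X, Y, F) = X" "Cod (homotopy_category C) (X, Y, F) = Y"
  "Id (homotopy_category C) X = hclass C X X (\<lambda>n. Id C (obj X n))"
  "Comp (homotopy_category C) = hcomp C" "Add (homotopy_category C) = hadd C"
  "ShiftOb (homotopy_category C) = shift_cplx C" "ShiftArr (homotopy_category C) = shift_harr C"
  "Dist (homotopy_category C) = distinguished_triangles C"
  by (simp_all add: homotopy_category_def homotopy_precat_def precat.extend_def)

text \<open>\<open>distinguished_triangles\<close> is formulated over
  \<open>homotopy_precat\<close>, which has no shift. This fact and the next two move to
  \<open>homotopy_category\<close>, which has the same objects and arrows.\<close>

lemma Hom_homotopy_precat: "Hom (homotopy_precat C) = Hom (homotopy_category C)"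
  by (intro ext) (simp add: Hom_def homotopy_category_def homotopy_precat_def precat.extend_def)

lemma iso_arr_homotopy_precat: "iso_arr (homotopy_precat C) = iso_arr (homotopy_category C)"
  by (intro ext)
    (simp add: iso_arr_def Hom_homotopy_precat, simp add: homotopy_category_def homotopy_precat_def precat.extend_def)

lemma Comp_homotopy_precat: "Comp (homotopy_precat C) = hcomp C"
  by (simp add: homotopy_precat_def)

lemma Hom_homotopy_category:
  assumes "M \<in> complexes C" "N \<in> complexes C"
  shows "Hom (homotopy_category C) M N = hclass C M N ` chain_maps C M N"
  using assms by (auto simp: Hom_def hclass_def quotient_def)

lemma full_subcategory_simps [simp]:
  "Ob (full_subcategory C S) = S" "Arr (full_subcategory C S) = {f \<in> Arr C. Dom C f \<in> S \<and> Cod C f \<in> S}"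
  "Dom (full_subcategory C S) = Dom C" "Cod (full_subcategory C S) = Cod C"
  "Id (full_subcategory C S) = Id C" "Comp (full_subcategory C S) = Comp C" "Zero (full_subcategory C S) = Zero C"
  "Add (full_subcategory C S) = Add C"
  by (simp_all add: full_subcategory_def)

lemma Hom_full_subcategory: "Hom (full_subcategory C S) a b = (if a \<in> S \<and> b \<in> S then Hom C a b else {})"
  by (auto simp: Hom_def)

lemma hom_group_full_subcategory:
  "a \<in> S \<Longrightarrow> b \<in> S \<Longrightarrow> hom_group (full_subcategory C S) a b = hom_group C a b"
  by (simp add: hom_group_def Hom_full_subcategory)

lemma neg_full_subcategory: "Dom C f \<in> S \<Longrightarrow> Cod C f \<in> S \<Longrightarrow> neg (full_subcategory C S) f = neg C f"
  by (simp add: neg_def hom_group_full_subcategory)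

lemma biproduct_full_subcategory:
  "S \<subseteq> Ob C \<Longrightarrow> biproduct (full_subcategory C S) a b s i1 i2 p1 p2 \<longleftrightarrow>
     a \<in> S \<and> b \<in> S \<and> s \<in> S \<and> biproduct C a b s i1 i2 p1 p2"
  by (auto simp: biproduct_def Hom_full_subcategory)

lemma complexes_full_subcategory:
  assumes "S \<subseteq> Ob C"
  shows "complexes (full_subcategory C S) = cplx_in C S"
  using assms by (auto simp: complexes_def cplx_in_def Hom_full_subcategory)

context
  fixes C :: "('o, 'm, 'z) precat_scheme" and S :: "'o set" and M N :: "('o, 'm) cplx"
  assumes M: "M \<in> cplx_in C S" and N: "N \<in> cplx_in C S"
begin

lemma objs_in: "obj M n \<in> S" "obj N n \<in> S"
  using M N by (simp_all add: cplx_in_def)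

lemma chain_maps_full_subcategory: "chain_maps (full_subcategory C S) M N = chain_maps C M N"
  by (simp add: chain_maps_def Hom_full_subcategory objs_in)

lemma homotopy_rel_full_subcategory: "homotopy_rel (full_subcategory C S) M N = homotopy_rel C M N"
  by (simp add: homotopy_rel_def chain_maps_full_subcategory Hom_full_subcategory objs_in)

lemma hclass_full_subcategory: "hclass (full_subcategory C S) M N = hclass C M N"
  by (intro ext) (simp add: hclass_def homotopy_rel_full_subcategory)

end

lemma (in preadditive_category) shift_full_subcategory:
  assumes "M \<in> cplx_in C S"
  shows "shift_cplx (full_subcategory C S) M = shift_cplx C M"
proof -
  have "M \<in> complexes C" and [simp]: "obj M n \<in> S" for n using assms by (simp_all add: cplx_in_def)
  note cplx_simps[OF this(1), simp]
  show ?thesis by (simp add: shift_cplx_def neg_full_subcategory)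
qed

lemma (in preadditive_category) preadditive_full_subcategory:
  assumes S: "S \<subseteq> Ob C"
  shows "preadditive_category (full_subcategory C S)"
proof (intro preadditive_category.intro category.intro preadditive_category_axioms.intro)
  show "comm_group (hom_group (full_subcategory C S) a b)"
    if "a \<in> Ob (full_subcategory C S)" "b \<in> Ob (full_subcategory C S)" for a b
    using that S hom_comm_group[of a b] by (auto simp: hom_group_full_subcategory)
qed (use S in \<open>auto simp: Hom_iff comp_assoc comp_Add Add_comp subset_iff\<close>)

text \<open>Arrows of the homotopy category over \<open>S\<close>, their composites, sums and shifts
  are expressed by chain maps and homotopy classes in \<open>C\<close>. In these terms the homotopy
  categories of \<X> and of \<Y> can be handled side by side, together with maps from complexes over
  one to complexes over the other.\<close>

locale homotopy_full = preadditive_category C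
  for C :: "('o, 'm, 'z) precat_scheme" (structure) +
  fixes S :: "'o set"
  assumes S: "S \<subseteq> Ob C"
begin

abbreviation "K \<equiv> homotopy_category (full_subcategory C S)"

lemma preadditive_S: "preadditive_category (full_subcategory C S)"
  by (rule preadditive_full_subcategory[OF S])

lemma cplx_in_C: "M \<in> cplx_in C S \<Longrightarrow> M \<in> complexes C"
  by (simp add: cplx_in_def)

lemma K_Ob [simp]: "complexes (full_subcategory C S) = cplx_in C S"
  by (rule complexes_full_subcategory[OF S])

lemma K_Hom:
  "M \<in> cplx_in C S \<Longrightarrow> N \<in> cplx_in C S \<Longrightarrow> Hom K M N = hclass C M N ` chain_maps C M N"
  by (simp add: Hom_homotopy_category hclass_full_subcategory chain_maps_full_subcategory)

lemma K_Hom_objs: "f \<in> Hom K M N \<Longrightarrow> M \<in> cplx_in C S \<and> N \<in> cplx_in C S"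
  by (auto simp: Hom_def)

lemma K_Id: "M \<in> cplx_in C S \<Longrightarrow> Id K M = hclass C M M (\<lambda>n. Id C (obj M n))"
  by (simp add: hclass_full_subcategory)

lemma K_Comp:
  assumes "M \<in> cplx_in C S" "N \<in> cplx_in C S" "L \<in> cplx_in C S" "f \<in> chain_maps C M N" "g \<in> chain_maps C N L"
  shows "hclass C N L g \<cdot>\<^bsub>K\<^esub> hclass C M N f = hclass C M L (\<lambda>n. g n \<cdot> f n)"
  using preadditive_category.hcomp_hclass[OF preadditive_S, of M N L f g] assms
  by (simp add: hclass_full_subcategory chain_maps_full_subcategory)

lemma K_Add:
  assumes "M \<in> cplx_in C S" "N \<in> cplx_in C S" "f \<in> chain_maps C M N" "g \<in> chain_maps C M N"
  shows "hclass C M N f \<boxplus>\<^bsub>K\<^esub> hclass C M N g = hclass C M N (\<lambda>n. f n \<boxplus> g n)"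
  using preadditive_category.hadd_hclass[OF preadditive_S, of M N f g] assms
  by (simp add: hclass_full_subcategory chain_maps_full_subcategory)

lemma K_ShiftOb: "M \<in> cplx_in C S \<Longrightarrow> shift_cplx (full_subcategory C S) M = shift_cplx C M"
  by (rule shift_full_subcategory)

lemma shift_in: "M \<in> cplx_in C S \<Longrightarrow> shift_cplx C M \<in> cplx_in C S"
  using shift_cplx_complexes by (simp add: cplx_in_def)

lemma K_ShiftArr:
  assumes "M \<in> cplx_in C S" "N \<in> cplx_in C S"
  shows "shift_harr (full_subcategory C S) (hclass C M N f) = hclass C (shift_cplx C M) (shift_cplx C N) (\<lambda>n. f (n + 1))"
  using preadditive_category.shift_harr_hclass[OF preadditive_S, of M N f] assms
  by (simp add: hclass_full_subcategory K_ShiftOb shift_in)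

lemma K_eq_iff:
  assumes "M \<in> cplx_in C S" "N \<in> cplx_in C S" "f \<in> chain_maps C M N"
  shows "hclass C M N f = hclass C M N g \<longleftrightarrow> (f, g) \<in> homotopy_rel C M N"
  using hclass_eq_iff[of M N f g] assms by (simp add: cplx_in_def)

lemma K_in: "M \<in> cplx_in C S \<Longrightarrow> N \<in> cplx_in C S \<Longrightarrow> f \<in> chain_maps C M N \<Longrightarrow> hclass C M N f \<in> Hom K M N"
  by (simp add: K_Hom)

lemma K_E:
  assumes "u \<in> Hom K M N"
  obtains f where "f \<in> chain_maps C M N" "u = hclass C M N f" "M \<in> cplx_in C S" "N \<in> cplx_in C S"
  using assms K_Hom_objs[OF assms] by (auto simp: K_Hom)

lemma chain_Comp_in:
  "f \<in> chain_maps C M N \<Longrightarrow> g \<in> chain_maps C N L \<Longrightarrow> M \<in> cplx_in C S \<Longrightarrow> N \<in> cplx_in C S \<Longrightarrow> L \<in> cplx_in C S \<Longrightarrow>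
   (\<lambda>n. g n \<cdot> f n) \<in> chain_maps C M L"
  by (rule chain_Comp) (simp_all add: cplx_in_C)

lemma category_K: "category K"
proof
  show "f \<in> Arr K \<Longrightarrow> Dom K f \<in> Ob K" "f \<in> Arr K \<Longrightarrow> Cod K f \<in> Ob K" for f by auto
  show "Id K a \<in> Hom K a a" if "a \<in> Ob K" for a
    using that K_in[of a a] chain_Id[of a] by (simp add: K_Id cplx_in_C hclass_full_subcategory)
  show "g \<cdot>\<^bsub>K\<^esub> f \<in> Hom K a c" if f: "f \<in> Hom K a b" and g: "g \<in> Hom K b c" for f g a b c
  proof -
    obtain u where u: "u \<in> chain_maps C a b" "f = hclass C a b u" "a \<in> cplx_in C S" "b \<in> cplx_in C S"
      using K_E[OF f] .
    obtain v where v: "v \<in> chain_maps C b c" "g = hclass C b c v" "c \<in> cplx_in C S" using K_E[OF g] .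
    show ?thesis unfolding u(2) v(2) K_Comp[OF u(3,4) v(3) u(1) v(1)]
      by (rule K_in[OF u(3) v(3) chain_Comp_in[OF u(1) v(1) u(3,4) v(3)]])
  qed
  show "Id K b \<cdot>\<^bsub>K\<^esub> f = f" "f \<cdot>\<^bsub>K\<^esub> Id K a = f" if "f \<in> Hom K a b" for f a b
  proof -
    obtain u where u: "u \<in> chain_maps C a b" "f = hclass C a b u" "a \<in> cplx_in C S" "b \<in> cplx_in C S"
      using K_E[OF \<open>f \<in> Hom K a b\<close>] .
    note [simp] = chain_simps(1-3)[OF u(1) cplx_in_C[OF u(3)] cplx_in_C[OF u(4)]]
    show "Id K b \<cdot>\<^bsub>K\<^esub> f = f" "f \<cdot>\<^bsub>K\<^esub> Id K a = f"
      unfolding u(2) using u chain_Id cplx_in_C by (simp_all add: K_Id K_Comp del: homotopy_category_simps)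
  qed
  show "h \<cdot>\<^bsub>K\<^esub> g \<cdot>\<^bsub>K\<^esub> f = h \<cdot>\<^bsub>K\<^esub> (g \<cdot>\<^bsub>K\<^esub> f)"
    if f: "f \<in> Hom K a b" and g: "g \<in> Hom K b c" and h: "h \<in> Hom K c d" for f g h a b c d
  proof -
    obtain u where u: "u \<in> chain_maps C a b" "f = hclass C a b u" "a \<in> cplx_in C S" "b \<in> cplx_in C S"
      using K_E[OF f] .
    obtain v where v: "v \<in> chain_maps C b c" "g = hclass C b c v" "c \<in> cplx_in C S" using K_E[OF g] .
    obtain w where w: "w \<in> chain_maps C c d" "h = hclass C c d w" "d \<in> cplx_in C S" using K_E[OF h] .
    note [simp] = chain_simps(1-3)[OF u(1) cplx_in_C[OF u(3)] cplx_in_C[OF u(4)]]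
      chain_simps(1-3)[OF v(1) cplx_in_C[OF u(4)] cplx_in_C[OF v(3)]]
      chain_simps(1-3)[OF w(1) cplx_in_C[OF v(3)] cplx_in_C[OF w(3)]]
    show ?thesis
      unfolding u(2) v(2) w(2) K_Comp[OF u(3,4) v(3) u(1) v(1)] K_Comp[OF u(4) v(3) w(3) v(1) w(1)]
        K_Comp[OF u(3,4) w(3) u(1) chain_Comp_in[OF v(1) w(1) u(4) v(3) w(3)]]
        K_Comp[OF u(3) v(3) w(3) chain_Comp_in[OF u(1) v(1) u(3,4) v(3)] w(1)]
      by (simp add: comp_assoc)
  qed
qed

lemma K_isoI:
  assumes M: "M \<in> cplx_in C S" and N: "N \<in> cplx_in C S" and f: "f \<in> chain_maps C M N" and g: "g \<in> chain_maps C N M"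
    and gf: "(\<lambda>n. g n \<cdot> f n, \<lambda>n. Id C (obj M n)) \<in> homotopy_rel C M M"
    and fg: "(\<lambda>n. f n \<cdot> g n, \<lambda>n. Id C (obj N n)) \<in> homotopy_rel C N N"
  shows "iso_arr K (hclass C M N f)"
proof -
  have MC: "M \<in> complexes C" and NC: "N \<in> complexes C" using M N by (simp_all add: cplx_in_C)
  have Arr: "hclass C M N f \<in> Arr K" "Dom K (hclass C M N f) = M" "Cod K (hclass C M N f) = N"
    using K_in[OF M N f] by (simp_all add: Hom_def)
  have "hclass C N M g \<cdot>\<^bsub>K\<^esub> hclass C M N f = Id K M" "hclass C M N f \<cdot>\<^bsub>K\<^esub> hclass C N M g = Id K N"
    unfolding K_Comp[OF M N M f g] K_Comp[OF N M N g f] K_Id[OF M] K_Id[OF N]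
    using gf fg K_eq_iff[OF M M chain_Comp[OF MC NC MC f g]] K_eq_iff[OF N N chain_Comp[OF NC MC NC g f]] by auto
  then show ?thesis unfolding iso_arr_def Arr(2,3) using Arr(1) K_in[OF N M g] by blast
qed

end

section \<open>Fully faithful and essentially surjective functors\<close>

lemma iso_arr_inverse:
  assumes "iso_arr C f" "f \<in> Hom C a b"
  obtains g where "g \<in> Hom C b a" "g \<cdot>\<^bsub>C\<^esub> f = Id C a" "f \<cdot>\<^bsub>C\<^esub> g = Id C b"
  using assms by (auto simp: iso_arr_def Hom_def)

lemma iso_arrI:
  assumes "f \<in> Hom C a b" "g \<in> Hom C b a" "g \<cdot>\<^bsub>C\<^esub> f = Id C a" "f \<cdot>\<^bsub>C\<^esub> g = Id C b"
  shows "iso_arr C f"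
  using assms by (auto simp: iso_arr_def Hom_def)

lemma (in category) iso_arr_Comp:
  assumes f: "f \<in> Hom C a b" "iso_arr C f" and g: "g \<in> Hom C b c" "iso_arr C g"
  shows "iso_arr C (g \<cdot> f)"
proof -
  obtain f' where f': "f' \<in> Hom C b a" "f' \<cdot> f = Id C a" "f \<cdot> f' = Id C b" using iso_arr_inverse[OF f(2,1)] .
  obtain g' where g': "g' \<in> Hom C c b" "g' \<cdot> g = Id C b" "g \<cdot> g' = Id C c" using iso_arr_inverse[OF g(2,1)] .
  have "f' \<cdot> g' \<cdot> (g \<cdot> f) = f' \<cdot> (g' \<cdot> g \<cdot> f)"
    using Comp_assoc[OF Comp_in[OF f(1) g(1)] g'(1) f'(1)] Comp_assoc[OF f(1) g(1) g'(1)] by simp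
  moreover have "g \<cdot> f \<cdot> (f' \<cdot> g') = g \<cdot> (f \<cdot> f' \<cdot> g')"
    using Comp_assoc[OF Comp_in[OF g'(1) f'(1)] f(1) g(1)] Comp_assoc[OF g'(1) f'(1) f(1)] by simp
  ultimately show ?thesis
    using f' g' Id_left[OF f(1)] Id_left[OF g'(1)]
    by (intro iso_arrI[OF Comp_in[OF f(1) g(1)] Comp_in[OF g'(1) f'(1)]]) simp_all
qed

text \<open>The usual quasi-inverse: choose for each \<open>b\<close> an object \<open>Go b\<close>
  with an isomorphism \<open>e b\<close> from \<open>Fo (Go b)\<close> to \<open>b\<close>, and
  conjugate arrows by these. Equations in \<open>S\<close> are verified after applying the faithful
  functor.\<close>

lemma equivalence_functorI:
  assumes S: "category S" and T: "category T" and F: "is_functor S T Fo Fa"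
    and full: "\<And>a b g. a \<in> Ob S \<Longrightarrow> b \<in> Ob S \<Longrightarrow> g \<in> Hom T (Fo a) (Fo b) \<Longrightarrow> \<exists>f \<in> Hom S a b. Fa f = g"
    and faithful: "\<And>a b f f'. f \<in> Hom S a b \<Longrightarrow> f' \<in> Hom S a b \<Longrightarrow> Fa f = Fa f' \<Longrightarrow> f = f'"
    and es: "\<And>b. b \<in> Ob T \<Longrightarrow> \<exists>a \<in> Ob S. \<exists>h \<in> Hom T (Fo a) b. iso_arr T h"
  shows "equivalence_functor S T Fo Fa"
proof -
  interpret S: category S by (rule S)
  interpret T: category T by (rule T)
  have S_Ob: "a \<in> Ob S" "b \<in> Ob S" if "f \<in> Hom S a b" for f a b
    using that S.Dom_in S.Cod_in by (auto simp: Hom_def)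
  have T_Ob: "a \<in> Ob T" "b \<in> Ob T" if "f \<in> Hom T a b" for f a b
    using that T.Dom_in T.Cod_in by (auto simp: Hom_def)
  have F_Id: "Fo a \<in> Ob T" "Fa (Id S a) = Id T (Fo a)" if "a \<in> Ob S" for a
    using F that by (simp_all add: is_functor_def)
  have F_in: "Fa f \<in> Hom T (Fo a) (Fo b)" if "f \<in> Hom S a b" for f a b
    using F that S_Ob[OF that] by (simp add: is_functor_def)
  have F_Comp: "Fa (g \<cdot>\<^bsub>S\<^esub> f) = Fa g \<cdot>\<^bsub>T\<^esub> Fa f" if "f \<in> Hom S a b" "g \<in> Hom S b c" for f g a b c
    using F that S_Ob[OF that(1)] S_Ob[OF that(2)] unfolding is_functor_def by blast
  have "\<forall>b. \<exists>a h h'. b \<in> Ob T \<longrightarrow> a \<in> Ob S \<and> h \<in> Hom T (Fo a) b \<and> h' \<in> Hom T b (Fo a) \<and>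
      h' \<cdot>\<^bsub>T\<^esub> h = Id T (Fo a) \<and> h \<cdot>\<^bsub>T\<^esub> h' = Id T b"
    using es by (metis iso_arr_inverse)
  then obtain Go e e' where Go: "\<And>b. b \<in> Ob T \<Longrightarrow> Go b \<in> Ob S"
      and e: "\<And>b. b \<in> Ob T \<Longrightarrow> e b \<in> Hom T (Fo (Go b)) b"
      and e': "\<And>b. b \<in> Ob T \<Longrightarrow> e' b \<in> Hom T b (Fo (Go b))"
      and e'e: "\<And>b. b \<in> Ob T \<Longrightarrow> e' b \<cdot>\<^bsub>T\<^esub> e b = Id T (Fo (Go b))"
      and ee': "\<And>b. b \<in> Ob T \<Longrightarrow> e b \<cdot>\<^bsub>T\<^esub> e' b = Id T b"
    by metis
  have cancel: "e b \<cdot>\<^bsub>T\<^esub> (e' b \<cdot>\<^bsub>T\<^esub> x) = x" if "x \<in> Hom T a b" for a b x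
    using T.Comp_assoc[OF that e' e] T_Ob[OF that] ee' T.Id_left[OF that] by metis
  have cancel': "e' b \<cdot>\<^bsub>T\<^esub> (e b \<cdot>\<^bsub>T\<^esub> x) = x" if "x \<in> Hom T a (Fo (Go b))" "b \<in> Ob T" for a b x
    using T.Comp_assoc[OF that(1) e e'] that(2) e'e T.Id_left[OF that(1)] by metis
  \<comment> \<open>One choice per arrow suffices, since \<open>g\<close> determines its source and
    target.\<close>
  have "\<forall>g. \<exists>f. \<forall>b b'. g \<in> Hom T b b' \<longrightarrow> f \<in> Hom S (Go b) (Go b') \<and> Fa f = e' b' \<cdot>\<^bsub>T\<^esub> (g \<cdot>\<^bsub>T\<^esub> e b)"
  proof
    fix g
    show "\<exists>f. \<forall>b b'. g \<in> Hom T b b' \<longrightarrow> f \<in> Hom S (Go b) (Go b') \<and> Fa f = e' b' \<cdot>\<^bsub>T\<^esub> (g \<cdot>\<^bsub>T\<^esub> e b)"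
    proof (cases "g \<in> Arr T")
      case True
      define b where "b = Dom T g"
      define b' where "b' = Cod T g"
      have g: "g \<in> Hom T b b'" and Ob: "b \<in> Ob T" "b' \<in> Ob T"
        using True T.Dom_in T.Cod_in by (simp_all add: Hom_def b_def b'_def)
      have "e' b' \<cdot>\<^bsub>T\<^esub> (g \<cdot>\<^bsub>T\<^esub> e b) \<in> Hom T (Fo (Go b)) (Fo (Go b'))"
        using T.Comp_in[OF T.Comp_in[OF e[OF Ob(1)] g] e'[OF Ob(2)]] .
      from full[OF Go[OF Ob(1)] Go[OF Ob(2)] this] show ?thesis by (auto simp: Hom_def b_def b'_def)
    qed (auto simp: Hom_def)
  qed
  then obtain Ga where Ga: "\<And>g b b'. g \<in> Hom T b b' \<Longrightarrow> Ga g \<in> Hom S (Go b) (Go b')"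
      and FGa: "\<And>g b b'. g \<in> Hom T b b' \<Longrightarrow> Fa (Ga g) = e' b' \<cdot>\<^bsub>T\<^esub> (g \<cdot>\<^bsub>T\<^esub> e b)"
    by metis
  have G: "is_functor T S Go Ga"
    unfolding is_functor_def
  proof (intro conjI ballI)
    fix b assume b: "b \<in> Ob T"
    show "Go b \<in> Ob S" using Go[OF b] .
    show "Ga (Id T b) = Id S (Go b)"
      by (rule faithful[OF Ga[OF T.Id_in[OF b]] S.Id_in[OF Go[OF b]]])
        (simp add: FGa[OF T.Id_in[OF b]] F_Id[OF Go[OF b]] T.Id_left[OF e[OF b]] e'e[OF b])
  next
    show "Ga g \<in> Hom S (Go a) (Go b)" if "g \<in> Hom T a b" for a b g using Ga[OF that] .
  next
    fix a b c f g assume f: "f \<in> Hom T a b" and g: "g \<in> Hom T b c"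
    note Ob = T_Ob[OF f] T_Ob[OF g]
    show "Ga (g \<cdot>\<^bsub>T\<^esub> f) = Ga g \<cdot>\<^bsub>S\<^esub> Ga f"
    proof (rule faithful[OF Ga[OF T.Comp_in[OF f g]] S.Comp_in[OF Ga[OF f] Ga[OF g]]])
      have fe: "f \<cdot>\<^bsub>T\<^esub> e a \<in> Hom T (Fo (Go a)) b" using T.Comp_in[OF e[OF Ob(1)] f] .
      have "Fa (Ga g \<cdot>\<^bsub>S\<^esub> Ga f) = e' c \<cdot>\<^bsub>T\<^esub> (g \<cdot>\<^bsub>T\<^esub> e b) \<cdot>\<^bsub>T\<^esub> (e' b \<cdot>\<^bsub>T\<^esub> (f \<cdot>\<^bsub>T\<^esub> e a))"
        by (simp add: F_Comp[OF Ga[OF f] Ga[OF g]] FGa[OF f] FGa[OF g])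
      also have "\<dots> = e' c \<cdot>\<^bsub>T\<^esub> (g \<cdot>\<^bsub>T\<^esub> (e b \<cdot>\<^bsub>T\<^esub> (e' b \<cdot>\<^bsub>T\<^esub> (f \<cdot>\<^bsub>T\<^esub> e a))))"
        using T.Comp_assoc[OF T.Comp_in[OF fe e'[OF Ob(2)]] T.Comp_in[OF e[OF Ob(2)] g] e'[OF Ob(4)]]
          T.Comp_assoc[OF T.Comp_in[OF fe e'[OF Ob(2)]] e[OF Ob(2)] g] by simp
      also have "\<dots> = Fa (Ga (g \<cdot>\<^bsub>T\<^esub> f))"
        by (simp add: cancel[OF fe] FGa[OF T.Comp_in[OF f g]] T.Comp_assoc[OF e[OF Ob(1)] f g])
      finally show "Fa (Ga (g \<cdot>\<^bsub>T\<^esub> f)) = Fa (Ga g \<cdot>\<^bsub>S\<^esub> Ga f)" by (rule sym)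
    qed
  qed
  \<comment> \<open>The unit at \<open>a\<close> is a preimage under \<open>Fa\<close> of the
    inverse of \<open>e (Fo a)\<close>.\<close>
  have "\<forall>a. \<exists>h. a \<in> Ob S \<longrightarrow> h \<in> Hom S a (Go (Fo a)) \<and> Fa h = e' (Fo a)"
    using full Go F_Id(1) e' by metis
  then obtain \<eta> where \<eta>: "\<And>a. a \<in> Ob S \<Longrightarrow> \<eta> a \<in> Hom S a (Go (Fo a))"
      and F\<eta>: "\<And>a. a \<in> Ob S \<Longrightarrow> Fa (\<eta> a) = e' (Fo a)"
    by metis
  have "natural_iso S S (\<lambda>a. a) (\<lambda>f. f) (Go \<circ> Fo) (Ga \<circ> Fa) \<eta>"
    unfolding natural_iso_def
  proof (intro conjI ballI)
    fix a assume a: "a \<in> Ob S"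
    note Fa_a = F_Id(1)[OF a]
    show "\<eta> a \<in> Hom S a ((Go \<circ> Fo) a)" using \<eta>[OF a] by simp
    obtain h where h: "h \<in> Hom S (Go (Fo a)) a" "Fa h = e (Fo a)"
      using full[OF Go[OF Fa_a] a e[OF Fa_a]] by blast
    show "iso_arr S (\<eta> a)"
    proof (rule iso_arrI[OF \<eta>[OF a] h(1)])
      show "h \<cdot>\<^bsub>S\<^esub> \<eta> a = Id S a"
        by (rule faithful[OF S.Comp_in[OF \<eta>[OF a] h(1)] S.Id_in[OF a]])
          (simp add: F_Comp[OF \<eta>[OF a] h(1)] h(2) F\<eta>[OF a] ee'[OF Fa_a] F_Id[OF a])
      show "\<eta> a \<cdot>\<^bsub>S\<^esub> h = Id S (Go (Fo a))"
        by (rule faithful[OF S.Comp_in[OF h(1) \<eta>[OF a]] S.Id_in[OF Go[OF Fa_a]]])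
          (simp add: F_Comp[OF h(1) \<eta>[OF a]] h(2) F\<eta>[OF a] e'e[OF Fa_a] F_Id[OF Go[OF Fa_a]])
    qed
  next
    fix a b f assume f: "f \<in> Hom S a b"
    note Ob = S_Ob[OF f]
    note FOb = F_Id(1)[OF Ob(1)] F_Id(1)[OF Ob(2)]
    have GF: "Ga (Fa f) \<in> Hom S (Go (Fo a)) (Go (Fo b))" using Ga[OF F_in[OF f]] .
    have "Fa (Ga (Fa f) \<cdot>\<^bsub>S\<^esub> \<eta> a) = e' (Fo b) \<cdot>\<^bsub>T\<^esub> (Fa f \<cdot>\<^bsub>T\<^esub> e (Fo a)) \<cdot>\<^bsub>T\<^esub> e' (Fo a)"
      by (simp add: F_Comp[OF \<eta>[OF Ob(1)] GF] F\<eta>[OF Ob(1)] FGa[OF F_in[OF f]])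
    also have "\<dots> = e' (Fo b) \<cdot>\<^bsub>T\<^esub> Fa f"
      using T.Comp_assoc[OF e'[OF FOb(1)] T.Comp_in[OF e[OF FOb(1)] F_in[OF f]] e'[OF FOb(2)]]
        T.Comp_assoc[OF e'[OF FOb(1)] e[OF FOb(1)] F_in[OF f]] ee'[OF FOb(1)] T.Id_right[OF F_in[OF f]] by simp
    also have "\<dots> = Fa (\<eta> b \<cdot>\<^bsub>S\<^esub> f)" by (simp add: F_Comp[OF f \<eta>[OF Ob(2)]] F\<eta>[OF Ob(2)])
    finally show "\<eta> b \<cdot>\<^bsub>S\<^esub> f = (Ga \<circ> Fa) f \<cdot>\<^bsub>S\<^esub> \<eta> a"
      using faithful[OF S.Comp_in[OF f \<eta>[OF Ob(2)]] S.Comp_in[OF \<eta>[OF Ob(1)] GF]] by simp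
  qed
  moreover have "natural_iso T T (Fo \<circ> Go) (Fa \<circ> Ga) (\<lambda>a. a) (\<lambda>f. f) e"
    unfolding natural_iso_def
  proof (intro conjI ballI)
    fix b assume b: "b \<in> Ob T"
    show "e b \<in> Hom T ((Fo \<circ> Go) b) b" using e[OF b] by simp
    show "iso_arr T (e b)" by (rule iso_arrI[OF e[OF b] e'[OF b] e'e[OF b] ee'[OF b]])
  next
    fix a b g assume g: "g \<in> Hom T a b"
    show "e b \<cdot>\<^bsub>T\<^esub> (Fa \<circ> Ga) g = g \<cdot>\<^bsub>T\<^esub> e a"
      using cancel[OF T.Comp_in[OF e[OF T_Ob(1)[OF g]] g]] by (simp add: FGa[OF g])
  qed
  ultimately show ?thesis using F G unfolding equivalence_functor_def by blast
qed

section \<open>Shifts and mapping cones of extending maps\<close>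

context preadditive_category
begin

text \<open>
  The extension property with respect to the shifted complex \<open>Q[-1]\<close>, spelled out in terms of \<open>Q\<close>.
\<close>

lemma null_extending_unshift:
  assumes ext: "null_extending C \<Y> M T j" and j: "j \<in> chain_maps C M T"
    and M: "M \<in> complexes C" and T: "T \<in> complexes C" and Q: "Q \<in> cplx_in C \<Y>"
    and v: "\<And>n. v n \<in> Hom C (obj T (n + 1)) (obj Q n)"
      "\<And>n. diff Q n \<cdot> v n = neg C (v (n + 1) \<cdot> diff T (n + 1))"
    and s: "\<And>n. s n \<in> Hom C (obj M (n + 2)) (obj Q n)"
      "\<And>n. v (n + 1) \<cdot> j (n + 2) = diff Q n \<cdot> s n \<boxminus> s (n + 1) \<cdot> diff M (n + 2)"
  shows "\<exists>t. \<forall>n. t n \<in> Hom C (obj T (n + 2)) (obj Q n) \<and> t n \<cdot> j (n + 2) = s n \<and>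
    v (n + 1) = diff Q n \<cdot> t n \<boxminus> t (n + 1) \<cdot> diff T (n + 2)"
proof -
  have QC: "Q \<in> complexes C" and QY: "obj Q n \<in> \<Y>" for n using Q by (simp_all add: cplx_in_def)
  note [simp] = cplx_simps[OF M] cplx_simps[OF T] cplx_simps[OF QC] chain_simps(1-3)[OF j M T]
  have [simp]: "v n \<in> Arr C" "Dom C (v n) = obj T (n + 1)" "Cod C (v n) = obj Q n"
    "s n \<in> Arr C" "Dom C (s n) = obj M (n + 2)" "Cod C (s n) = obj Q n" for n
    using v(1)[of n] s(1)[of n] by (simp_all add: Hom_iff)
  \<comment> \<open>This is \<open>Q[-1]\<close>, including the sign of its differential.\<close>
  define Q' where "Q' = \<lparr>obj = (\<lambda>n. obj Q (n - 1)), diff = (\<lambda>n. neg C (diff Q (n - 1)))\<rparr>"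
  have [simp]: "obj Q' n = obj Q (n - 1)" "diff Q' n = neg C (diff Q (n - 1))" for n by (simp_all add: Q'_def)
  have Q'C: "Q' \<in> complexes C"
    unfolding complexes_def
  proof (intro CollectI allI conjI)
    fix n
    have "diff Q n \<cdot> diff Q (n - 1) = Zero C (obj Q (n - 1)) (obj Q (n + 1))" by simp
    then show "diff Q' (n + 1) \<cdot> diff Q' n = Zero C (obj Q' n) (obj Q' (n + 1 + 1))"
      by (simp add: arith)
  qed (simp_all add: Hom_iff)
  then have Q': "Q' \<in> cplx_in C \<Y>" using QY by (simp add: cplx_in_def)
  have u: "(\<lambda>n. v (n - 1)) \<in> chain_maps C T Q'"
  proof (rule chain_mapsI)
    fix n show "diff Q' n \<cdot> v (n - 1) = v (n + 1 - 1) \<cdot> diff T n"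
      using v(2)[of "n - 1"] by (simp add: arith)
  qed simp_all
  \<comment> \<open>The sign of \<open>Q'\<close>, together with the negation of \<open>s\<close>,
    turns the difference in the hypothesis into the sum that a null homotopy requires.\<close>
  have "null_homotopy C M Q' (\<lambda>n. v (n - 1) \<cdot> j n) (\<lambda>n. neg C (s (n - 1)))"
  proof (rule null_homotopyI)
    fix n show "v (n + 1 - 1) \<cdot> j (n + 1) = diff Q' n \<cdot> neg C (s (n - 1)) \<boxplus> neg C (s (n + 1 - 1)) \<cdot> diff M (n + 1)"
      using s(2)[of "n - 1"] by (simp add: arith)
  qed simp_all
  from null_extendingD[OF ext Q' u this] obtain \<tau> where \<tau>: "null_homotopy C T Q' (\<lambda>n. v (n - 1)) \<tau>"
      and \<tau>j: "\<And>n. \<tau> n \<cdot> j (n + 1) = neg C (s (n - 1))" by blast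
  note [simp] = null_simps(1-3)[OF \<tau>]
  show ?thesis
  proof (intro exI[where x = "\<lambda>n. neg C (\<tau> (n + 1))"] allI conjI)
    fix n
    show "neg C (\<tau> (n + 1)) \<in> Hom C (obj T (n + 2)) (obj Q n)" by (simp add: Hom_iff)
    show "neg C (\<tau> (n + 1)) \<cdot> j (n + 2) = s n" using \<tau>j[of "n + 1"] by (simp add: arith)
    show "v (n + 1) = diff Q n \<cdot> neg C (\<tau> (n + 1)) \<boxminus> neg C (\<tau> (n + 1 + 1)) \<cdot> diff T (n + 2)"
      using null_simps(4)[OF \<tau>, of "n + 2" "n + 1"] by (simp add: arith)
  qed
qed

text \<open>A map from \<open>T[1]\<close> to \<open>Q\<close> is a map from \<open>T\<close> to
  \<open>Q[-1]\<close>. This makes the shift of \<open>Fo P\<close> as good a target for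
  \<open>P[1]\<close> as \<open>Fo\<close> of \<open>P[1]\<close>, so that the two can be
  compared.\<close>

lemma null_extending_shift:
  assumes ext: "null_extending C \<Y> M T j" and j: "j \<in> chain_maps C M T"
    and M: "M \<in> complexes C" and T: "T \<in> complexes C"
  shows "null_extending C \<Y> (shift_cplx C M) (shift_cplx C T) (\<lambda>n. j (n + 1))"
  unfolding null_extending_def
proof (intro ballI allI impI)
  fix Q u \<sigma> assume Q: "Q \<in> cplx_in C \<Y>" and u: "u \<in> chain_maps C (shift_cplx C T) Q"
    and \<sigma>: "null_homotopy C (shift_cplx C M) Q (\<lambda>n. u n \<cdot> j (n + 1)) \<sigma>"
  have QC: "Q \<in> complexes C" using Q by (simp add: cplx_in_def)
  note [simp] = cplx_simps[OF M] cplx_simps[OF T] cplx_simps[OF QC] chain_simps(1-3)[OF j M T]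
    chain_simps(1-3)[OF u shift_cplx_complexes[OF T] QC, simplified] null_simps(1-3)[OF \<sigma>, simplified]
  have "\<exists>t. \<forall>n. t n \<in> Hom C (obj T (n + 2)) (obj Q n) \<and> t n \<cdot> j (n + 2) = \<sigma> n \<and>
      u (n + 1) = diff Q n \<cdot> t n \<boxminus> t (n + 1) \<cdot> diff T (n + 2)"
  proof (rule null_extending_unshift[OF ext j M T Q])
    fix n
    show "diff Q n \<cdot> u n = neg C (u (n + 1) \<cdot> diff T (n + 1))"
      using chain_simps(4)[OF u shift_cplx_complexes[OF T] QC, of n] by (simp add: arith)
    show "u (n + 1) \<cdot> j (n + 2) = diff Q n \<cdot> \<sigma> n \<boxminus> \<sigma> (n + 1) \<cdot> diff M (n + 2)"
      using null_simps(4)[OF \<sigma>, of "n + 1" n] by (simp add: arith)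
  qed (simp_all add: Hom_iff)
  then obtain t where t: "\<And>n. t n \<in> Arr C" "\<And>n. Dom C (t n) = obj T (n + 2)" "\<And>n. Cod C (t n) = obj Q n"
      "\<And>n. t n \<cdot> j (n + 2) = \<sigma> n" "\<And>n. u (n + 1) = diff Q n \<cdot> t n \<boxminus> t (n + 1) \<cdot> diff T (n + 2)"
    unfolding Hom_iff by blast
  have "null_homotopy C (shift_cplx C T) Q u t"
    by (rule null_homotopyI) (simp_all add: t(1-3,5) arith)
  then show "\<exists>\<tau>. null_homotopy C (shift_cplx C T) Q u \<tau> \<and> (\<forall>n. \<tau> n \<cdot> j (n + 1 + 1) = \<sigma> n)"
    using t(4) by auto
qed

lemma null_extending_extend:
  assumes ext: "null_extending C \<Y> M T j" and j: "j \<in> chain_maps C M T"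
    and M: "M \<in> complexes C" and T: "T \<in> complexes C" and Q: "Q \<in> cplx_in C \<Y>" and f: "f \<in> chain_maps C M Q"
  shows "\<exists>g \<in> chain_maps C T Q. \<forall>n. g n \<cdot> j n = f n"
proof -
  have QC: "Q \<in> complexes C" and QY: "obj Q n \<in> \<Y>" for n using Q by (simp_all add: cplx_in_def)
  note [simp] = cplx_simps[OF M] cplx_simps[OF T] cplx_simps[OF QC] chain_simps(1-3)[OF j M T]
    chain_simps(1-3)[OF f M QC]
  have Q': "shift_cplx C Q \<in> cplx_in C \<Y>" using QY shift_cplx_complexes[OF QC] by (simp add: cplx_in_def)
  have "(\<lambda>n. Zero C (obj T n) (obj (shift_cplx C Q) n)) \<in> chain_maps C T (shift_cplx C Q)"
    by (rule chain_Zero[OF T shift_cplx_complexes[OF QC]])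
  \<comment> \<open>\<open>f (n + 1)\<close> is the component ending in degree \<open>n\<close> of
    \<open>Q[1]\<close>; the chain map equation of \<open>f\<close> is the homotopy equation for
    zero because of the sign in \<open>Q[1]\<close>.\<close>
  moreover have "null_homotopy C M (shift_cplx C Q) (\<lambda>n. Zero C (obj T n) (obj (shift_cplx C Q) n) \<cdot> j n) (\<lambda>n. f (n + 1))"
    by (rule null_homotopyI) (simp_all add: chain_simps(4)[OF f M QC] arith)
  ultimately obtain \<tau> where \<tau>: "null_homotopy C T (shift_cplx C Q) (\<lambda>n. Zero C (obj T n) (obj (shift_cplx C Q) n)) \<tau>"
      and \<tau>j: "\<And>n. \<tau> n \<cdot> j (n + 1) = f (n + 1)"
    using null_extendingD[OF ext Q'] by blast
  have \<tau>_arr [simp]: "\<tau> n \<in> Arr C" "Dom C (\<tau> n) = obj T (n + 1)" "Cod C (\<tau> n) = obj Q (n + 1)" for n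
    using null_simps(1-3)[OF \<tau>, of n] by simp_all
  have "(\<lambda>n. \<tau> (n - 1)) \<in> chain_maps C T Q"
  proof (rule chain_mapsI)
    fix n
    show "diff Q n \<cdot> \<tau> (n - 1) = \<tau> (n + 1 - 1) \<cdot> diff T n"
      using null_simps(4)[OF \<tau>, of n "n - 1"] by (simp add: arith)
  qed simp_all
  moreover have "\<tau> (n - 1) \<cdot> j n = f n" for n using \<tau>j[of "n - 1"] by simp
  ultimately show ?thesis by (intro bexI[where x = "\<lambda>n. \<tau> (n - 1)"]) simp_all
qed

text \<open>The homotopy between the restrictions is a null homotopy of the restricted difference,
  and it extends.\<close>

lemma null_extending_unique:
  assumes ext: "null_extending C \<Y> M T j" and j: "j \<in> chain_maps C M T"
    and M: "M \<in> complexes C" and T: "T \<in> complexes C" and Q: "Q \<in> cplx_in C \<Y>"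
    and g: "g \<in> chain_maps C T Q" and g': "g' \<in> chain_maps C T Q"
    and rel: "(\<lambda>n. g n \<cdot> j n, \<lambda>n. g' n \<cdot> j n) \<in> homotopy_rel C M Q"
  shows "(g, g') \<in> homotopy_rel C T Q"
proof -
  have QC: "Q \<in> complexes C" using Q by (simp add: cplx_in_def)
  note [simp] = chain_simps(1-3)[OF j M T] chain_simps(1-3)[OF g T QC] chain_simps(1-3)[OF g' T QC]
  obtain \<sigma> where "null_homotopy C M Q (\<lambda>n. g n \<cdot> j n \<boxminus> g' n \<cdot> j n) \<sigma>"
    using rel by (auto simp: homotopy_rel_iff[OF M QC])
  then have "null_homotopy C M Q (\<lambda>n. (g n \<boxminus> g' n) \<cdot> j n) \<sigma>" by (simp add: sub_comp)
  from null_extendingD[OF ext Q chain_sub[OF T QC g g'] this]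
  obtain \<tau> where "null_homotopy C T Q (\<lambda>n. g n \<boxminus> g' n) \<tau>" by blast
  then show ?thesis by (rule homotopy_relI[OF T QC g g'])
qed

section \<open>Mapping cones\<close>

lemma mapping_cone_simps:
  assumes cone: "mapping_cone C M M' f Z i1 i2 p1 p2" and M: "M \<in> complexes C" and M': "M' \<in> complexes C"
    and f: "f \<in> chain_maps C M M'"
  shows "biproduct C (obj M (n + 1)) (obj M' n) (obj Z n) (i1 n) (i2 n) (p1 n) (p2 n)"
    "Z \<in> complexes C" "i2 \<in> chain_maps C M' Z" "p1 \<in> chain_maps C Z (shift_cplx C M)"
    "diff Z n \<cdot> i1 n = i2 (n + 1) \<cdot> f (n + 1) \<boxminus> i1 (n + 1) \<cdot> diff M (n + 1)"
    "diff Z n \<cdot> i2 n = i2 (n + 1) \<cdot> diff M' n"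
proof -
  show bp: "biproduct C (obj M (n + 1)) (obj M' n) (obj Z n) (i1 n) (i2 n) (p1 n) (p2 n)" for n
    using cone by (simp add: mapping_cone_def)
  have d: "diff Z n = i1 (n + 1) \<cdot> (neg C (diff M (n + 1)) \<cdot> p1 n)
      \<boxplus> i2 (n + 1) \<cdot> (f (n + 1) \<cdot> p1 n \<boxplus> diff M' n \<cdot> p2 n)" for n
    using cone unfolding mapping_cone_def by blast
  note [simp] = cplx_simps[OF M] cplx_simps[OF M'] chain_simps(1-3)[OF f M M'] biproduct_simps[OF bp]
  have [simp]: "diff Z n \<in> Arr C" "Dom C (diff Z n) = obj Z n" "Cod C (diff Z n) = obj Z (n + 1)" for n
    unfolding d by simp_all
  have di1: "diff Z n \<cdot> i1 n = i2 (n + 1) \<cdot> f (n + 1) \<boxminus> i1 (n + 1) \<cdot> diff M (n + 1)"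
    and di2: "diff Z n \<cdot> i2 n = i2 (n + 1) \<cdot> diff M' n" for n
    unfolding d by (simp_all add: arith)
  then show "diff Z n \<cdot> i1 n = i2 (n + 1) \<cdot> f (n + 1) \<boxminus> i1 (n + 1) \<cdot> diff M (n + 1)"
    "diff Z n \<cdot> i2 n = i2 (n + 1) \<cdot> diff M' n" .
  have di1': "diff Z m \<cdot> (i1 m \<cdot> x) = i2 (m + 1) \<cdot> (f (m + 1) \<cdot> x) \<boxminus> i1 (m + 1) \<cdot> (diff M (m + 1) \<cdot> x)"
    if "x \<in> Arr C" "Cod C x = obj M (m + 1)" for x m
    using comp_eq_comp[OF di1, where x = x] that by (simp add: distrib)
  have di2': "diff Z m \<cdot> (i2 m \<cdot> x) = i2 (m + 1) \<cdot> (diff M' m \<cdot> x)" if "x \<in> Arr C" "Cod C x = obj M' m" for x m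
    using comp_eq_comp[OF di2, where x = x] that by (simp add: distrib)
  have "diff Z (n + 1) \<cdot> diff Z n = Zero C (obj Z n) (obj Z (n + 2))" for n
    by (rule biproduct_eq_out[OF bp[of n]])
      (simp_all add: arith di1 di2 di1' di2' chain_simps(4)[OF f M M'])
  then show Z: "Z \<in> complexes C" by (simp add: complexes_def Hom_iff)
  show "i2 \<in> chain_maps C M' Z" by (rule chain_mapsI) (simp_all add: di2)
  show "p1 \<in> chain_maps C Z (shift_cplx C M)" by (rule chain_mapsI) (simp_all add: d arith)
qed

text \<open>\<open>M'\<close> is a subcomplex of the cone with quotient \<open>M[1]\<close>. A
  homotopy on the cone is therefore extended first along \<open>j'\<close> and then, after a
  correction by this first extension, along the shift of \<open>j\<close>. Strict commutativity of
  the square makes the sum of \<open>j[1]\<close> and \<open>j'\<close> a chain map without a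
  homotopy entry in its matrix.\<close>

lemma null_extending_cone:
  assumes M: "M \<in> complexes C" and M': "M' \<in> complexes C" and T: "T \<in> complexes C" and T': "T' \<in> complexes C"
    and j: "j \<in> chain_maps C M T" and j': "j' \<in> chain_maps C M' T'"
    and ext: "null_extending C \<Y> M T j" and ext': "null_extending C \<Y> M' T' j'"
    and f: "f \<in> chain_maps C M M'" and g: "g \<in> chain_maps C T T'" and gj: "\<And>n. g n \<cdot> j n = j' n \<cdot> f n"
    and Z: "mapping_cone C M M' f Z i1 i2 p1 p2" and W: "mapping_cone C T T' g W k1 k2 r1 r2"
  shows "(\<lambda>n. k1 n \<cdot> (j (n + 1) \<cdot> p1 n) \<boxplus> k2 n \<cdot> (j' n \<cdot> p2 n)) \<in> chain_maps C Z W" (is "?k \<in> _")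
    and "null_extending C \<Y> Z W (\<lambda>n. k1 n \<cdot> (j (n + 1) \<cdot> p1 n) \<boxplus> k2 n \<cdot> (j' n \<cdot> p2 n))"
proof -
  note bp = mapping_cone_simps(1)[OF Z M M' f] and ZC = mapping_cone_simps(2)[OF Z M M' f]
    and bp' = mapping_cone_simps(1)[OF W T T' g] and WC = mapping_cone_simps(2)[OF W T T' g]
  note [simp] = cplx_simps[OF M] cplx_simps[OF M'] cplx_simps[OF T] cplx_simps[OF T'] cplx_simps[OF ZC] cplx_simps[OF WC]
    chain_simps(1-3)[OF f M M'] chain_simps(1-3)[OF g T T'] chain_simps(1-3)[OF j M T] chain_simps(1-3)[OF j' M' T']
    biproduct_simps[OF bp] biproduct_simps[OF bp']
  have gj': "g n \<cdot> (j n \<cdot> x) = j' n \<cdot> (f n \<cdot> x)" if "x \<in> Arr C" "Cod C x = obj M n" for n x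
    using comp_eq_comp[OF gj[of n], where x = x] that by (simp add: comp_assoc)
  have dZ: "diff Z n \<cdot> (i1 n \<cdot> x) = i2 (n + 1) \<cdot> (f (n + 1) \<cdot> x) \<boxminus> i1 (n + 1) \<cdot> (diff M (n + 1) \<cdot> x)"
    if "x \<in> Arr C" "Cod C x = obj M (n + 1)" for x n
    using comp_eq_comp[OF mapping_cone_simps(5)[OF Z M M' f], where x = x] that by (simp add: distrib)
  have dW: "diff W n \<cdot> (k1 n \<cdot> x) = k2 (n + 1) \<cdot> (g (n + 1) \<cdot> x) \<boxminus> k1 (n + 1) \<cdot> (diff T (n + 1) \<cdot> x)"
    if "x \<in> Arr C" "Cod C x = obj T (n + 1)" for x n
    using comp_eq_comp[OF mapping_cone_simps(5)[OF W T T' g], where x = x] that by (simp add: distrib)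
  have dW2: "diff W n \<cdot> (k2 n \<cdot> x) = k2 (n + 1) \<cdot> (diff T' n \<cdot> x)" if "x \<in> Arr C" "Cod C x = obj T' n" for x n
    using comp_eq_comp[OF mapping_cone_simps(6)[OF W T T' g], where x = x] that by (simp add: distrib)
  note dZ1 = mapping_cone_simps(5,6)[OF Z M M' f] and dW1 = mapping_cone_simps(5,6)[OF W T T' g]
  note [simp] = chain_simps(4,5)[OF j M T] chain_simps(4,5)[OF j' M' T']
  show k: "?k \<in> chain_maps C Z W"
  proof (rule chain_mapsI)
    fix n
    show "diff W n \<cdot> ?k n = ?k (n + 1) \<cdot> diff Z n"
      by (rule biproduct_eq_out[OF bp[of n]]) (simp_all add: arith dW dW2 dZ1 gj gj')
  qed simp_all
  show "null_extending C \<Y> Z W ?k"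
    unfolding null_extending_def
  proof (intro ballI allI impI)
    fix Q u \<sigma> assume Q: "Q \<in> cplx_in C \<Y>" and u: "u \<in> chain_maps C W Q"
      and \<sigma>: "null_homotopy C Z Q (\<lambda>n. u n \<cdot> ?k n) \<sigma>"
    have QC: "Q \<in> complexes C" using Q by (simp add: cplx_in_def)
    note [simp] = cplx_simps[OF QC] chain_simps(1-3)[OF u WC QC] null_simps(1-3)[OF \<sigma>]
    have du: "diff Q n \<cdot> (u n \<cdot> x) = u (n + 1) \<cdot> (diff W n \<cdot> x)" if "x \<in> Arr C" "Cod C x = obj W n" for x n
      using chain_simps(5)[OF u WC QC] that by simp
    have uk: "u (n + 1) \<cdot> (?k (n + 1) \<cdot> x) = diff Q n \<cdot> (\<sigma> n \<cdot> x) \<boxplus> \<sigma> (n + 1) \<cdot> (diff Z (n + 1) \<cdot> x)"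
      if "x \<in> Arr C" "Cod C x = obj Z (n + 1)" for x n
    proof -
      have "u (n + 1) \<cdot> (?k (n + 1) \<cdot> x) = (u (n + 1) \<cdot> ?k (n + 1)) \<cdot> x"
        using that by (simp add: comp_assoc)
      also have "\<dots> = (diff Q n \<cdot> \<sigma> n \<boxplus> \<sigma> (n + 1) \<cdot> diff Z (n + 1)) \<cdot> x"
        using null_simps(4)[OF \<sigma>, of "n + 1" n] by simp
      finally show ?thesis using that by (simp add: distrib)
    qed
    \<comment> \<open>The restriction of \<open>\<sigma>\<close> to the subcomplex
      \<open>M'\<close>.\<close>
    have "null_homotopy C M' Q (\<lambda>n. u n \<cdot> k2 n \<cdot> j' n) (\<lambda>n. \<sigma> n \<cdot> i2 (n + 1))"
    proof (rule null_homotopyI)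
      fix n
      show "u (n + 1) \<cdot> k2 (n + 1) \<cdot> j' (n + 1) =
          diff Q n \<cdot> (\<sigma> n \<cdot> i2 (n + 1)) \<boxplus> \<sigma> (n + 1) \<cdot> i2 (n + 1 + 1) \<cdot> diff M' (n + 1)"
        using uk[of "i2 (n + 1)" n] by (simp add: distrib dZ1)
    qed simp_all
    moreover have "(\<lambda>n. u n \<cdot> k2 n) \<in> chain_maps C T' Q"
      by (rule chain_Comp[OF T' WC QC mapping_cone_simps(3)[OF W T T' g] u])
    ultimately obtain t2 where t2: "null_homotopy C T' Q (\<lambda>n. u n \<cdot> k2 n) t2"
        and t2j: "\<And>n. t2 n \<cdot> j' (n + 1) = \<sigma> n \<cdot> i2 (n + 1)"
      using null_extendingD[OF ext' Q] by blast
    note [simp] = null_simps(1-3)[OF t2]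
    have t2j': "t2 n \<cdot> (j' m \<cdot> x) = \<sigma> n \<cdot> (i2 m \<cdot> x)" if "m = n + 1" "x \<in> Arr C" "Cod C x = obj M' m" for m n x
      using comp_eq_comp[OF t2j[of n], where x = x] that by (simp add: comp_assoc)
    have uk2: "u m \<cdot> k2 m = diff Q n \<cdot> t2 n \<boxplus> t2 m \<cdot> diff T' m" if "m = n + 1" for m n
      using null_simps(4)[OF t2 that] .
    have uk2': "u m \<cdot> (k2 m \<cdot> x) = diff Q n \<cdot> (t2 n \<cdot> x) \<boxplus> t2 m \<cdot> (diff T' m \<cdot> x)"
      if "m = n + 1" "x \<in> Arr C" "Cod C x = obj T' m" for m n x
      using comp_eq_comp[OF uk2[OF that(1)], where x = x] that by (simp add: distrib)
    have gd: "diff T' n \<cdot> g n = g (n + 1) \<cdot> diff T n" for n using chain_simps(4)[OF g T T'] .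
    \<comment> \<open>On the other summand \<open>u k1\<close> is not a chain map from
      \<open>T[1]\<close>: its defect is \<open>u k2 g\<close>. By \<open>uk2\<close> the maps
      \<open>t2 g\<close> have the same defect, so the difference is a chain map.\<close>
    have "\<exists>t. \<forall>n. t n \<in> Hom C (obj T (n + 2)) (obj Q n) \<and> t n \<cdot> j (n + 2) = \<sigma> n \<cdot> i1 (n + 1) \<and>
      u (n + 1) \<cdot> k1 (n + 1) \<boxminus> t2 (n + 1) \<cdot> g (n + 1 + 1) = diff Q n \<cdot> t n \<boxminus> t (n + 1) \<cdot> diff T (n + 2)"
    proof (rule null_extending_unshift[OF ext j M T Q, where v = "\<lambda>n. u n \<cdot> k1 n \<boxminus> t2 n \<cdot> g (n + 1)"])
      fix n
      show "u n \<cdot> k1 n \<boxminus> t2 n \<cdot> g (n + 1) \<in> Hom C (obj T (n + 1)) (obj Q n)" by (simp add: Hom_iff)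
      show "\<sigma> n \<cdot> i1 (n + 1) \<in> Hom C (obj M (n + 2)) (obj Q n)" by (simp add: Hom_iff)
      show "diff Q n \<cdot> (u n \<cdot> k1 n \<boxminus> t2 n \<cdot> g (n + 1)) =
          neg C ((u (n + 1) \<cdot> k1 (n + 1) \<boxminus> t2 (n + 1) \<cdot> g (n + 1 + 1)) \<cdot> diff T (n + 1))"
        by (simp add: arith du dW1 uk2'[of "n + 1" n] gd)
      show "(u (n + 1) \<cdot> k1 (n + 1) \<boxminus> t2 (n + 1) \<cdot> g (n + 1 + 1)) \<cdot> j (n + 2) =
          diff Q n \<cdot> (\<sigma> n \<cdot> i1 (n + 1)) \<boxminus> \<sigma> (n + 1) \<cdot> i1 (n + 1 + 1) \<cdot> diff M (n + 2)"
        using uk[of "i1 (n + 1)" n] by (simp add: arith dZ1 gj t2j')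
    qed
    then obtain t1 where t1 [simp]: "\<And>n. t1 n \<in> Arr C" "\<And>n. Dom C (t1 n) = obj T (n + 2)"
        "\<And>n. Cod C (t1 n) = obj Q n" and t1j: "\<And>n. t1 n \<cdot> j (n + 2) = \<sigma> n \<cdot> i1 (n + 1)"
        and uk1: "\<And>n. u (n + 1) \<cdot> k1 (n + 1) \<boxminus> t2 (n + 1) \<cdot> g (n + 1 + 1) =
          diff Q n \<cdot> t1 n \<boxminus> t1 (n + 1) \<cdot> diff T (n + 2)"
      unfolding Hom_iff by blast
    have t1j': "t1 n \<cdot> (j (n + 2) \<cdot> x) = \<sigma> n \<cdot> (i1 (n + 1) \<cdot> x)" if "x \<in> Arr C" "Cod C x = obj M (n + 2)" for n x
      using comp_eq_comp[OF t1j[of n], where x = x] that by (simp add: comp_assoc)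
    let ?t = "\<lambda>n. t1 n \<cdot> r1 (n + 1) \<boxplus> t2 n \<cdot> r2 (n + 1)"
    have "null_homotopy C W Q u ?t"
    proof (rule null_homotopyI)
      fix n
      show "u (n + 1) = diff Q n \<cdot> ?t n \<boxplus> ?t (n + 1) \<cdot> diff W (n + 1)"
      proof (rule biproduct_eq_out[OF bp'])
        show "u (n + 1) \<cdot> k1 (n + 1) = (diff Q n \<cdot> ?t n \<boxplus> ?t (n + 1) \<cdot> diff W (n + 1)) \<cdot> k1 (n + 1)"
          using uk1[of n] by (simp add: arith dW1)
        show "u (n + 1) \<cdot> k2 (n + 1) = (diff Q n \<cdot> ?t n \<boxplus> ?t (n + 1) \<cdot> diff W (n + 1)) \<cdot> k2 (n + 1)"
          by (simp add: arith dW1 uk2[of "n + 1" n])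
      qed simp_all
    qed simp_all
    moreover have "?t n \<cdot> ?k (n + 1) = \<sigma> n" for n
      by (rule biproduct_eq_out[OF bp[of "n + 1"]]) (simp_all add: arith t1j t2j)
    ultimately show "\<exists>\<tau>. null_homotopy C W Q u \<tau> \<and> (\<forall>n. \<tau> n \<cdot> ?k (n + 1) = \<sigma> n)" by blast
  qed
qed

end

section \<open>The triangle equivalence\<close>

context homotopy_full
begin

lemma mapping_cone_full_subcategory:
  assumes P: "P \<in> cplx_in C S" and Q: "Q \<in> cplx_in C S" and f: "f \<in> chain_maps C P Q"
  shows "mapping_cone (full_subcategory C S) P Q f Z i1 i2 p1 p2 \<longleftrightarrow>
    mapping_cone C P Q f Z i1 i2 p1 p2 \<and> Z \<in> cplx_in C S"
proof -
  have PC: "P \<in> complexes C" and QC: "Q \<in> complexes C" and PS [simp]: "obj P n \<in> S" "obj Q n \<in> S" for n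
    using P Q by (simp_all add: cplx_in_def)
  have [simp]: "neg (full_subcategory C S) (diff P n) = neg C (diff P n)" for n
    by (simp add: neg_full_subcategory cplx_simps[OF PC])
  have "mapping_cone (full_subcategory C S) P Q f Z i1 i2 p1 p2 \<longleftrightarrow>
      mapping_cone C P Q f Z i1 i2 p1 p2 \<and> (\<forall>n. obj Z n \<in> S)"
    unfolding mapping_cone_def by (simp add: biproduct_full_subcategory[OF S]) blast
  then show ?thesis
    using mapping_cone_simps(2)[OF _ PC QC f] by (auto simp: cplx_in_def)
qed

lemma K_DistD:
  assumes "(u, v, w) \<in> distinguished_triangles (full_subcategory C S)"
  shows "\<exists>X Y Z P Q W f i1 i2 p1 p2 a b c.
      u \<in> Hom K X Y \<and> v \<in> Hom K Y Z \<and> w \<in> Hom K Z (shift_cplx C X) \<and>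
      P \<in> cplx_in C S \<and> Q \<in> cplx_in C S \<and> W \<in> cplx_in C S \<and> f \<in> chain_maps C P Q \<and>
      mapping_cone C P Q f W i1 i2 p1 p2 \<and>
      a \<in> Hom K X P \<and> b \<in> Hom K Y Q \<and> c \<in> Hom K Z W \<and> iso_arr K a \<and> iso_arr K b \<and> iso_arr K c \<and>
      b \<cdot>\<^bsub>K\<^esub> u = hclass C P Q f \<cdot>\<^bsub>K\<^esub> a \<and> c \<cdot>\<^bsub>K\<^esub> v = hclass C Q W i2 \<cdot>\<^bsub>K\<^esub> b \<and>
      shift_harr (full_subcategory C S) a \<cdot>\<^bsub>K\<^esub> w = hclass C W (shift_cplx C P) p1 \<cdot>\<^bsub>K\<^esub> c"
proof -
  obtain X Y Z u' v' w' X' Y' Z' a b c where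
      uvw: "u \<in> Hom K X Y" "v \<in> Hom K Y Z" "w \<in> Hom K Z (shift_cplx (full_subcategory C S) X)"
    and st: "(u', v', w') \<in> standard_triangles (full_subcategory C S)"
    and u'v': "u' \<in> Hom K X' Y'" "v' \<in> Hom K Y' Z'"
    and abc: "a \<in> Hom K X X'" "b \<in> Hom K Y Y'" "c \<in> Hom K Z Z'" "iso_arr K a" "iso_arr K b" "iso_arr K c"
    and eq: "b \<cdot>\<^bsub>K\<^esub> u = u' \<cdot>\<^bsub>K\<^esub> a" "c \<cdot>\<^bsub>K\<^esub> v = v' \<cdot>\<^bsub>K\<^esub> b"
      "shift_harr (full_subcategory C S) a \<cdot>\<^bsub>K\<^esub> w = w' \<cdot>\<^bsub>K\<^esub> c"
    using assms unfolding distinguished_triangles_def Let_def Hom_homotopy_precat iso_arr_homotopy_precat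
      Comp_homotopy_precat homotopy_category_simps by blast
  obtain P Q W f i1 i2 p1 p2 where PQ: "P \<in> cplx_in C S" "Q \<in> cplx_in C S"
      and f: "f \<in> chain_maps (full_subcategory C S) P Q"
      and cone: "mapping_cone (full_subcategory C S) P Q f W i1 i2 p1 p2"
      and u': "u' = hclass (full_subcategory C S) P Q f" and v': "v' = hclass (full_subcategory C S) Q W i2"
      and w': "w' = hclass (full_subcategory C S) W (shift_cplx (full_subcategory C S) P) p1"
    using st unfolding standard_triangles_def K_Ob by blast
  have f': "f \<in> chain_maps C P Q" using f PQ by (simp add: chain_maps_full_subcategory)
  have cone': "mapping_cone C P Q f W i1 i2 p1 p2" and W: "W \<in> cplx_in C S"
    using cone mapping_cone_full_subcategory[OF PQ f'] by blast+
  \<comment> \<open>Arrows record their source and target, so \<open>u'\<close> and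
    \<open>v'\<close> determine the three complexes.\<close>
  have [simp]: "X' = P" "Y' = Q" "Z' = W"
    using u'v' by (simp_all add: u' v' Hom_def hclass_def)
  have X: "X \<in> cplx_in C S" using K_Hom_objs[OF uvw(1)] by blast
  show ?thesis
    using uvw abc eq PQ W f' cone' X
    by (intro exI conjI) (simp_all del: homotopy_category_simps
        add: u' v' w' K_ShiftOb hclass_full_subcategory shift_in)
qed

lemma K_DistI:
  assumes uvw: "u \<in> Hom K X Y" "v \<in> Hom K Y Z" "w \<in> Hom K Z (shift_cplx C X)"
    and PQ: "P \<in> cplx_in C S" "Q \<in> cplx_in C S" "W \<in> cplx_in C S" "f \<in> chain_maps C P Q"
    and cone: "mapping_cone C P Q f W i1 i2 p1 p2"
    and abc: "a \<in> Hom K X P" "b \<in> Hom K Y Q" "c \<in> Hom K Z W" "iso_arr K a" "iso_arr K b" "iso_arr K c"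
    and eq: "b \<cdot>\<^bsub>K\<^esub> u = hclass C P Q f \<cdot>\<^bsub>K\<^esub> a" "c \<cdot>\<^bsub>K\<^esub> v = hclass C Q W i2 \<cdot>\<^bsub>K\<^esub> b"
      "shift_harr (full_subcategory C S) a \<cdot>\<^bsub>K\<^esub> w = hclass C W (shift_cplx C P) p1 \<cdot>\<^bsub>K\<^esub> c"
  shows "(u, v, w) \<in> distinguished_triangles (full_subcategory C S)"
proof -
  have X: "X \<in> cplx_in C S" using K_Hom_objs[OF uvw(1)] by blast
  have "mapping_cone (full_subcategory C S) P Q f W i1 i2 p1 p2"
    using mapping_cone_full_subcategory[OF PQ(1,2,4)] cone PQ(3) by blast
  moreover have "f \<in> chain_maps (full_subcategory C S) P Q"
    using PQ by (simp add: chain_maps_full_subcategory)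
  ultimately have st: "(hclass C P Q f, hclass C Q W i2, hclass C W (shift_cplx C P) p1)
      \<in> standard_triangles (full_subcategory C S)"
    unfolding standard_triangles_def K_Ob
    using PQ by (intro CollectI exI[where x = P] exI[where x = Q] exI[where x = W] exI[where x = f] exI conjI)
      (simp_all add: hclass_full_subcategory K_ShiftOb shift_in)
  have PC: "P \<in> complexes C" and QC: "Q \<in> complexes C" using PQ by (simp_all add: cplx_in_C)
  have st_in: "hclass C P Q f \<in> Hom K P Q" "hclass C Q W i2 \<in> Hom K Q W"
    using PQ mapping_cone_simps(3)[OF cone PC QC PQ(4)] by (simp_all add: K_in)
  have w: "w \<in> Hom K Z (shift_cplx (full_subcategory C S) X)" using uvw(3) K_ShiftOb[OF X] by simp
  show ?thesis
    unfolding distinguished_triangles_def Let_def Hom_homotopy_precat iso_arr_homotopy_precat Comp_homotopy_precat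
    using uvw(1,2) w abc eq[unfolded homotopy_category_simps(6)] st st_in by blast
qed

lemma shift_harr_in:
  assumes "u \<in> Hom K M N"
  shows "shift_harr (full_subcategory C S) u \<in> Hom K (shift_cplx C M) (shift_cplx C N)"
proof -
  obtain f where f: "f \<in> chain_maps C M N" "u = hclass C M N f" and MN: "M \<in> cplx_in C S" "N \<in> cplx_in C S"
    using K_E[OF assms] .
  note [simp] = cplx_simps[OF cplx_in_C[OF MN(1)]] cplx_simps[OF cplx_in_C[OF MN(2)]]
  have "(\<lambda>n. f (n + 1)) \<in> chain_maps C (shift_cplx C M) (shift_cplx C N)"
    by (rule chain_mapsI)
      (simp_all add: chain_simps[OF f(1) cplx_in_C[OF MN(1)] cplx_in_C[OF MN(2)]] arith)
  then show ?thesis using MN by (simp add: f(2) K_ShiftArr K_in shift_in)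
qed

end

section \<open>From chosen coresolutions to a triangle equivalence\<close>

lemma functor_iso:
  assumes F: "is_functor S T Fo Fa" and S: "category S" and f: "f \<in> Hom S a b" "iso_arr S f"
  shows "iso_arr T (Fa f)"
proof -
  obtain g where g: "g \<in> Hom S b a" "g \<cdot>\<^bsub>S\<^esub> f = Id S a" "f \<cdot>\<^bsub>S\<^esub> g = Id S b" using iso_arr_inverse[OF f(2,1)] .
  have ab: "a \<in> Ob S" "b \<in> Ob S" using f(1) category.Dom_in[OF S] category.Cod_in[OF S] by (auto simp: Hom_def)
  have eqs: "Fa g \<cdot>\<^bsub>T\<^esub> Fa f = Id T (Fo a)" "Fa f \<cdot>\<^bsub>T\<^esub> Fa g = Id T (Fo b)"
    "Fa f \<in> Hom T (Fo a) (Fo b)" "Fa g \<in> Hom T (Fo b) (Fo a)"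
    using F ab f(1) g unfolding is_functor_def by metis+
  show ?thesis by (rule iso_arrI[OF eqs(3,4,1,2)])
qed

text \<open>\<open>Fo\<close> and \<open>J\<close> are arbitrary choices of one coresolution for
  each complex over \<X>, unrelated for different complexes; the action on arrows is forced by the
  extension property. \<open>sums\<close> provides cones over \<Y>, and \<open>resolve\<close>
  serves essential surjectivity.\<close>

locale coresolution_functor = preadditive_category C
  for C :: "('o, 'm, 'z) precat_scheme" (structure) +
  fixes \<X> \<Y> :: "'o set" and Fo :: "('o, 'm) cplx \<Rightarrow> ('o, 'm) cplx" and J :: "('o, 'm) cplx \<Rightarrow> int \<Rightarrow> 'm"
  assumes \<X>: "\<X> \<subseteq> Ob C" and \<Y>: "\<Y> \<subseteq> Ob C"
    and sums: "a \<in> \<Y> \<Longrightarrow> b \<in> \<Y> \<Longrightarrow> \<exists>s \<in> \<Y>. \<exists>i1 i2 p1 p2. biproduct C a b s i1 i2 p1 p2"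
    and Fo: "P \<in> cplx_in C \<X> \<Longrightarrow> Fo P \<in> cplx_in C \<Y>"
    and J: "P \<in> cplx_in C \<X> \<Longrightarrow> J P \<in> chain_maps C P (Fo P)"
    and ext: "P \<in> cplx_in C \<X> \<Longrightarrow> null_extending C \<Y> P (Fo P) (J P)"
    and lift: "P \<in> cplx_in C \<X> \<Longrightarrow> homotopy_lifting C \<X> P (Fo P) (J P)"
    and resolve: "Q \<in> cplx_in C \<Y> \<Longrightarrow> \<exists>P \<in> cplx_in C \<X>. \<exists>k \<in> chain_maps C P Q. homotopy_extending C \<Y> P Q k"
begin

sublocale X: homotopy_full C \<X> by unfold_locales (rule \<X>)
sublocale Y: homotopy_full C \<Y> by unfold_locales (rule \<Y>)

lemma extend:
  assumes P: "P \<in> cplx_in C \<X>" and Q: "Q \<in> cplx_in C \<Y>" and f: "f \<in> chain_maps C P Q"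
  obtains g where "g \<in> chain_maps C (Fo P) Q" "\<And>n. g n \<cdot> J P n = f n"
  using null_extending_extend[OF ext[OF P] J[OF P] X.cplx_in_C[OF P] Y.cplx_in_C[OF Fo[OF P]] Q f] by blast

lemma unique:
  assumes P: "P \<in> cplx_in C \<X>" and Q: "Q \<in> cplx_in C \<Y>"
    and g: "g \<in> chain_maps C (Fo P) Q" and g': "g' \<in> chain_maps C (Fo P) Q"
    and rel: "(\<lambda>n. g n \<cdot> J P n, \<lambda>n. g' n \<cdot> J P n) \<in> homotopy_rel C P Q"
  shows "hclass C (Fo P) Q g = hclass C (Fo P) Q g'"
  using null_extending_unique[OF ext[OF P] J[OF P] X.cplx_in_C[OF P] Y.cplx_in_C[OF Fo[OF P]] Q g g' rel]
    Y.K_eq_iff[OF Fo[OF P] Q g] by blast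

lemma unique_strict:
  assumes P: "P \<in> cplx_in C \<X>" and Q: "Q \<in> cplx_in C \<Y>"
    and g: "g \<in> chain_maps C (Fo P) Q" and g': "g' \<in> chain_maps C (Fo P) Q"
    and eq: "\<And>n. g n \<cdot> J P n = g' n \<cdot> J P n"
  shows "hclass C (Fo P) Q g = hclass C (Fo P) Q g'"
  using homotopy_rel_refl[OF X.cplx_in_C[OF P] Y.cplx_in_C[OF Q]]
    chain_Comp[OF X.cplx_in_C[OF P] Y.cplx_in_C[OF Fo[OF P]] Y.cplx_in_C[OF Q] J[OF P] g'] eq
  by (intro unique[OF P Q g g']) simp

text \<open>The targets of two extending maps out of \<open>M\<close> represent the same functor on
  the homotopy category over \<Y>, so the comparison between them is invertible. This produces the
  isomorphism with the shift as well as the one with the cone.\<close>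

lemma extending_iso:
  assumes M: "M \<in> complexes C" and T: "T \<in> cplx_in C \<Y>" and W: "W \<in> cplx_in C \<Y>"
    and j: "j \<in> chain_maps C M T" "null_extending C \<Y> M T j"
    and k: "k \<in> chain_maps C M W" "null_extending C \<Y> M W k"
    and c: "c \<in> chain_maps C T W" "\<And>n. c n \<cdot> j n = k n"
  shows "iso_arr Y.K (hclass C T W c)"
proof -
  have TC: "T \<in> complexes C" and WC: "W \<in> complexes C" using T W by (simp_all add: Y.cplx_in_C)
  obtain c' where c': "c' \<in> chain_maps C W T" "\<And>n. c' n \<cdot> k n = j n"
    using null_extending_extend[OF k(2,1) M WC T j(1)] by blast
  note [simp] = chain_simps(1-3)[OF j(1) M TC] chain_simps(1-3)[OF k(1) M WC] chain_simps(1-3)[OF c(1) TC WC]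
    chain_simps(1-3)[OF c'(1) WC TC]
  show ?thesis
  proof (rule Y.K_isoI[OF T W c(1) c'(1)])
    show "(\<lambda>n. c' n \<cdot> c n, \<lambda>n. Id C (obj T n)) \<in> homotopy_rel C T T"
      by (rule null_extending_unique[OF j(2,1) M TC T chain_Comp[OF TC WC TC c(1) c'(1)] chain_Id[OF TC]])
        (simp add: comp_assoc c(2) c'(2) homotopy_rel_refl[OF M TC j(1)])
    show "(\<lambda>n. c n \<cdot> c' n, \<lambda>n. Id C (obj W n)) \<in> homotopy_rel C W W"
      by (rule null_extending_unique[OF k(2,1) M WC W chain_Comp[OF WC TC WC c'(1) c(1)] chain_Id[OF WC]])
        (simp add: comp_assoc c(2) c'(2) homotopy_rel_refl[OF M WC k(1)])
  qed
qed

text \<open>Any \<open>g\<close> will do that makes the square with \<open>J\<close> commute up to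
  homotopy for some representative \<open>f\<close>: \<open>Fa_eq\<close> shows that its class does
  not depend on the choices.\<close>

definition Fa :: "('o, 'm) harr \<Rightarrow> ('o, 'm) harr" where
  "Fa = (\<lambda>(P, Q, c). hclass C (Fo P) (Fo Q) (SOME g. g \<in> chain_maps C (Fo P) (Fo Q) \<and>
     (\<exists>f \<in> c. (\<lambda>n. g n \<cdot> J P n, \<lambda>n. J Q n \<cdot> f n) \<in> homotopy_rel C P (Fo Q))))"

lemma Fa_eq:
  assumes P: "P \<in> cplx_in C \<X>" and Q: "Q \<in> cplx_in C \<X>" and f: "f \<in> chain_maps C P Q"
    and g: "g \<in> chain_maps C (Fo P) (Fo Q)"
    and rel: "(\<lambda>n. g n \<cdot> J P n, \<lambda>n. J Q n \<cdot> f n) \<in> homotopy_rel C P (Fo Q)"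
  shows "Fa (hclass C P Q f) = hclass C (Fo P) (Fo Q) g"
proof -
  have PC: "P \<in> complexes C" and QC: "Q \<in> complexes C" and FQC: "Fo Q \<in> complexes C"
    using X.cplx_in_C[OF P] X.cplx_in_C[OF Q] Y.cplx_in_C[OF Fo[OF Q]] .
  let ?R = "\<lambda>g. g \<in> chain_maps C (Fo P) (Fo Q) \<and> (\<exists>f' \<in> homotopy_rel C P Q `` {f}.
      (\<lambda>n. g n \<cdot> J P n, \<lambda>n. J Q n \<cdot> f' n) \<in> homotopy_rel C P (Fo Q))"
  have "?R g" using g rel homotopy_rel_refl[OF PC QC f] by blast
  then have "?R (SOME g. ?R g)" by (rule someI[of ?R])
  then obtain g' f' where g': "g' = (SOME g. ?R g)" "g' \<in> chain_maps C (Fo P) (Fo Q)"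
      and f': "(f, f') \<in> homotopy_rel C P Q" "(\<lambda>n. g' n \<cdot> J P n, \<lambda>n. J Q n \<cdot> f' n) \<in> homotopy_rel C P (Fo Q)"
    by blast
  \<comment> \<open>The chosen \<open>g'\<close> may belong to a representative \<open>f'\<close>
    other than \<open>f\<close>, but the composites of the two with \<open>J Q\<close> are
    homotopic.\<close>
  have "(\<lambda>n. J Q n \<cdot> f' n, \<lambda>n. J Q n \<cdot> f n) \<in> homotopy_rel C P (Fo Q)"
    using homotopy_rel_Comp[OF PC QC FQC homotopy_rel_sym[OF PC QC f'(1)] homotopy_rel_refl[OF QC FQC J[OF Q]]] .
  then have "(\<lambda>n. g' n \<cdot> J P n, \<lambda>n. g n \<cdot> J P n) \<in> homotopy_rel C P (Fo Q)"
    using f'(2) rel homotopy_rel_trans[OF PC FQC] homotopy_rel_sym[OF PC FQC] by blast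
  then have "hclass C (Fo P) (Fo Q) g' = hclass C (Fo P) (Fo Q) g" by (rule unique[OF P Fo[OF Q] g'(2) g])
  then show ?thesis by (simp add: Fa_def hclass_def g'(1))
qed

lemma Fa_strict:
  assumes P: "P \<in> cplx_in C \<X>" and Q: "Q \<in> cplx_in C \<X>" and f: "f \<in> chain_maps C P Q"
    and g: "g \<in> chain_maps C (Fo P) (Fo Q)" "\<And>n. g n \<cdot> J P n = J Q n \<cdot> f n"
  shows "Fa (hclass C P Q f) = hclass C (Fo P) (Fo Q) g"
  using homotopy_rel_refl[OF X.cplx_in_C[OF P] Y.cplx_in_C[OF Fo[OF Q]]
      chain_Comp[OF X.cplx_in_C[OF P] X.cplx_in_C[OF Q] Y.cplx_in_C[OF Fo[OF Q]] f J[OF Q]]] g(2)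
  by (intro Fa_eq[OF P Q f g(1)]) simp

text \<open>For each representative the square with \<open>J\<close> can even be made to commute
  strictly, which is the form that the comparison of cones requires.\<close>

lemma extend_arr:
  assumes P: "P \<in> cplx_in C \<X>" and Q: "Q \<in> cplx_in C \<X>" and f: "f \<in> chain_maps C P Q"
  obtains g where "g \<in> chain_maps C (Fo P) (Fo Q)" "\<And>n. g n \<cdot> J P n = J Q n \<cdot> f n"
    "Fa (hclass C P Q f) = hclass C (Fo P) (Fo Q) g"
proof -
  obtain g where "g \<in> chain_maps C (Fo P) (Fo Q)" "\<And>n. g n \<cdot> J P n = J Q n \<cdot> f n"
    using extend[OF P Fo[OF Q]
      chain_Comp[OF X.cplx_in_C[OF P] X.cplx_in_C[OF Q] Y.cplx_in_C[OF Fo[OF Q]] f J[OF Q]]] by blast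
  then show ?thesis using Fa_strict[OF P Q f] that by blast
qed

lemma J_simps:
  assumes "P \<in> cplx_in C \<X>"
  shows "J P n \<in> Arr C" "Dom C (J P n) = obj P n" "Cod C (J P n) = obj (Fo P) n"
  using chain_simps(1-3)[OF J[OF assms] X.cplx_in_C[OF assms] Y.cplx_in_C[OF Fo[OF assms]]] by blast+

lemma additive_functor_Fa: "additive_functor X.K Y.K Fo Fa"
  unfolding additive_functor_def is_functor_def
proof (intro conjI ballI)
  fix P assume "P \<in> Ob X.K"
  then have P: "P \<in> cplx_in C \<X>" by simp
  then show "Fo P \<in> Ob Y.K" using Fo by simp
  note [simp] = J_simps[OF P]
  show "Fa (Id X.K P) = Id Y.K (Fo P)"
    unfolding X.K_Id[OF P] Y.K_Id[OF Fo[OF P]]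
    by (rule Fa_strict[OF P P chain_Id[OF X.cplx_in_C[OF P]] chain_Id[OF Y.cplx_in_C[OF Fo[OF P]]]]) simp
next
  fix P Q u assume u: "u \<in> Hom X.K P Q"
  obtain f where f: "f \<in> chain_maps C P Q" "u = hclass C P Q f" and PQ: "P \<in> cplx_in C \<X>" "Q \<in> cplx_in C \<X>"
    using X.K_E[OF u] .
  obtain g where "g \<in> chain_maps C (Fo P) (Fo Q)" "Fa u = hclass C (Fo P) (Fo Q) g"
    using extend_arr[OF PQ f(1)] f(2) by blast
  then show "Fa u \<in> Hom Y.K (Fo P) (Fo Q)" using Y.K_in[OF Fo[OF PQ(1)] Fo[OF PQ(2)]] by simp
next
  fix P Q R u v assume u: "u \<in> Hom X.K P Q" and v: "v \<in> Hom X.K Q R"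
  obtain f where f: "f \<in> chain_maps C P Q" "u = hclass C P Q f" and P: "P \<in> cplx_in C \<X>" and Q: "Q \<in> cplx_in C \<X>"
    using X.K_E[OF u] .
  obtain f' where f': "f' \<in> chain_maps C Q R" "v = hclass C Q R f'" and R: "R \<in> cplx_in C \<X>"
    using X.K_E[OF v] .
  obtain g where g: "g \<in> chain_maps C (Fo P) (Fo Q)" "\<And>n. g n \<cdot> J P n = J Q n \<cdot> f n"
      and Fu: "Fa u = hclass C (Fo P) (Fo Q) g"
    using extend_arr[OF P Q f(1)] f(2) by blast
  obtain g' where g': "g' \<in> chain_maps C (Fo Q) (Fo R)" "\<And>n. g' n \<cdot> J Q n = J R n \<cdot> f' n"
      and Fv: "Fa v = hclass C (Fo Q) (Fo R) g'"
    using extend_arr[OF Q R f'(1)] f'(2) by blast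
  note FO = Fo[OF P] Fo[OF Q] Fo[OF R]
  note [simp] = J_simps[OF P] J_simps[OF Q] J_simps[OF R]
    chain_simps(1-3)[OF f(1) X.cplx_in_C[OF P] X.cplx_in_C[OF Q]]
    chain_simps(1-3)[OF f'(1) X.cplx_in_C[OF Q] X.cplx_in_C[OF R]]
    chain_simps(1-3)[OF g(1) Y.cplx_in_C[OF FO(1)] Y.cplx_in_C[OF FO(2)]]
    chain_simps(1-3)[OF g'(1) Y.cplx_in_C[OF FO(2)] Y.cplx_in_C[OF FO(3)]]
  show "Fa (v \<cdot>\<^bsub>X.K\<^esub> u) = Fa v \<cdot>\<^bsub>Y.K\<^esub> Fa u"
    unfolding Fu Fv Y.K_Comp[OF FO g(1) g'(1)] unfolding f(2) f'(2) X.K_Comp[OF P Q R f(1) f'(1)]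
  proof (rule Fa_strict[OF P R X.chain_Comp_in[OF f(1) f'(1) P Q R] Y.chain_Comp_in[OF g(1) g'(1) FO]])
    fix n
    have "g' n \<cdot> g n \<cdot> J P n = g' n \<cdot> J Q n \<cdot> f n" by (simp add: comp_assoc g(2))
    also have "\<dots> = J R n \<cdot> (f' n \<cdot> f n)" by (simp add: g'(2) comp_assoc)
    finally show "g' n \<cdot> g n \<cdot> J P n = J R n \<cdot> (f' n \<cdot> f n)" .
  qed
next
  fix P Q u v assume u: "u \<in> Hom X.K P Q" and v: "v \<in> Hom X.K P Q"
  obtain f where f: "f \<in> chain_maps C P Q" "u = hclass C P Q f" and P: "P \<in> cplx_in C \<X>" and Q: "Q \<in> cplx_in C \<X>"
    using X.K_E[OF u] .
  obtain f' where f': "f' \<in> chain_maps C P Q" "v = hclass C P Q f'" using X.K_E[OF v] .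
  obtain g where g: "g \<in> chain_maps C (Fo P) (Fo Q)" "\<And>n. g n \<cdot> J P n = J Q n \<cdot> f n"
      and Fu: "Fa u = hclass C (Fo P) (Fo Q) g"
    using extend_arr[OF P Q f(1)] f(2) by blast
  obtain g' where g': "g' \<in> chain_maps C (Fo P) (Fo Q)" "\<And>n. g' n \<cdot> J P n = J Q n \<cdot> f' n"
      and Fv: "Fa v = hclass C (Fo P) (Fo Q) g'"
    using extend_arr[OF P Q f'(1)] f'(2) by blast
  note FO = Fo[OF P] Fo[OF Q]
  note [simp] = J_simps[OF P] J_simps[OF Q]
    chain_simps(1-3)[OF f(1) X.cplx_in_C[OF P] X.cplx_in_C[OF Q]]
    chain_simps(1-3)[OF f'(1) X.cplx_in_C[OF P] X.cplx_in_C[OF Q]]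
    chain_simps(1-3)[OF g(1) Y.cplx_in_C[OF FO(1)] Y.cplx_in_C[OF FO(2)]]
    chain_simps(1-3)[OF g'(1) Y.cplx_in_C[OF FO(1)] Y.cplx_in_C[OF FO(2)]]
  show "Fa (u \<boxplus>\<^bsub>X.K\<^esub> v) = Fa u \<boxplus>\<^bsub>Y.K\<^esub> Fa v"
    unfolding Fu Fv Y.K_Add[OF FO g(1) g'(1)] unfolding f(2) f'(2) X.K_Add[OF P Q f(1) f'(1)]
    by (rule Fa_strict[OF P Q chain_Add[OF X.cplx_in_C[OF P] X.cplx_in_C[OF Q] f(1) f'(1)]
        chain_Add[OF Y.cplx_in_C[OF FO(1)] Y.cplx_in_C[OF FO(2)] g(1) g'(1)]])
      (simp add: distrib g(2) g'(2))
qed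

lemma is_functor_Fa: "is_functor X.K Y.K Fo Fa"
  using additive_functor_Fa by (simp add: additive_functor_def)

lemma equivalence: "equivalence_functor X.K Y.K Fo Fa"
proof (rule equivalence_functorI[OF X.category_K Y.category_K is_functor_Fa])
  fix P Q g assume "P \<in> Ob X.K" "Q \<in> Ob X.K" and "g \<in> Hom Y.K (Fo P) (Fo Q)"
  then have P: "P \<in> cplx_in C \<X>" and Q: "Q \<in> cplx_in C \<X>" and g: "g \<in> Hom Y.K (Fo P) (Fo Q)" by simp_all
  obtain g0 where g0: "g0 \<in> chain_maps C (Fo P) (Fo Q)" "g = hclass C (Fo P) (Fo Q) g0" using Y.K_E[OF g] .
  have C: "P \<in> complexes C" "Q \<in> complexes C" "Fo P \<in> complexes C" "Fo Q \<in> complexes C"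
    using X.cplx_in_C[OF P] X.cplx_in_C[OF Q] Y.cplx_in_C[OF Fo[OF P]] Y.cplx_in_C[OF Fo[OF Q]] .
  \<comment> \<open>Fullness: \<open>g J\<close> lifts through \<open>J Q\<close> up to
    homotopy.\<close>
  have gJ: "(\<lambda>n. g0 n \<cdot> J P n) \<in> chain_maps C P (Fo Q)" using chain_Comp[OF C(1,3,4) J[OF P] g0(1)] .
  obtain f \<sigma> where f: "f \<in> chain_maps C P Q" and \<sigma>: "null_homotopy C P (Fo Q) (\<lambda>n. g0 n \<cdot> J P n \<boxminus> J Q n \<cdot> f n) \<sigma>"
    using homotopy_liftingD(1)[OF lift[OF Q] P gJ] by blast
  have "Fa (hclass C P Q f) = g"
    unfolding g0(2) by (rule Fa_eq[OF P Q f g0(1) homotopy_relI[OF C(1,4) gJ chain_Comp[OF C(1,2,4) f J[OF Q]] \<sigma>]])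
  then show "\<exists>f \<in> Hom X.K P Q. Fa f = g" using X.K_in[OF P Q f] by blast
next
  fix P Q u v assume u: "u \<in> Hom X.K P Q" and v: "v \<in> Hom X.K P Q" and eq: "Fa u = Fa v"
  obtain f where f: "f \<in> chain_maps C P Q" "u = hclass C P Q f" and P: "P \<in> cplx_in C \<X>" and Q: "Q \<in> cplx_in C \<X>"
    using X.K_E[OF u] .
  obtain f' where f': "f' \<in> chain_maps C P Q" "v = hclass C P Q f'" using X.K_E[OF v] .
  obtain g where g: "g \<in> chain_maps C (Fo P) (Fo Q)" "\<And>n. g n \<cdot> J P n = J Q n \<cdot> f n"
      and Fu: "Fa u = hclass C (Fo P) (Fo Q) g"
    using extend_arr[OF P Q f(1)] f(2) by blast
  obtain g' where g': "g' \<in> chain_maps C (Fo P) (Fo Q)" "\<And>n. g' n \<cdot> J P n = J Q n \<cdot> f' n"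
      and Fv: "Fa v = hclass C (Fo P) (Fo Q) g'"
    using extend_arr[OF P Q f'(1)] f'(2) by blast
  have C: "P \<in> complexes C" "Q \<in> complexes C" "Fo P \<in> complexes C" "Fo Q \<in> complexes C"
    using X.cplx_in_C[OF P] X.cplx_in_C[OF Q] Y.cplx_in_C[OF Fo[OF P]] Y.cplx_in_C[OF Fo[OF Q]] .
  note [simp] = J_simps[OF Q] chain_simps(1-3)[OF f(1) C(1,2)] chain_simps(1-3)[OF f'(1) C(1,2)]
  have "(g, g') \<in> homotopy_rel C (Fo P) (Fo Q)"
    using eq Y.K_eq_iff[OF Fo[OF P] Fo[OF Q] g(1)] unfolding Fu Fv by blast
  \<comment> \<open>Faithfulness: restricted along \<open>J P\<close>, the homotopy relates
    \<open>J Q f\<close> and \<open>J Q f'\<close>, and composition with \<open>J Q\<close> is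
    injective on classes.\<close>
  from homotopy_rel_Comp[OF C(1,3,4) homotopy_rel_refl[OF C(1,3) J[OF P]] this]
  have "(\<lambda>n. J Q n \<cdot> f n, \<lambda>n. J Q n \<cdot> f' n) \<in> homotopy_rel C P (Fo Q)" by (simp add: g(2) g'(2))
  then obtain \<sigma> where "null_homotopy C P (Fo Q) (\<lambda>n. J Q n \<cdot> f n \<boxminus> J Q n \<cdot> f' n) \<sigma>"
    by (auto simp: homotopy_rel_iff[OF C(1,4)])
  then have "null_homotopy C P (Fo Q) (\<lambda>n. J Q n \<cdot> (f n \<boxminus> f' n)) \<sigma>" by (simp add: comp_sub)
  from homotopy_liftingD(2)[OF lift[OF Q] P chain_sub[OF C(1,2) f(1) f'(1)] this]
  obtain \<tau> where "null_homotopy C P Q (\<lambda>n. f n \<boxminus> f' n) \<tau>" by blast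
  then show "u = v"
    unfolding f(2) f'(2) using homotopy_relI[OF C(1,2) f(1) f'(1)] X.K_eq_iff[OF P Q f(1)] by blast
next
  fix Q assume "Q \<in> Ob Y.K"
  then have Q: "Q \<in> cplx_in C \<Y>" by simp
  obtain P k where P: "P \<in> cplx_in C \<X>" and k: "k \<in> chain_maps C P Q" and he: "homotopy_extending C \<Y> P Q k"
    using resolve[OF Q] by blast
  have C: "P \<in> complexes C" "Q \<in> complexes C" "Fo P \<in> complexes C"
    using X.cplx_in_C[OF P] Y.cplx_in_C[OF Q] Y.cplx_in_C[OF Fo[OF P]] .
  \<comment> \<open>\<open>a\<close> extends \<open>k\<close> over \<open>J P\<close>, and
    \<open>b\<close> extends \<open>J P\<close> over \<open>k\<close> up to homotopy. Hence
    \<open>b a\<close> and \<open>a b\<close> agree with the identities after restriction to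
    \<open>P\<close>, and restriction along \<open>J P\<close> and along \<open>k\<close> is
    injective on classes.\<close>
  obtain a where a: "a \<in> chain_maps C (Fo P) Q" "\<And>n. a n \<cdot> J P n = k n" using extend[OF P Q k] by blast
  obtain b \<sigma> where b: "b \<in> chain_maps C Q (Fo P)" and \<sigma>: "null_homotopy C P (Fo P) (\<lambda>n. J P n \<boxminus> b n \<cdot> k n) \<sigma>"
    using he Fo[OF P] J[OF P] unfolding homotopy_extending_def by blast
  note [simp] = J_simps[OF P] chain_simps(1-3)[OF k C(1,2)] chain_simps(1-3)[OF a(1) C(3,2)] chain_simps(1-3)[OF b C(2,3)]
  have ab: "(\<lambda>n. a n \<cdot> b n) \<in> chain_maps C Q Q" using chain_Comp[OF C(2,3,2) b a(1)] .
  have ba: "(\<lambda>n. b n \<cdot> a n) \<in> chain_maps C (Fo P) (Fo P)" using chain_Comp[OF C(3,2,3) a(1) b] .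
  have Jbk: "(J P, \<lambda>n. b n \<cdot> k n) \<in> homotopy_rel C P (Fo P)"
    by (rule homotopy_relI[OF C(1,3) J[OF P] chain_Comp[OF C(1,2,3) k b] \<sigma>])
  have "(\<lambda>n. b n \<cdot> a n, \<lambda>n. Id C (obj (Fo P) n)) \<in> homotopy_rel C (Fo P) (Fo P)"
    by (rule null_extending_unique[OF ext[OF P] J[OF P] C(1,3) Fo[OF P] ba chain_Id[OF C(3)]])
      (simp add: comp_assoc a(2) homotopy_rel_sym[OF C(1,3) Jbk])
  moreover have "(\<lambda>n. a n \<cdot> b n, \<lambda>n. Id C (obj Q n)) \<in> homotopy_rel C Q Q"
  proof -
    have "(\<lambda>n. a n \<cdot> (b n \<cdot> k n), \<lambda>n. a n \<cdot> J P n) \<in> homotopy_rel C P Q"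
      using homotopy_rel_Comp[OF C(1,3,2) homotopy_rel_sym[OF C(1,3) Jbk] homotopy_rel_refl[OF C(3,2) a(1)]] .
    then obtain \<tau> where "null_homotopy C P Q (\<lambda>n. a n \<cdot> (b n \<cdot> k n) \<boxminus> k n) \<tau>"
      by (auto simp: homotopy_rel_iff[OF C(1,2)] a(2))
    then have "null_homotopy C P Q (\<lambda>n. (a n \<cdot> b n \<boxminus> Id C (obj Q n)) \<cdot> k n) \<tau>"
      by (simp add: sub_comp comp_assoc cplx_simps[OF C(2)])
    moreover have "(\<lambda>n. a n \<cdot> b n \<boxminus> Id C (obj Q n)) \<in> chain_maps C Q Q"
      using chain_sub[OF C(2,2) ab chain_Id[OF C(2)]] .
    moreover have "null_homotopy C P Q (\<lambda>n. x n \<cdot> k n) \<tau> \<Longrightarrow> \<exists>\<tau>. null_homotopy C Q Q x \<tau>"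
      if "x \<in> chain_maps C Q Q" for x \<tau>
      using he Q that unfolding homotopy_extending_def by blast
    ultimately obtain \<rho> where "null_homotopy C Q Q (\<lambda>n. a n \<cdot> b n \<boxminus> Id C (obj Q n)) \<rho>" by blast
    then show ?thesis by (rule homotopy_relI[OF C(2,2) ab chain_Id[OF C(2)]])
  qed
  ultimately have "iso_arr Y.K (hclass C (Fo P) Q a)" by (rule Y.K_isoI[OF Fo[OF P] Q a(1) b])
  then show "\<exists>P \<in> Ob X.K. \<exists>h \<in> Hom Y.K (Fo P) Q. iso_arr Y.K h"
    using P Y.K_in[OF Fo[OF P] Q a(1)] by auto
qed

lemma ex_cone:
  assumes P: "P \<in> cplx_in C \<Y>" and Q: "Q \<in> cplx_in C \<Y>" and f: "f \<in> chain_maps C P Q"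
  shows "\<exists>Z i1 i2 p1 p2. mapping_cone C P Q f Z i1 i2 p1 p2 \<and> Z \<in> cplx_in C \<Y>"
proof -
  have "\<exists>s i1 i2 p1 p2. s \<in> \<Y> \<and> biproduct C (obj P (n + 1)) (obj Q n) s i1 i2 p1 p2" for n
  proof -
    have "obj P (n + 1) \<in> \<Y>" "obj Q n \<in> \<Y>" using P Q by (simp_all add: cplx_in_def)
    from sums[OF this] show ?thesis by blast
  qed
  then obtain s i1 i2 p1 p2 where s: "\<And>n. s n \<in> \<Y>"
      and bp: "\<And>n. biproduct C (obj P (n + 1)) (obj Q n) (s n) (i1 n) (i2 n) (p1 n) (p2 n)"
    by metis
  define Z where "Z = \<lparr>obj = s, diff = (\<lambda>n. i1 (n + 1) \<cdot> (neg C (diff P (n + 1)) \<cdot> p1 n)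
    \<boxplus> i2 (n + 1) \<cdot> (f (n + 1) \<cdot> p1 n \<boxplus> diff Q n \<cdot> p2 n))\<rparr>"
  have cone: "mapping_cone C P Q f Z i1 i2 p1 p2" using bp by (simp add: mapping_cone_def Z_def)
  then have "Z \<in> cplx_in C \<Y>"
    using mapping_cone_simps(2)[OF cone Y.cplx_in_C[OF P] Y.cplx_in_C[OF Q] f] s by (simp add: cplx_in_def Z_def)
  then show ?thesis using cone by blast
qed

text \<open>Both isomorphisms that enter are comparisons of extending maps: \<open>\<eta>\<close>
  compares \<open>J\<close> of \<open>P[1]\<close> with the shift of \<open>J P\<close>, and
  \<open>d\<close> compares \<open>J W\<close>, for a cone \<open>W\<close>, with the map of cones
  induced by \<open>J\<close>. Squares are checked after restriction to complexes over \<X>, where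
  they commute strictly.\<close>

lemma triangle_equivalent: "triangle_equivalent X.K Y.K"
proof -
  have J_shift: "(\<lambda>n. J P (n + 1)) \<in> chain_maps C (shift_cplx C P) (shift_cplx C (Fo P))"
    if P: "P \<in> cplx_in C \<X>" for P
  proof -
    note [simp] = J_simps[OF P] cplx_simps[OF X.cplx_in_C[OF P]] cplx_simps[OF Y.cplx_in_C[OF Fo[OF P]]]
    show ?thesis
      by (rule chain_mapsI)
        (simp_all add: arith chain_simps(4)[OF J[OF P] X.cplx_in_C[OF P] Y.cplx_in_C[OF Fo[OF P]]])
  qed
  have "\<forall>P. \<exists>e. P \<in> cplx_in C \<X> \<longrightarrow> e \<in> chain_maps C (Fo (shift_cplx C P)) (shift_cplx C (Fo P)) \<and>
      (\<forall>n. e n \<cdot> J (shift_cplx C P) n = J P (n + 1))"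
    using extend[OF X.shift_in Y.shift_in[OF Fo] J_shift] by metis
  then obtain e where e: "\<And>P. P \<in> cplx_in C \<X> \<Longrightarrow> e P \<in> chain_maps C (Fo (shift_cplx C P)) (shift_cplx C (Fo P))"
      and eJ: "\<And>P n. P \<in> cplx_in C \<X> \<Longrightarrow> e P n \<cdot> J (shift_cplx C P) n = J P (n + 1)"
    by metis
  define \<eta> where "\<eta> P = hclass C (Fo (shift_cplx C P)) (shift_cplx C (Fo P)) (e P)" for P
  have \<eta>_in: "\<eta> P \<in> Hom Y.K (Fo (shift_cplx C P)) (shift_cplx C (Fo P))" if P: "P \<in> cplx_in C \<X>" for P
    unfolding \<eta>_def by (rule Y.K_in[OF Fo[OF X.shift_in[OF P]] Y.shift_in[OF Fo[OF P]] e[OF P]])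
  have \<eta>_iso: "iso_arr Y.K (\<eta> P)" if P: "P \<in> cplx_in C \<X>" for P
  proof -
    note P' = X.shift_in[OF P]
    show ?thesis
      unfolding \<eta>_def
      by (rule extending_iso[OF X.cplx_in_C[OF P'] Fo[OF P'] Y.shift_in[OF Fo[OF P]] J[OF P'] ext[OF P'] J_shift[OF P]
          null_extending_shift[OF ext[OF P] J[OF P] X.cplx_in_C[OF P] Y.cplx_in_C[OF Fo[OF P]]] e[OF P] eJ[OF P]])
  qed
  have \<eta>_nat: "\<eta> Q \<cdot>\<^bsub>Y.K\<^esub> Fa (shift_harr (full_subcategory C \<X>) u) = shift_harr (full_subcategory C \<Y>) (Fa u) \<cdot>\<^bsub>Y.K\<^esub> \<eta> P"
    if u: "u \<in> Hom X.K P Q" for u P Q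
  proof -
    obtain f where f: "f \<in> chain_maps C P Q" "u = hclass C P Q f" and P: "P \<in> cplx_in C \<X>" and Q: "Q \<in> cplx_in C \<X>"
      using X.K_E[OF u] .
    note P' = X.shift_in[OF P] and Q' = X.shift_in[OF Q]
    note FO = Fo[OF P] Fo[OF Q] and FO' = Fo[OF P'] Fo[OF Q'] and SFO = Y.shift_in[OF Fo[OF P]] Y.shift_in[OF Fo[OF Q]]
    obtain g where g: "g \<in> chain_maps C (Fo P) (Fo Q)" "\<And>n. g n \<cdot> J P n = J Q n \<cdot> f n"
        and Fu: "Fa u = hclass C (Fo P) (Fo Q) g"
      using extend_arr[OF P Q f(1)] f(2) by blast
    note [simp] = J_simps[OF P] J_simps[OF Q] J_simps[OF P'] J_simps[OF Q']
      cplx_simps[OF X.cplx_in_C[OF P]] cplx_simps[OF X.cplx_in_C[OF Q]]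
      cplx_simps[OF Y.cplx_in_C[OF FO(1)]] cplx_simps[OF Y.cplx_in_C[OF FO(2)]]
      chain_simps(1-3)[OF f(1) X.cplx_in_C[OF P] X.cplx_in_C[OF Q]]
      chain_simps(1-3)[OF g(1) Y.cplx_in_C[OF FO(1)] Y.cplx_in_C[OF FO(2)]]
      chain_simps(1-3)[OF e[OF P] Y.cplx_in_C[OF FO'(1)] Y.cplx_in_C[OF SFO(1)]]
      chain_simps(1-3)[OF e[OF Q] Y.cplx_in_C[OF FO'(2)] Y.cplx_in_C[OF SFO(2)]]
    have f': "(\<lambda>n. f (n + 1)) \<in> chain_maps C (shift_cplx C P) (shift_cplx C Q)"
      by (rule chain_mapsI) (simp_all add: arith chain_simps(4)[OF f(1) X.cplx_in_C[OF P] X.cplx_in_C[OF Q]])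
    have gs: "(\<lambda>n. g (n + 1)) \<in> chain_maps C (shift_cplx C (Fo P)) (shift_cplx C (Fo Q))"
      by (rule chain_mapsI) (simp_all add: arith chain_simps(4)[OF g(1) Y.cplx_in_C[OF FO(1)] Y.cplx_in_C[OF FO(2)]])
    obtain g' where g': "g' \<in> chain_maps C (Fo (shift_cplx C P)) (Fo (shift_cplx C Q))"
        "\<And>n. g' n \<cdot> J (shift_cplx C P) n = J (shift_cplx C Q) n \<cdot> f (n + 1)"
        and Fu': "Fa (hclass C (shift_cplx C P) (shift_cplx C Q) (\<lambda>n. f (n + 1))) =
          hclass C (Fo (shift_cplx C P)) (Fo (shift_cplx C Q)) g'"
      using extend_arr[OF P' Q' f'] by blast
    note [simp] = chain_simps(1-3)[OF g'(1) Y.cplx_in_C[OF FO'(1)] Y.cplx_in_C[OF FO'(2)]]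
    have "hclass C (Fo (shift_cplx C P)) (shift_cplx C (Fo Q)) (\<lambda>n. e Q n \<cdot> g' n) =
        hclass C (Fo (shift_cplx C P)) (shift_cplx C (Fo Q)) (\<lambda>n. g (n + 1) \<cdot> e P n)"
    proof (rule unique_strict[OF P' SFO(2) Y.chain_Comp_in[OF g'(1) e[OF Q] FO' SFO(2)]
          Y.chain_Comp_in[OF e[OF P] gs FO'(1) SFO]])
      fix n
      have "e Q n \<cdot> g' n \<cdot> J (shift_cplx C P) n = (e Q n \<cdot> J (shift_cplx C Q) n) \<cdot> f (n + 1)"
        by (simp add: comp_assoc g'(2))
      also have "\<dots> = J Q (n + 1) \<cdot> f (n + 1)" by (simp add: eJ[OF Q])
      also have "\<dots> = g (n + 1) \<cdot> e P n \<cdot> J (shift_cplx C P) n" by (simp add: comp_assoc eJ[OF P] g(2))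
      finally show "e Q n \<cdot> g' n \<cdot> J (shift_cplx C P) n = g (n + 1) \<cdot> e P n \<cdot> J (shift_cplx C P) n" .
    qed
    then show ?thesis
      unfolding Fu unfolding f(2) X.K_ShiftArr[OF P Q] Fu' Y.K_ShiftArr[OF FO] \<eta>_def
      by (simp only: Y.K_Comp[OF FO' SFO(2) g'(1) e[OF Q]] Y.K_Comp[OF FO'(1) SFO e[OF P] gs])
  qed
  have nat: "natural_iso X.K Y.K (Fo \<circ> ShiftOb X.K) (Fa \<circ> ShiftArr X.K) (ShiftOb Y.K \<circ> Fo) (ShiftArr Y.K \<circ> Fa) \<eta>"
    unfolding natural_iso_def homotopy_category_simps(1) X.K_Ob
  proof (rule conjI; (rule ballI)+)
    fix P assume P: "P \<in> cplx_in C \<X>"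
    show "\<eta> P \<in> Hom Y.K ((Fo \<circ> ShiftOb X.K) P) ((ShiftOb Y.K \<circ> Fo) P) \<and> iso_arr Y.K (\<eta> P)"
      unfolding o_apply homotopy_category_simps(8) X.K_ShiftOb[OF P] Y.K_ShiftOb[OF Fo[OF P]]
      by (rule conjI[OF \<eta>_in[OF P] \<eta>_iso[OF P]])
  next
    fix P Q u assume "u \<in> Hom X.K P Q"
    then show "\<eta> Q \<cdot>\<^bsub>Y.K\<^esub> (Fa \<circ> ShiftArr X.K) u = (ShiftArr Y.K \<circ> Fa) u \<cdot>\<^bsub>Y.K\<^esub> \<eta> P"
      unfolding o_apply homotopy_category_simps(9) by (rule \<eta>_nat)
  qed
  interpret KX: category X.K by (rule X.category_K)
  interpret KY: category Y.K by (rule Y.category_K)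
  have F_in: "Fa u \<in> Hom Y.K (Fo P) (Fo Q)" if "u \<in> Hom X.K P Q" for u P Q
    using is_functor_Fa that X.K_Hom_objs[OF that] unfolding is_functor_def by auto
  have F_Comp: "Fa (v \<cdot>\<^bsub>X.K\<^esub> u) = Fa v \<cdot>\<^bsub>Y.K\<^esub> Fa u" if "u \<in> Hom X.K P Q" "v \<in> Hom X.K Q R" for u v P Q R
    using is_functor_Fa that X.K_Hom_objs[OF that(1)] X.K_Hom_objs[OF that(2)]
    unfolding is_functor_def homotopy_category_simps(1) X.K_Ob by blast
  have dist: "(Fa u, Fa v, \<eta> (Dom X.K u) \<cdot>\<^bsub>Y.K\<^esub> Fa w) \<in> distinguished_triangles (full_subcategory C \<Y>)"
    if tri: "(u, v, w) \<in> distinguished_triangles (full_subcategory C \<X>)" for u v w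
  proof -
    obtain X Y Z P Q W f i1 i2 p1 p2 a b c where
        u: "u \<in> Hom X.K X Y" and v: "v \<in> Hom X.K Y Z" and w: "w \<in> Hom X.K Z (shift_cplx C X)"
      and P: "P \<in> cplx_in C \<X>" and Q: "Q \<in> cplx_in C \<X>" and W: "W \<in> cplx_in C \<X>" and f: "f \<in> chain_maps C P Q"
      and cone: "mapping_cone C P Q f W i1 i2 p1 p2"
      and a: "a \<in> Hom X.K X P" and b: "b \<in> Hom X.K Y Q" and c: "c \<in> Hom X.K Z W"
      and iso: "iso_arr X.K a" "iso_arr X.K b" "iso_arr X.K c"
      and eq: "b \<cdot>\<^bsub>X.K\<^esub> u = hclass C P Q f \<cdot>\<^bsub>X.K\<^esub> a" "c \<cdot>\<^bsub>X.K\<^esub> v = hclass C Q W i2 \<cdot>\<^bsub>X.K\<^esub> b"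
        "shift_harr (full_subcategory C \<X>) a \<cdot>\<^bsub>X.K\<^esub> w = hclass C W (shift_cplx C P) p1 \<cdot>\<^bsub>X.K\<^esub> c"
      using X.K_DistD[OF tri] by blast
    have X: "X \<in> cplx_in C \<X>" using X.K_Hom_objs[OF u] by blast
    note C = X.cplx_in_C[OF P] X.cplx_in_C[OF Q] X.cplx_in_C[OF W]
    note FO = Fo[OF P] Fo[OF Q] Fo[OF W]
    note FC = Y.cplx_in_C[OF FO(1)] Y.cplx_in_C[OF FO(2)] Y.cplx_in_C[OF FO(3)]
    note cone_maps = mapping_cone_simps(3,4)[OF cone C(1,2) f]
    obtain g where g: "g \<in> chain_maps C (Fo P) (Fo Q)" "\<And>n. g n \<cdot> J P n = J Q n \<cdot> f n"
        and Ff: "Fa (hclass C P Q f) = hclass C (Fo P) (Fo Q) g"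
      using extend_arr[OF P Q f] by blast
    obtain V k1 k2 r1 r2 where cone': "mapping_cone C (Fo P) (Fo Q) g V k1 k2 r1 r2" and V: "V \<in> cplx_in C \<Y>"
      using ex_cone[OF FO(1,2) g(1)] by blast
    note VC = Y.cplx_in_C[OF V]
    note cone_maps' = mapping_cone_simps(3,4)[OF cone' FC(1,2) g(1)]
    let ?k = "\<lambda>n. k1 n \<cdot> (J P (n + 1) \<cdot> p1 n) \<boxplus> k2 n \<cdot> (J Q n \<cdot> p2 n)"
    note k = null_extending_cone[OF C(1,2) FC(1,2) J[OF P] J[OF Q] ext[OF P] ext[OF Q] f g cone cone']
    obtain d where d: "d \<in> chain_maps C (Fo W) V" "\<And>n. d n \<cdot> J W n = ?k n"
      using extend[OF W V k(1)] by blast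
    have d_iso: "iso_arr Y.K (hclass C (Fo W) V d)"
      by (rule extending_iso[OF C(3) FO(3) V J[OF W] ext[OF W] k d])
    have d_in: "hclass C (Fo W) V d \<in> Hom Y.K (Fo W) V" by (rule Y.K_in[OF FO(3) V d(1)])
    note P' = X.shift_in[OF P]
    obtain g2 where g2: "g2 \<in> chain_maps C (Fo Q) (Fo W)" "\<And>n. g2 n \<cdot> J Q n = J W n \<cdot> i2 n"
        and Fi2: "Fa (hclass C Q W i2) = hclass C (Fo Q) (Fo W) g2"
      using extend_arr[OF Q W cone_maps(1)] by blast
    obtain g3 where g3: "g3 \<in> chain_maps C (Fo W) (Fo (shift_cplx C P))" "\<And>n. g3 n \<cdot> J W n = J (shift_cplx C P) n \<cdot> p1 n"
        and Fp1: "Fa (hclass C W (shift_cplx C P) p1) = hclass C (Fo W) (Fo (shift_cplx C P)) g3"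
      using extend_arr[OF W P' cone_maps(2)] by blast
    note SFP = Y.shift_in[OF FO(1)]
    note [simp] = J_simps[OF P] J_simps[OF Q] J_simps[OF W] J_simps[OF P']
      biproduct_simps[OF mapping_cone_simps(1)[OF cone C(1,2) f]]
      biproduct_simps[OF mapping_cone_simps(1)[OF cone' FC(1,2) g(1)]]
      chain_simps(1-3)[OF d(1) FC(3) VC] chain_simps(1-3)[OF g2(1) FC(2,3)]
      chain_simps(1-3)[OF g3(1) FC(3) Y.cplx_in_C[OF Fo[OF P']]]
      chain_simps(1-3)[OF e[OF P] Y.cplx_in_C[OF Fo[OF P']] Y.cplx_in_C[OF SFP]]
    have d_i2: "hclass C (Fo W) V d \<cdot>\<^bsub>Y.K\<^esub> Fa (hclass C Q W i2) = hclass C (Fo Q) V k2"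
      unfolding Fi2 Y.K_Comp[OF FO(2,3) V g2(1) d(1)]
    proof (rule unique_strict[OF Q V Y.chain_Comp_in[OF g2(1) d(1) FO(2,3) V] cone_maps'(1)])
      fix n
      have "d n \<cdot> g2 n \<cdot> J Q n = (d n \<cdot> J W n) \<cdot> i2 n" by (simp add: comp_assoc g2(2))
      also have "\<dots> = k2 n \<cdot> J Q n" unfolding d(2) by (simp add: distrib)
      finally show "d n \<cdot> g2 n \<cdot> J Q n = k2 n \<cdot> J Q n" .
    qed
    \<comment> \<open>\<open>\<eta>\<close> intervenes because the third arrow of the image triangle
      ends in \<open>Fo\<close> of \<open>P[1]\<close>, but that of the cone in the shift of
      \<open>Fo P\<close>.\<close>
    have d_p1: "hclass C V (shift_cplx C (Fo P)) r1 \<cdot>\<^bsub>Y.K\<^esub> hclass C (Fo W) V d =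
        \<eta> P \<cdot>\<^bsub>Y.K\<^esub> Fa (hclass C W (shift_cplx C P) p1)"
      unfolding Fp1 \<eta>_def Y.K_Comp[OF FO(3) V SFP d(1) cone_maps'(2)] Y.K_Comp[OF FO(3) Fo[OF P'] SFP g3(1) e[OF P]]
    proof (rule unique_strict[OF W SFP Y.chain_Comp_in[OF d(1) cone_maps'(2) FO(3) V SFP]
          Y.chain_Comp_in[OF g3(1) e[OF P] FO(3) Fo[OF P'] SFP]])
      fix n
      have "e P n \<cdot> g3 n \<cdot> J W n = (e P n \<cdot> J (shift_cplx C P) n) \<cdot> p1 n" by (simp add: comp_assoc g3(2))
      also have "\<dots> = r1 n \<cdot> (d n \<cdot> J W n)" unfolding d(2) by (simp add: distrib eJ[OF P])
      finally show "r1 n \<cdot> d n \<cdot> J W n = e P n \<cdot> g3 n \<cdot> J W n" by (simp add: comp_assoc)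
    qed
    have f_in: "hclass C P Q f \<in> Hom X.K P Q" and i2_in: "hclass C Q W i2 \<in> Hom X.K Q W"
      and p1_in: "hclass C W (shift_cplx C P) p1 \<in> Hom X.K W (shift_cplx C P)"
      using X.K_in P Q W P' f cone_maps by blast+
    have r1_in: "hclass C V (shift_cplx C (Fo P)) r1 \<in> Hom Y.K V (shift_cplx C (Fo P))"
      and k2_in: "hclass C (Fo Q) V k2 \<in> Hom Y.K (Fo Q) V"
      using Y.K_in[OF V SFP cone_maps'(2)] Y.K_in[OF FO(2) V cone_maps'(1)] .
    \<comment> \<open>The image of the given isomorphism onto the cone \<open>W\<close>, followed by
      the comparison of \<open>Fo W\<close> with the cone \<open>V\<close> of
      \<open>g\<close>.\<close>
    define c2 where "c2 = hclass C (Fo W) V d \<cdot>\<^bsub>Y.K\<^esub> Fa c"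
    have c2_in: "c2 \<in> Hom Y.K (Fo Z) V" unfolding c2_def by (rule KY.Comp_in[OF F_in[OF c] d_in])
    have sa: "shift_harr (full_subcategory C \<X>) a \<in> Hom X.K (shift_cplx C X) (shift_cplx C P)"
      by (rule X.shift_harr_in[OF a])
    have sFa: "shift_harr (full_subcategory C \<Y>) (Fa a) \<in> Hom Y.K (shift_cplx C (Fo X)) (shift_cplx C (Fo P))"
      by (rule Y.shift_harr_in[OF F_in[OF a]])
    have Dom_u: "Dom X.K u = X" using u by (simp add: Hom_def)
    have 1: "Fa b \<cdot>\<^bsub>Y.K\<^esub> Fa u = hclass C (Fo P) (Fo Q) g \<cdot>\<^bsub>Y.K\<^esub> Fa a"
      using F_Comp[OF u b] F_Comp[OF a f_in] eq(1) Ff by metis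
    have "c2 \<cdot>\<^bsub>Y.K\<^esub> Fa v = hclass C (Fo W) V d \<cdot>\<^bsub>Y.K\<^esub> Fa (c \<cdot>\<^bsub>X.K\<^esub> v)"
      unfolding c2_def F_Comp[OF v c] by (rule KY.Comp_assoc[OF F_in[OF v] F_in[OF c] d_in])
    also have "\<dots> = hclass C (Fo W) V d \<cdot>\<^bsub>Y.K\<^esub> (Fa (hclass C Q W i2) \<cdot>\<^bsub>Y.K\<^esub> Fa b)"
      unfolding eq(2) F_Comp[OF b i2_in] by (rule refl)
    also have "\<dots> = hclass C (Fo Q) V k2 \<cdot>\<^bsub>Y.K\<^esub> Fa b"
      using KY.Comp_assoc[OF F_in[OF b] F_in[OF i2_in] d_in] d_i2 by metis
    finally have 2: "c2 \<cdot>\<^bsub>Y.K\<^esub> Fa v = hclass C (Fo Q) V k2 \<cdot>\<^bsub>Y.K\<^esub> Fa b" .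
    \<comment> \<open>Naturality of \<open>\<eta>\<close> exchanges the shift of \<open>Fa a\<close>
      for the image of the shift of \<open>a\<close>, so that \<open>eq(3)\<close> becomes
      applicable under \<open>Fa\<close>.\<close>
    have "shift_harr (full_subcategory C \<Y>) (Fa a) \<cdot>\<^bsub>Y.K\<^esub> (\<eta> X \<cdot>\<^bsub>Y.K\<^esub> Fa w) =
        \<eta> P \<cdot>\<^bsub>Y.K\<^esub> Fa (shift_harr (full_subcategory C \<X>) a) \<cdot>\<^bsub>Y.K\<^esub> Fa w"
      using KY.Comp_assoc[OF F_in[OF w] \<eta>_in[OF X] sFa] \<eta>_nat[OF a] by metis
    also have "\<dots> = \<eta> P \<cdot>\<^bsub>Y.K\<^esub> Fa (shift_harr (full_subcategory C \<X>) a \<cdot>\<^bsub>X.K\<^esub> w)"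
      unfolding F_Comp[OF w sa] by (rule KY.Comp_assoc[OF F_in[OF w] F_in[OF sa] \<eta>_in[OF P]])
    also have "\<dots> = \<eta> P \<cdot>\<^bsub>Y.K\<^esub> (Fa (hclass C W (shift_cplx C P) p1) \<cdot>\<^bsub>Y.K\<^esub> Fa c)"
      unfolding eq(3) F_Comp[OF c p1_in] by (rule refl)
    also have "\<dots> = hclass C V (shift_cplx C (Fo P)) r1 \<cdot>\<^bsub>Y.K\<^esub> hclass C (Fo W) V d \<cdot>\<^bsub>Y.K\<^esub> Fa c"
      using KY.Comp_assoc[OF F_in[OF c] F_in[OF p1_in] \<eta>_in[OF P]] d_p1 by metis
    also have "\<dots> = hclass C V (shift_cplx C (Fo P)) r1 \<cdot>\<^bsub>Y.K\<^esub> c2"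
      unfolding c2_def by (rule KY.Comp_assoc[OF F_in[OF c] d_in r1_in])
    finally have 3: "shift_harr (full_subcategory C \<Y>) (Fa a) \<cdot>\<^bsub>Y.K\<^esub> (\<eta> X \<cdot>\<^bsub>Y.K\<^esub> Fa w) =
        hclass C V (shift_cplx C (Fo P)) r1 \<cdot>\<^bsub>Y.K\<^esub> c2" .
    have isos: "iso_arr Y.K (Fa a)" "iso_arr Y.K (Fa b)" "iso_arr Y.K c2"
      using functor_iso[OF is_functor_Fa X.category_K a iso(1)] functor_iso[OF is_functor_Fa X.category_K b iso(2)]
        KY.iso_arr_Comp[OF F_in[OF c] functor_iso[OF is_functor_Fa X.category_K c iso(3)] d_in d_iso]
      unfolding c2_def .
    have \<eta>w: "\<eta> X \<cdot>\<^bsub>Y.K\<^esub> Fa w \<in> Hom Y.K (Fo Z) (shift_cplx C (Fo X))"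
      by (rule KY.Comp_in[OF F_in[OF w] \<eta>_in[OF X]])
    show ?thesis
      unfolding Dom_u
      by (rule Y.K_DistI[OF F_in[OF u] F_in[OF v] \<eta>w FO(1,2) V g(1) cone' F_in[OF a] F_in[OF b] c2_in isos 1 2 3])
  qed
  have tri: "triangle_functor X.K Y.K Fo Fa \<eta>"
    unfolding triangle_functor_def homotopy_category_simps(10)
    by (rule conjI[OF additive_functor_Fa conjI[OF nat]], (rule allI)+, rule impI, rule dist)
  show ?thesis
    unfolding triangle_equivalent_def
    by (rule exI[where x = Fo], rule exI[where x = Fa], rule exI[where x = \<eta>], rule conjI[OF tri equivalence])
qed

end

theorem theoremA:
  fixes A :: "('o, 'm) precat" and \<X> \<Y> :: "'o set"
  assumes "abelian_category A"
    and "additive_subcategory A \<X>"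
    and "additive_subcategory A \<Y>"
    and "admissible_balanced_pair A \<X> \<Y>"
    and "finite_dimension A \<X> \<Y>"
  shows "triangle_equivalent (homotopy_category (full_subcategory A \<X>))
                             (homotopy_category (full_subcategory A \<Y>))"
proof -
  interpret abelian_category A by fact
  have bp: "balanced_pair A \<X> \<Y>" and adm: "admissible A \<X>"
    using assms(4) by (simp_all add: admissible_balanced_pair_def)
  have dim: "res_dim A \<X> < \<infinity>" "cores_dim A \<Y> < \<infinity>"
    using assms(5) unfolding finite_dimension_def by blast+
  \<comment> \<open>The implication stands inside the quantifiers so that the choice yields total
    functions \<open>Fo\<close> and \<open>J\<close>.\<close>
  have "\<forall>P. \<exists>T j. P \<in> cplx_in A \<X> \<longrightarrow> T \<in> cplx_in A \<Y> \<and> j \<in> chain_maps A P T \<and>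
      null_extending A \<Y> P T j \<and> homotopy_lifting A \<X> P T j"
    using ex_coresolution_complex[OF assms(3) bp adm dim(2)] by (simp add: cplx_in_def) blast
  then obtain Fo J where FJ: "\<And>P. P \<in> cplx_in A \<X> \<Longrightarrow> Fo P \<in> cplx_in A \<Y> \<and> J P \<in> chain_maps A P (Fo P) \<and>
      null_extending A \<Y> P (Fo P) (J P) \<and> homotopy_lifting A \<X> P (Fo P) (J P)"
    by metis
  interpret coresolution_functor A \<X> \<Y> Fo J
  proof unfold_locales
    show "\<X> \<subseteq> Ob A" "\<Y> \<subseteq> Ob A" using additive_subcategoryD(1)[OF assms(2)] additive_subcategoryD(1)[OF assms(3)] by blast+
    show "\<exists>s \<in> \<Y>. \<exists>i1 i2 p1 p2. biproduct A a b s i1 i2 p1 p2" if "a \<in> \<Y>" "b \<in> \<Y>" for a b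
      using ex_biproduct[of a b] additive_subcategoryD(1,2)[OF assms(3)] that by metis
    show "\<exists>P \<in> cplx_in A \<X>. \<exists>k \<in> chain_maps A P Q. homotopy_extending A \<Y> P Q k" if "Q \<in> cplx_in A \<Y>" for Q
      using ex_resolution_complex[OF assms(2) bp adm dim(1)] that by (simp add: cplx_in_def)
  qed (use FJ in blast)+
  show ?thesis by (rule triangle_equivalent)
qed

end
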